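(* Let $n$ be the rank of $\mathfrak o_N$, so that $N=2n$ or $N=2n+1$. In the orthogonal twisted $q$-Yangian $\mathrm Y^{\rm tw}_q(\mathfrak o_N)$ the series $c(u)=\gamma_N(u)^{-1}\,\mathrm{sdet}\,S(u)$ is given by $$c(u)=\sum_{p\in\mathfrak S_N}(-q)^{-l(p)+l(p')}\;\bar s^{\,t}_{p_1p'_1}(u^{-1})\cdots\bar s^{\,t}_{p_np'_n}(q^{2n-2}u^{-1})\; s_{p_{n+1}p'_{n+1}}(q^{-2n}u)\cdots s_{p_Np'_N}(q^{-2N+2}u),$$ where $p'=\pi_N(p)$, $\bar s^{\,t}_{ij}(u)=\bar s_{ji}(u)$ are the entries of the transposed matrix $\overline S^{\,t}(u)$, and $l(\cdot)$ is the length (number of inversions) of a permutation.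
   Context: Fix $q\in\mathbb C$, nonzero and not a root of unity. $E_{ij}$ are the matrix units of $\mathrm{End}\,\mathbb C^N$; a matrix $M=(m_{ij})$ over an algebra is identified with $\sum m_{ij}\otimes E_{ij}$, $M^t$ is its transpose; subscripts indicate the copies of $\mathrm{End}\,\mathbb C^N$ in which an element acts. Let $$R(u,v)=(u-v)\sum_{i\ne j}E_{ii}\otimes E_{jj}+(q^{-1}u-qv)\sum_iE_{ii}\otimes E_{ii}+(q^{-1}-q)u\sum_{i>j}E_{ij}\otimes E_{ji}+(q^{-1}-q)v\sum_{i<j}E_{ij}\otimes E_{ji},$$ and let $R^t(u,v)$ be obtained from it by transposition in the first tensor factor. $\mathrm U_q(\widehat{\mathfrak{gl}}_N)$ is generated by $t_{ij}^{(r)},\bar t_{ij}^{\,(r)}$ ($1\le i,j\le N$, $r\ge0$). With $t_{ij}(u)=\sum_{r\ge0}t_{ij}^{(r)}u^{-r}$, $\bar t_{ij}(u)=\sum_{r\ge0}\bar t_{ij}^{\,(r)}u^{r}$, $T(u)=(t_{ij}(u))$, $\overline T(u)=(\bar t_{ij}(u))$, the defining relations are: $t_{ij}^{(0)}=\bar t_{ji}^{\,(0)}=0$ for $i<j$; $t_{ii}^{(0)}\bar t_{ii}^{\,(0)}=\bar t_{ii}^{\,(0)}t_{ii}^{(0)}=1$; $R(u,v)T_1(u)T_2(v)=T_2(v)T_1(u)R(u,v)$; $R(u,v)\overline T_1(u)\overline T_2(v)=\overline T_2(v)\overline T_1(u)R(u,v)$; $R(u,v)\overline T_1(u)T_2(v)=T_2(v)\overline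 T_1(u)R(u,v)$. Let $S(u)=T(u)\,\overline T(u^{-1})^t=(s_{ij}(u))$ (series in $u^{-1}$) and $\overline S(u)=\overline T(u)\,T(u^{-1})^t=(\bar s_{ij}(u))$ (series in $u$). $\mathrm Y^{\rm tw}_q(\mathfrak o_N)$ is the subalgebra of $\mathrm U_q(\widehat{\mathfrak{gl}}_N)$ generated by the coefficients of all $s_{ij}(u)$; it also contains the coefficients of the $\bar s_{ij}(u)$. Sklyanin determinant: let $P^q=\sum_iE_{ii}\otimes E_{ii}+q\sum_{i>j}E_{ij}\otimes E_{ji}+q^{-1}\sum_{i<j}E_{ij}\otimes E_{ji}$. The assignment $(i,i+1)\mapsto P^q_{i,i+1}$ defines an action $\sigma\mapsto P^q_\sigma$ of $\mathfrak S_N$ on $(\mathbb C^N)^{\otimes N}$; put $A^q_N=\sum_{\sigma\in\mathfrak S_N}\mathrm{sgn}\,\sigma\cdot P^q_\sigma$. With $u_i=q^{-2i+2}u$ and $R^t_{ij}=R^t_{ij}(u_i^{-1},u_j)$, the product $$A^q_N\,S_1(u_1)R^t_{12}\cdots R^t_{1N}\,S_2(u_2)R^t_{23}\cdots R^t_{2N}\,S_3(u_3)\cdots R^t_{N-1,N}\,S_N(u_N)$$ equals $A^q_N$ times a series, denoted $\mathrm{sdet}\,S(u)$, with coefficients in $\mathrm Y^{\rm tw}_q(\mathfrak o_N)$. Put $\gamma_N(u)=\prod_{1\le i<j\le N}(q^{2i-2}u^{-1}-q^{-2j+2}u)$, whose inverse is expanded as a series in $u^{-1}$. The map $\pi_N:\mathfrak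 S_N\to\mathfrak S_N$, $p\mapsto p'$ ($N\ge2$): permutations are written as sequences $p=(p_1,\dots,p_N)$. For a set $\Omega=\{\omega_1<\dots<\omega_m\}$ of integers, $m\ge3$, define a map $f_\Omega$ on ordered pairs of distinct elements of $\Omega$ by $(\omega_k,\omega_l)\mapsto(\omega_l,\omega_k)$ for $k,l<m$; $(\omega_k,\omega_m)\mapsto(\omega_{m-1},\omega_k)$ and $(\omega_m,\omega_k)\mapsto(\omega_k,\omega_{m-1})$ for $k<m-1$; $(\omega_{m-1},\omega_m)\mapsto(\omega_{m-1},\omega_{m-2})$; $(\omega_m,\omega_{m-1})\mapsto(\omega_{m-1},\omega_{m-2})$. Given $p$, set $p'_N=N$, $\Omega_1=\{1,\dots,N\}$, and for $i=1,2,\dots$, as long as $|\Omega_i|\ge3$, set $(p'_i,p'_{N-i})=f_{\Omega_i}(p_i,p_{N-i+1})$ and $\Omega_{i+1}=\Omega_i\setminus\{p_i,p_{N-i+1}\}$. If $N=2n$ is even, the last set $\Omega_n$ has two elements and $p'_n$ is the smaller of them (so $\pi_2$ sends every permutation to the identity). *)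

theory Defs
  imports
    Complex_Main
    "HOL-Library.FuncSet"
    "HOL-Library.Poly_Mapping"
    "HOL-Computational_Algebra.Formal_Laurent_Series"
    "HOL-Combinatorics.Permutations"
    "HOL-Algebra.QuotRing"
    "HOL-Algebra.Generated_Rings"
begin

section \<open>The free algebra on the generators\<close>

text \<open>\<open>GenT i j r\<close> is $t_{ij}^{(r)}$ and \<open>GenTbar i j r\<close> is $\bar t_{ij}^{(r)}$.\<close>

datatype uq_gen = GenT nat nat nat | GenTbar nat nat nat

text \<open>Words form an additively written monoid (concatenation), so that the convolution product
  of \<open>poly_mapping\<close> makes the finitely supported functions on words the free unital associative
  complex algebra.\<close>

datatype uq_word = Word (letters: "uq_gen list")

instantiation uq_word :: monoid_add
begin
definition zero_uq_word :: uq_word where "0 = Word []"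
definition plus_uq_word :: "uq_word \<Rightarrow> uq_word \<Rightarrow> uq_word"
  where "v + w = Word (letters v @ letters w)"
instance by standard (simp_all add: zero_uq_word_def plus_uq_word_def)
end

type_synonym free_alg = "uq_word \<Rightarrow>\<^sub>0 complex"

definition gen :: "uq_gen \<Rightarrow> free_alg"
  where "gen g = Poly_Mapping.single (Word [g]) 1"

definition scal :: "complex \<Rightarrow> free_alg"
  where "scal c = Poly_Mapping.single 0 c"

definition t_ser :: "nat \<Rightarrow> nat \<Rightarrow> free_alg fps" \<comment> \<open>$t_{ij}(u)$, as a power series in $u^{-1}$\<close>
  where "t_ser i j = Abs_fps (\<lambda>r. gen (GenT i j r))"

definition tbar_ser :: "nat \<Rightarrow> nat \<Rightarrow> free_alg fps" \<comment> \<open>$\bar t_{ij}(u)$, as a power series in $u$\<close>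
  where "tbar_ser i j = Abs_fps (\<lambda>r. gen (GenTbar i j r))"


section \<open>Operators on tensor powers\<close>

text \<open>An element of $B \otimes (\mathrm{End}\, C^N)^{\otimes m}$ is given by its matrix entries in the
  basis of multi-indices \<open>a\<close>, where \<open>a k\<close> belongs to the \<open>k\<close>-th copy of $C^N$.\<close>

type_synonym 'b oper = "(nat \<Rightarrow> nat) \<Rightarrow> (nat \<Rightarrow> nat) \<Rightarrow> 'b"

definition multi_idx :: "nat \<Rightarrow> nat \<Rightarrow> (nat \<Rightarrow> nat) set"
  where "multi_idx N m = ({1..m} \<rightarrow>\<^sub>E {1..N})"

definition op_mult :: "nat \<Rightarrow> nat \<Rightarrow> 'b::ring_1 oper \<Rightarrow> 'b oper \<Rightarrow> 'b oper"
  where "op_mult N m A B = (\<lambda>a c. \<Sum>b\<in>multi_idx N m. A a b * B b c)"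

definition op_one :: "'b::ring_1 oper"
  where "op_one = (\<lambda>a b. if a = b then 1 else 0)"

definition op_prod :: "nat \<Rightarrow> nat \<Rightarrow> 'b::ring_1 oper list \<Rightarrow> 'b oper"
  where "op_prod N m As = foldr (op_mult N m) As op_one"

definition in_copy :: "nat \<Rightarrow> nat \<Rightarrow> (nat \<Rightarrow> nat \<Rightarrow> 'b::ring_1) \<Rightarrow> 'b oper"
  where "in_copy m k M = (\<lambda>a b. if \<forall>r\<in>{1..m} - {k}. a r = b r then M (a k) (b k) else 0)"

text \<open>Elements of $B \otimes \mathrm{End}\, C^N \otimes \mathrm{End}\, C^N$ are given by functions \<open>M\<close> with
  \<open>M i j k l\<close> the coefficient of $E_{ij} \otimes E_{kl}$.\<close>

definition in_copies ::
    "nat \<Rightarrow> nat \<Rightarrow> nat \<Rightarrow> (nat \<Rightarrow> nat \<Rightarrow> nat \<Rightarrow> nat \<Rightarrow> 'b::ring_1) \<Rightarrow> 'b oper"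
  where "in_copies m k l M =
    (\<lambda>a b. if \<forall>r\<in>{1..m} - {k, l}. a r = b r then M (a k) (b k) (a l) (b l) else 0)"

text \<open>In the following \<open>Q\<close> and \<open>Q'\<close> are the images of $q$ and $q^{-1}$ in the coefficient ring.\<close>

definition R_mat :: "'b::ring_1 \<Rightarrow> 'b \<Rightarrow> 'b \<Rightarrow> 'b \<Rightarrow> nat \<Rightarrow> nat \<Rightarrow> nat \<Rightarrow> nat \<Rightarrow> 'b"
  where "R_mat Q Q' u v i j k l =
      (if i = j \<and> k = l \<and> i \<noteq> k then u - v else 0)
    + (if i = j \<and> k = l \<and> i = k then Q' * u - Q * v else 0)
    + (if k = j \<and> l = i \<and> i > j then (Q' - Q) * u else 0)
    + (if k = j \<and> l = i \<and> i < j then (Q' - Q) * v else 0)"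

definition Rt_mat :: "'b::ring_1 \<Rightarrow> 'b \<Rightarrow> 'b \<Rightarrow> 'b \<Rightarrow> nat \<Rightarrow> nat \<Rightarrow> nat \<Rightarrow> nat \<Rightarrow> 'b"
  where "Rt_mat Q Q' u v i j k l = R_mat Q Q' u v j i k l"

definition Pq_mat :: "'b::ring_1 \<Rightarrow> 'b \<Rightarrow> nat \<Rightarrow> nat \<Rightarrow> nat \<Rightarrow> nat \<Rightarrow> 'b"
  where "Pq_mat Q Q' i j k l =
      (if i = j \<and> k = l \<and> i = k then 1 else 0)
    + (if k = j \<and> l = i \<and> i > j then Q else 0)
    + (if k = j \<and> l = i \<and> i < j then Q' else 0)"

text \<open>$P^q_\sigma$ is computed from an arbitrary factorization of $\sigma$ into adjacent
  transpositions; the choice does not matter because these operators define an action.\<close>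

definition Pq_perm :: "nat \<Rightarrow> 'b::ring_1 \<Rightarrow> 'b \<Rightarrow> (nat \<Rightarrow> nat) \<Rightarrow> 'b oper"
  where "Pq_perm N Q Q' \<sigma> =
    op_prod N N (map (\<lambda>i. in_copies N i (Suc i) (Pq_mat Q Q'))
      (SOME is. set is \<subseteq> {1..<N} \<and> foldr (\<lambda>i \<tau>. transpose i (Suc i) \<circ> \<tau>) is id = \<sigma>))"

definition q_antisym :: "nat \<Rightarrow> 'b::ring_1 \<Rightarrow> 'b \<Rightarrow> 'b oper" \<comment> \<open>$A^q_N$\<close>
  where "q_antisym N Q Q' =
    (\<lambda>a b. \<Sum>\<sigma> | \<sigma> permutes {1..N}. of_int (sign \<sigma>) * Pq_perm N Q Q' \<sigma> a b)"


section \<open>The quantum affine algebra\<close>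

text \<open>Series in two formal variables live in \<open>free_alg fls fls\<close>: the inner variable stands for
  $u$ or $u^{-1}$, the outer one for $v$ or $v^{-1}$, whichever has nonnegative exponents in the
  series of generators involved.\<close>

definition inner_ser :: "free_alg fps \<Rightarrow> free_alg fls fls"
  where "inner_ser f = fls_const (fps_to_fls f)"

definition outer_ser :: "free_alg fps \<Rightarrow> free_alg fls fls"
  where "outer_ser f = fps_to_fls (Abs_fps (\<lambda>r. fls_const (fps_nth f r)))"

definition RTT_defect ::
    "complex \<Rightarrow> nat \<Rightarrow> free_alg fls fls \<Rightarrow> free_alg fls fls \<Rightarrow> (nat \<Rightarrow> nat \<Rightarrow> free_alg fps) \<Rightarrow>
     (nat \<Rightarrow> nat \<Rightarrow> free_alg fps) \<Rightarrow> free_alg fls fls oper"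
  \<comment> \<open>$R(u,v) A_1(u) B_2(v) - B_2(v) A_1(u) R(u,v)$\<close>
  where "RTT_defect q N u v A B =
    (let R = in_copies 2 1 2 (R_mat (fls_const (fls_const (scal q)))
                                    (fls_const (fls_const (scal (inverse q)))) u v);
         A1 = in_copy 2 1 (\<lambda>i j. inner_ser (A i j));
         B2 = in_copy 2 2 (\<lambda>i j. outer_ser (B i j))
     in (\<lambda>a b. op_prod N 2 [R, A1, B2] a b - op_prod N 2 [B2, A1, R] a b))"

definition coeffs2 :: "nat \<Rightarrow> free_alg fls fls oper \<Rightarrow> free_alg set"
  where "coeffs2 N D =
    {fls_nth (fls_nth (D a b) k) l | a b k l. a \<in> multi_idx N 2 \<and> b \<in> multi_idx N 2}"

text \<open>The generators with an index outside \<open>{1..N}\<close> do not belong to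
  $U_q(\widehat{\mathfrak{gl}}_N)$; the first two sets remove them.\<close>

definition uq_relations :: "complex \<Rightarrow> nat \<Rightarrow> free_alg set"
  where "uq_relations q N =
      {gen (GenT i j r) | i j r. i \<notin> {1..N} \<or> j \<notin> {1..N}}
    \<union> {gen (GenTbar i j r) | i j r. i \<notin> {1..N} \<or> j \<notin> {1..N}}
    \<union> {gen (GenT i j 0) | i j. i \<in> {1..N} \<and> j \<in> {1..N} \<and> i < j}
    \<union> {gen (GenTbar j i 0) | i j. i \<in> {1..N} \<and> j \<in> {1..N} \<and> i < j}
    \<union> {gen (GenT i i 0) * gen (GenTbar i i 0) - 1 | i. i \<in> {1..N}}
    \<union> {gen (GenTbar i i 0) * gen (GenT i i 0) - 1 | i. i \<in> {1..N}}
    \<union> coeffs2 N (RTT_defect q N (fls_const fls_X_inv) fls_X_inv t_ser t_ser)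
    \<union> coeffs2 N (RTT_defect q N (fls_const fls_X) fls_X tbar_ser tbar_ser)
    \<union> coeffs2 N (RTT_defect q N (fls_const fls_X) fls_X_inv tbar_ser t_ser)"

definition free_ring :: "free_alg ring"
  where "free_ring = \<lparr>carrier = UNIV, mult = (*), one = 1, zero = 0, add = (+)\<rparr>"

lemma ring_free_ring: "ring free_ring"
proof (rule ringI)
  show "abelian_group free_ring"
  proof (rule abelian_groupI)
    fix x :: free_alg
    show "\<exists>y\<in>carrier free_ring. y \<oplus>\<^bsub>free_ring\<^esub> x = \<zero>\<^bsub>free_ring\<^esub>"
      by (rule bexI[of _ "- x"]) (simp_all add: free_ring_def)
  qed (simp_all add: free_ring_def add_ac)
  show "monoid free_ring"
    by (rule monoidI) (simp_all add: free_ring_def mult.assoc)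
qed (simp_all add: free_ring_def algebra_simps)

definition uq_ideal :: "complex \<Rightarrow> nat \<Rightarrow> free_alg set"
  where "uq_ideal q N = Idl\<^bsub>free_ring\<^esub> (uq_relations q N)"

definition Uq :: "complex \<Rightarrow> nat \<Rightarrow> free_alg set ring"
  where "Uq q N = free_ring Quot (uq_ideal q N)"

definition uq_class :: "complex \<Rightarrow> nat \<Rightarrow> free_alg \<Rightarrow> free_alg set"
  where "uq_class q N x = uq_ideal q N +>\<^bsub>free_ring\<^esub> x"

text \<open>From here on the variable of \<open>free_alg fls\<close> is $u^{-1}$. Laurent series over \<open>Uq q N\<close> are
  represented by Laurent series over the free algebra; \<open>uq_series\<close> is the image of such a
  representative, so that equality of images is equality over \<open>Uq q N\<close>.\<close>

definition uq_series :: "complex \<Rightarrow> nat \<Rightarrow> free_alg fls \<Rightarrow> int \<Rightarrow> free_alg set"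
  where "uq_series q N f = (\<lambda>k. uq_class q N (fls_nth f k))"


section \<open>The twisted q-Yangian and the Sklyanin determinant\<close>

definition s_ser :: "nat \<Rightarrow> nat \<Rightarrow> nat \<Rightarrow> free_alg fps" \<comment> \<open>$s_{ij}(u)$, as a power series in $u^{-1}$\<close>
  where "s_ser N i j = (\<Sum>k=1..N. t_ser i k * tbar_ser j k)"

definition sbar_ser :: "nat \<Rightarrow> nat \<Rightarrow> nat \<Rightarrow> free_alg fps" \<comment> \<open>$\bar s_{ij}(u)$, as a power series in $u$\<close>
  where "sbar_ser N i j = (\<Sum>k=1..N. tbar_ser i k * t_ser j k)"

definition sbar_t_ser :: "nat \<Rightarrow> nat \<Rightarrow> nat \<Rightarrow> free_alg fps"
  where "sbar_t_ser N i j = sbar_ser N j i"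

text \<open>The power series \<open>f\<close> with its variable replaced by $c u^{-1}$: it is $s_{ij}(c^{-1}u)$ for
  \<open>f = s_ser N i j\<close> and $\bar s_{ij}(c u^{-1})$ for \<open>f = sbar_ser N i j\<close>.\<close>

definition subst_ser :: "complex \<Rightarrow> free_alg fps \<Rightarrow> free_alg fls"
  where "subst_ser c f = fps_to_fls (Abs_fps (\<lambda>r. scal (c ^ r) * fps_nth f r))"

definition Ytw :: "complex \<Rightarrow> nat \<Rightarrow> free_alg set set"
  where "Ytw q N = generate_ring (Uq q N)
    (range (\<lambda>c. uq_class q N (scal c))
     \<union> {uq_class q N (fps_nth (s_ser N i j) r) | i j r. i \<in> {1..N} \<and> j \<in> {1..N}})"

definition scal_fls :: "complex \<Rightarrow> free_alg fls"
  where "scal_fls c = fls_const (scal c)"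

definition sdet_product :: "complex \<Rightarrow> nat \<Rightarrow> free_alg fls oper"
  where "sdet_product q N =
    (let Q = scal_fls q; Q' = scal_fls (inverse q);
         u = (\<lambda>i. scal_fls (q powi (2 - 2 * int i)) * fls_X_inv);
         u_inv = (\<lambda>i. scal_fls (q powi (2 * int i - 2)) * fls_X);
         S = (\<lambda>i. in_copy N i (\<lambda>j k. subst_ser (q powi (2 * int i - 2)) (s_ser N j k)));
         Rt = (\<lambda>i j. in_copies N i j (Rt_mat Q Q' (u_inv i) (u j)))
     in op_prod N N
          (q_antisym N Q Q' # concat (map (\<lambda>i. S i # map (Rt i) [Suc i..<Suc N]) [1..<Suc N])))"

definition is_sdet :: "complex \<Rightarrow> nat \<Rightarrow> free_alg fls \<Rightarrow> bool"
  where "is_sdet q N D \<longleftrightarrow>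
    (\<forall>k. uq_series q N D k \<in> Ytw q N) \<and>
    (\<forall>a\<in>multi_idx N N. \<forall>b\<in>multi_idx N N.
       uq_series q N (sdet_product q N a b) =
       uq_series q N (q_antisym N (scal_fls q) (scal_fls (inverse q)) a b * D))"

text \<open>A representative: its image under \<open>uq_series\<close> is uniquely determined, since $A^q_N$ has
  nonzero scalar entries.\<close>

definition sdet :: "complex \<Rightarrow> nat \<Rightarrow> free_alg fls"
  where "sdet q N = (SOME D. is_sdet q N D)"

definition gamma_N :: "complex \<Rightarrow> nat \<Rightarrow> complex fls"
  where "gamma_N q N = (\<Prod>(i, j) \<in> {(i, j). 1 \<le> i \<and> i < j \<and> j \<le> N}.
    fls_const (q powi (2 * int i - 2)) * fls_X - fls_const (q powi (2 - 2 * int j)) * fls_X_inv)"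

lift_definition fls_scal :: "complex fls \<Rightarrow> free_alg fls"
  is "\<lambda>f k. scal (f k)"
  by (auto simp: scal_def elim: eventually_mono)

definition c_ser :: "complex \<Rightarrow> nat \<Rightarrow> free_alg fls"
  where "c_ser q N = fls_scal (inverse (gamma_N q N)) * sdet q N"


section \<open>The map on permutations\<close>

definition inversions :: "nat \<Rightarrow> (nat \<Rightarrow> nat) \<Rightarrow> nat"
  where "inversions N p = card {(i, j). 1 \<le> i \<and> i < j \<and> j \<le> N \<and> p i > p j}"

text \<open>\<open>x\<close>, \<open>y\<close>, \<open>z\<close> are $\omega_m$, $\omega_{m-1}$, $\omega_{m-2}$.\<close>

definition pair_map :: "nat set \<Rightarrow> nat \<times> nat \<Rightarrow> nat \<times> nat"
  where "pair_map \<Omega> = (\<lambda>(a, b).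
    let w = sorted_list_of_set \<Omega>; m = card \<Omega>;
        x = w ! (m - 1); y = w ! (m - 2); z = w ! (m - 3)
    in if a \<noteq> x \<and> b \<noteq> x then (b, a)
       else if a \<noteq> y \<and> b = x then (y, a)
       else if a = x \<and> b \<noteq> y then (b, y)
       else (y, z))"

text \<open>\<open>omega_set N p k\<close> is $\Omega_{k+1}$.\<close>

fun omega_set :: "nat \<Rightarrow> (nat \<Rightarrow> nat) \<Rightarrow> nat \<Rightarrow> nat set"
  where
    "omega_set N p 0 = {1..N}"
  | "omega_set N p (Suc k) = omega_set N p k - {p (Suc k), p (N - k)}"

text \<open>Since $\Omega_i$ has $N-2i+2$ elements, step \<open>i\<close> is performed iff $2i < N$; it determines
  the values at \<open>i\<close> and \<open>N - i\<close>.\<close>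

definition perm_prime :: "nat \<Rightarrow> (nat \<Rightarrow> nat) \<Rightarrow> nat \<Rightarrow> nat"
  where "perm_prime N p j =
    (let step = (\<lambda>i. pair_map (omega_set N p (i - 1)) (p i, p (N - i + 1)))
     in if j \<notin> {1..N} \<or> j = N then j
        else if 2 * j < N then fst (step j)
        else if 2 * j = N then Min (omega_set N p (j - 1))
        else snd (step (N - j)))"

end

theory Submission
  imports Defs "HOL-Combinatorics.Multiset_Permutations"
begin

text \<open>
  On row vectors that are antisymmetric in the $q$-sense the matrices $R^t_{ij}$ act by scalars, so the
  Sklyanin determinant is $\gamma_N(u)$ times a product of a $q$-minor of $T$ and a $q$-minor of
  $\overline T$. An entry $\bar t_{jd}$ commutes with a $q$-minor of $T$ whose row set contains $j$ and
  whose column set contains $d$. Expanding this product alternately along its last column, which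
  produces an entry of $S$, and along its first column, which produces an entry of $\overline S^t$,
  removes two indices at a time; the bookkeeping of the removed pairs is the recursion that defines
  $\pi_N$.
\<close>

text \<open>The commutation is conditional, and this forces the shape of f_\<Omega>. With row set I,
  every column except the last one, c, must belong to I. Removing c costs a row l. The column l must
  go next, because it no longer has a row; if l is the largest element of I, which is not among the
  columns other than c, the second largest element goes instead. This costs a row k. The column that
  has lost its row (if there is none, the largest column left) becomes the new last column, and the
  configuration has its old form on a set with two elements fewer. The commutation itself comes from
  the exchange relation R_{0m} ... R_{01} X_0 T_1 ... T_m = T_1 ... T_m X_0 R_{0m} ... R_{01}.
  Between q-alternating vectors both sides give the same scalar, which has to be cancelled. For this
  reason the algebra is done over a central field of scalars, the complex Laurent series in u^{-1},
  with u_i = q^{2-2i} u as elements of it. There the scalar is nonzero, because u_i^{-1} and u_j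
  have different degrees. The defining relations in two formal variables must therefore be
  specialized at u_i and u_j beforehand.\<close>

section \<open>Inversions of words and sums over index tuples\<close>

fun inv_list :: "nat list \<Rightarrow> nat" where
  "inv_list [] = 0"
| "inv_list (x # xs) = length (filter (\<lambda>y. y < x) xs) + inv_list xs"

lemma inv_list_append:
  "inv_list (xs @ ys) = inv_list xs + inv_list ys + (\<Sum>x\<leftarrow>xs. length (filter (\<lambda>y. y < x) ys))"
  by (induction xs) auto

lemma inv_list_swap:
  assumes "c < d"
  shows "inv_list (xs @ d # c # ys) = Suc (inv_list (xs @ c # d # ys))"
proof -
  have "(\<Sum>x\<leftarrow>xs. length (filter (\<lambda>y. y < x) (d # c # ys))) = (\<Sum>x\<leftarrow>xs. length (filter (\<lambda>y. y < x) (c # d # ys)))"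
    by (rule arg_cong[where f = sum_list], rule map_cong) auto
  then show ?thesis using assms by (simp only: inv_list_append) simp
qed

lemma inv_list_snoc: "inv_list (xs @ [y]) = inv_list xs + length (filter (\<lambda>x. y < x) xs)"
  by (induction xs) auto

text \<open>Adjacent exchanges bring the first letter of \<open>xs\<close> to the front of
  \<open>ys\<close>, and the tails are treated recursively. Besides ring-valued functions it is also
  applied to a truth-valued \<open>g\<close>, as a reachability argument.\<close>

lemma adjacent_swap_invariant:
  assumes swap: "\<And>xs x y ys. g (xs @ x # y # ys) = g (xs @ y # x # ys)"
    and "mset xs = mset ys"
  shows "g xs = g ys"
proof -
  have move: "g (zs @ xs @ x # ys) = g (zs @ x # xs @ ys)" for zs xs x ys
  proof (induction xs arbitrary: zs)
    case (Cons a xs)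
    show ?case using Cons[of "zs @ [a]"] swap[of zs a x "xs @ ys"] by simp
  qed simp
  have "g (zs @ xs) = g (zs @ ys)" if "mset xs = mset ys" for zs xs ys
    using that
  proof (induction xs arbitrary: zs ys)
    case (Cons x xs)
    then have "x \<in> set ys" by (metis list.set_intros(1) mset_eq_setD)
    then obtain ys1 ys2 where ys: "ys = ys1 @ x # ys2" by (meson split_list)
    with Cons.prems have "mset xs = mset (ys1 @ ys2)" by simp
    from Cons.IH[OF this, of "zs @ [x]"] show ?case using move[of zs ys1 x ys2] ys by simp
  qed simp
  from this[of xs ys "[]"] assms(2) show ?thesis by simp
qed

definition tuples :: "nat \<Rightarrow> nat \<Rightarrow> nat list set" where
  "tuples N m = {xs. set xs \<subseteq> {1..N} \<and> length xs = m}"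

lemma finite_tuples [simp]: "finite (tuples N m)"
  unfolding tuples_def by (rule finite_lists_length_eq) simp

lemma tuples_0 [simp]: "tuples N 0 = {[]}"
  by (auto simp: tuples_def)

lemma tuples_length: "xs \<in> tuples N m \<Longrightarrow> length xs = m"
  by (simp add: tuples_def)

lemma sum_tuples_Suc:
  "(\<Sum>xs\<in>tuples N (Suc m). f xs) = (\<Sum>x\<in>{1..N}. \<Sum>xs\<in>tuples N m. f (x # xs))"
proof -
  have "tuples N (Suc m) = (\<lambda>(x, xs). x # xs) ` ({1..N} \<times> tuples N m)"
    by (auto simp: tuples_def length_Suc_conv image_iff)
  moreover have "inj_on (\<lambda>(x, xs). x # xs) ({1..N} \<times> tuples N m)"
    by (auto simp: inj_on_def)
  ultimately have "(\<Sum>xs\<in>tuples N (Suc m). f xs) = (\<Sum>(x, xs)\<in>{1..N} \<times> tuples N m. f (x # xs))"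
    by (simp only: sum.reindex) (rule sum.cong, auto)
  then show ?thesis by (simp only: sum.cartesian_product)
qed

lemma sum_tuples_add:
  "(\<Sum>xs\<in>tuples N (m + n). f xs) = (\<Sum>xs\<in>tuples N m. \<Sum>ys\<in>tuples N n. f (xs @ ys))"
  by (induction m arbitrary: f) (simp_all add: sum_tuples_Suc)

lemma sum_tuples_snoc:
  "(\<Sum>xs\<in>tuples N (Suc m). f xs) = (\<Sum>xs\<in>tuples N m. \<Sum>x\<in>{1..N}. f (xs @ [x]))"
  using sum_tuples_add[of f N m 1] by (simp add: sum_tuples_Suc)

lemma sum_swap3: "(\<Sum>x\<in>A. \<Sum>y\<in>B. \<Sum>r\<in>C. h x y r) = (\<Sum>r\<in>C. \<Sum>x\<in>A. \<Sum>y\<in>B. h x y r)"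
proof -
  have "(\<Sum>x\<in>A. \<Sum>y\<in>B. \<Sum>r\<in>C. h x y r) = (\<Sum>x\<in>A. \<Sum>r\<in>C. \<Sum>y\<in>B. h x y r)"
    by (rule sum.cong[OF refl], rule sum.swap)
  also have "\<dots> = (\<Sum>r\<in>C. \<Sum>x\<in>A. \<Sum>y\<in>B. h x y r)"
    by (rule sum.swap)
  finally show ?thesis .
qed

text \<open>Pairs each (x, y) with (y, x), so that a q-alternating factor can merge the two terms
  into one.\<close>

lemma sum_pairs_less:
  fixes h :: "nat \<Rightarrow> nat \<Rightarrow> 'a::ab_group_add"
  assumes "finite A" "\<And>x. h x x = 0"
  shows "(\<Sum>x\<in>A. \<Sum>y\<in>A. h x y) = (\<Sum>x\<in>A. \<Sum>y\<in>{y\<in>A. x < y}. h x y + h y x)"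
proof -
  have split: "(\<Sum>y\<in>A. h x y) = (\<Sum>y\<in>{y\<in>A. x < y}. h x y) + (\<Sum>y\<in>{y\<in>A. y < x}. h x y)" for x
  proof -
    have "(\<Sum>y\<in>A. h x y) = (\<Sum>y\<in>{y\<in>A. x < y} \<union> {y\<in>A. y < x}. h x y)"
    proof (rule sum.mono_neutral_right)
      show "\<forall>y\<in>A - ({y \<in> A. x < y} \<union> {y \<in> A. y < x}). h x y = 0"
      proof
        fix y assume "y \<in> A - ({y \<in> A. x < y} \<union> {y \<in> A. y < x})"
        then have "y = x" by auto
        then show "h x y = 0" using assms(2) by simp
      qed
    qed (use assms(1) in auto)
    also have "\<dots> = (\<Sum>y\<in>{y\<in>A. x < y}. h x y) + (\<Sum>y\<in>{y\<in>A. y < x}. h x y)"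
      by (rule sum.union_disjoint) (use assms(1) in auto)
    finally show ?thesis .
  qed
  have "(\<Sum>x\<in>A. \<Sum>y\<in>{y\<in>A. y < x}. h x y) = (\<Sum>x\<in>A. \<Sum>y\<in>{y\<in>A. x < y}. h y x)"
    using sum.swap_restrict[OF assms(1) assms(1), of h "\<lambda>x y. y < x"] .
  then show ?thesis by (simp only: split sum.distrib)
qed

text \<open>The first argument of \<open>M\<close> numbers the tensor copy and with it the parameter
  u_a at which the series are taken; an ordered product therefore runs through consecutive
  parameters.\<close>

primrec prodM :: "(nat \<Rightarrow> nat \<Rightarrow> nat \<Rightarrow> 'l::ring_1) \<Rightarrow> nat \<Rightarrow> nat list \<Rightarrow> nat list \<Rightarrow> 'l" where
  "prodM M a xs [] = 1"
| "prodM M a xs (y # ys) = M a (hd xs) y * prodM M (Suc a) (tl xs) ys"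

lemma prodM_append:
  "length xs = length ys \<Longrightarrow>
   prodM M a (xs @ xs') (ys @ ys') = prodM M a xs ys * prodM M (a + length ys) xs' ys'"
  by (induction xs ys arbitrary: a rule: list_induct2) (simp_all add: mult.assoc)

section \<open>q-alternating functions of index words\<close>

text \<open>Separates a field of scalars from the noncommutative ring of matrix entries, so that a
  nonzero scalar can be cancelled even where that ring has zero divisors.\<close>

locale central_scalars =
  fixes sc :: "'k::field \<Rightarrow> 'l::ring_1"
  assumes sc_1 [simp]: "sc 1 = 1"
    and sc_add: "sc (x + y) = sc x + sc y"
    and sc_mult: "sc (x * y) = sc x * sc y"
    and sc_central: "sc x * z = z * sc x"
begin

lemma sc_0 [simp]: "sc 0 = 0"
  using sc_add[of 0 0] by simp

lemma sc_cancel: "x \<noteq> 0 \<Longrightarrow> sc x * y = sc x * z \<Longrightarrow> y = z"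
  by (metis left_inverse mult.assoc mult_1 sc_1 sc_mult)

lemma sc_left: "y * (sc x * z) = sc x * (y * z)"
  by (metis mult.assoc sc_central)

lemma sc_sc: "sc x * (sc y * z) = sc (x * y) * z"
  by (simp add: sc_mult mult.assoc)

end

locale alternation = central_scalars sc for sc :: "'k::field \<Rightarrow> 'l::ring_1" +
  fixes \<kappa> :: 'k
  assumes kappa_nz: "\<kappa> \<noteq> 0"
begin

text \<open>For \<kappa> = -1/q these are the row vectors on which every P^q_{i,i+1} acts as -1.
  Vanishing on equal neighbours is a separate clause, as the exchange rule speaks of distinct
  letters only.\<close>

definition alternating :: "(nat list \<Rightarrow> 'l) \<Rightarrow> bool" where
  "alternating f \<longleftrightarrow>
     (\<forall>xs c d ys. c < d \<longrightarrow> f (xs @ d # c # ys) = sc \<kappa> * f (xs @ c # d # ys)) \<and>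
     (\<forall>xs c ys. f (xs @ c # c # ys) = 0)"

lemma alternatingI:
  assumes "\<And>xs c d ys. c < d \<Longrightarrow> f (xs @ d # c # ys) = sc \<kappa> * f (xs @ c # d # ys)"
    and "\<And>xs c ys. f (xs @ c # c # ys) = 0"
  shows "alternating f"
  using assms by (simp add: alternating_def)

lemma alternating_swap: "alternating f \<Longrightarrow> c < d \<Longrightarrow> f (xs @ d # c # ys) = sc \<kappa> * f (xs @ c # d # ys)"
  by (simp add: alternating_def)

lemma alternating_same: "alternating f \<Longrightarrow> f (xs @ c # c # ys) = 0"
  by (simp add: alternating_def)

text \<open>An adjacent exchange into decreasing order adds one inversion and one factor \<kappa>;
  the product with the inverse power is thus invariant under every rearrangement.\<close>

lemma alternating_perm_inverse:
  assumes f: "alternating f" and "mset xs = mset ys"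
  shows "sc (inverse \<kappa> ^ inv_list xs) * f xs = sc (inverse \<kappa> ^ inv_list ys) * f ys"
proof -
  define g where "g = (\<lambda>xs. sc (inverse \<kappa> ^ inv_list xs) * f xs)"
  have *: "g (xs @ d # c # ys) = g (xs @ c # d # ys)" if "c < d" for xs c d ys
  proof -
    have "inverse \<kappa> ^ Suc n * \<kappa> = inverse \<kappa> ^ n" for n using kappa_nz by simp
    then show ?thesis
      by (simp only: g_def inv_list_swap[OF that] alternating_swap[OF f that] sc_sc)
  qed
  have "g (xs @ x # y # ys) = g (xs @ y # x # ys)" for xs x y ys
    using *[of x y xs ys] *[of y x xs ys] by (cases x y rule: linorder_cases) simp_all
  from adjacent_swap_invariant[of g, OF this assms(2)] show ?thesis by (simp only: g_def)
qed

lemma alternating_perm: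
  assumes f: "alternating f" and "mset xs = mset ys"
  shows "sc (\<kappa> ^ inv_list ys) * f xs = sc (\<kappa> ^ inv_list xs) * f ys"
proof -
  have kk: "\<kappa> ^ m * \<kappa> ^ n * inverse \<kappa> ^ m = \<kappa> ^ n" "\<kappa> ^ m * \<kappa> ^ n * inverse \<kappa> ^ n = \<kappa> ^ m" for m n
    using kappa_nz by (simp_all add: power_inverse)
  have "sc (\<kappa> ^ inv_list xs * \<kappa> ^ inv_list ys) * (sc (inverse \<kappa> ^ inv_list xs) * f xs) =
        sc (\<kappa> ^ inv_list xs * \<kappa> ^ inv_list ys) * (sc (inverse \<kappa> ^ inv_list ys) * f ys)"
    by (simp only: alternating_perm_inverse[OF assms])
  then show ?thesis by (simp only: sc_sc kk)
qed

text \<open>Bringing two equal letters next to each other changes the value by an invertible scalar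
  only.\<close>

lemma alternating_not_distinct:
  assumes f: "alternating f" and "\<not> distinct xs"
  shows "f xs = 0"
proof -
  from not_distinct_decomp[OF assms(2)] obtain as bs cs y where xs: "xs = as @ [y] @ bs @ [y] @ cs"
    by blast
  then have "mset xs = mset ([] @ y # y # as @ bs @ cs)" by simp
  from alternating_perm[OF f this] have "sc (\<kappa> ^ inv_list ([] @ y # y # as @ bs @ cs)) * f xs = 0"
    using alternating_same[OF f, of "[]" y "as @ bs @ cs"] by simp
  then show ?thesis
    using sc_cancel[of "\<kappa> ^ inv_list ([] @ y # y # as @ bs @ cs)" "f xs" 0] kappa_nz by simp
qed

lemma alternating_eqI:
  assumes f: "alternating f" and g: "alternating g" and "mset xs = mset ys" "f ys = g ys"
  shows "f xs = g xs"
proof -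
  have "sc (\<kappa> ^ inv_list ys) * f xs = sc (\<kappa> ^ inv_list ys) * g xs"
    by (simp only: alternating_perm[OF f assms(3)] alternating_perm[OF g assms(3)] assms(4))
  then show ?thesis by (rule sc_cancel[rotated]) (simp add: kappa_nz)
qed

text \<open>The q-sign of an arrangement of \<open>I\<close>: as a scalar it is the q-alternating
  function supported on these arrangements that is 1 on the increasing one.\<close>

definition wt :: "nat set \<Rightarrow> nat list \<Rightarrow> 'k" where
  "wt I ds = (if distinct ds \<and> set ds = I then \<kappa> ^ inv_list ds else 0)"

lemma alternating_wt: "alternating (\<lambda>ds. sc (wt I ds))"
proof (rule alternatingI)
  fix xs c d ys assume "c < (d::nat)"
  show "sc (wt I (xs @ d # c # ys)) = sc \<kappa> * sc (wt I (xs @ c # d # ys))"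
  proof -
    have "(distinct (xs @ d # c # ys) \<and> set (xs @ d # c # ys) = I) =
          (distinct (xs @ c # d # ys) \<and> set (xs @ c # d # ys) = I)"
      by auto
    then show ?thesis
      unfolding wt_def inv_list_swap[OF \<open>c < d\<close>] by (simp add: sc_mult)
  qed
qed (simp add: wt_def)

text \<open>A first letter k is inverted with exactly the smaller elements of \<open>I\<close>. This
  is the q-sign in the Laplace expansion along the first column; \<open>wt_snoc\<close> gives the
  one for the last column.\<close>

lemma wt_Cons:
  assumes "finite I"
  shows "wt I (k # ks) = (if k \<in> I then \<kappa> ^ card {x\<in>I. x < k} * wt (I - {k}) ks else 0)"
proof (cases "distinct (k # ks) \<and> set (k # ks) = I")
  case True
  then have "length (filter (\<lambda>y. y < k) ks) = card {x\<in>I. x < k}"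
    by (subst distinct_card[symmetric]) (auto intro!: arg_cong[where f = card])
  then show ?thesis using True by (auto simp: wt_def power_add)
next
  case False
  then show ?thesis by (auto simp: wt_def)
qed

lemma wt_snoc:
  assumes "finite I"
  shows "wt I (ks @ [l]) = (if l \<in> I then \<kappa> ^ card {x\<in>I. l < x} * wt (I - {l}) ks else 0)"
proof (cases "distinct (ks @ [l]) \<and> set (ks @ [l]) = I")
  case True
  then have "length (filter (\<lambda>y. l < y) ks) = card {x\<in>I. l < x}"
    by (subst distinct_card[symmetric]) (auto intro!: arg_cong[where f = card])
  then show ?thesis using True by (auto simp: wt_def power_add inv_list_snoc)
next
  case False
  then show ?thesis by (auto simp: wt_def)
qed

text \<open>What remains of the RTT relation where R degenerates: for rows b < b' the
  q-antisymmetrized product of an entry of \<open>M a\<close> and one of \<open>M (Suc a)\<close> is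
  q-alternating in its two columns.\<close>

definition adjacent_rel :: "(nat \<Rightarrow> nat \<Rightarrow> nat \<Rightarrow> 'l) \<Rightarrow> bool" where
  "adjacent_rel M \<longleftrightarrow> (\<forall>a b b' c. b < b' \<longrightarrow>
     (\<forall>d. c < d \<longrightarrow> M a b d * M (Suc a) b' c + sc \<kappa> * (M a b' d * M (Suc a) b c) =
        sc \<kappa> * (M a b c * M (Suc a) b' d + sc \<kappa> * (M a b' c * M (Suc a) b d))) \<and>
     M a b c * M (Suc a) b' c + sc \<kappa> * (M a b' c * M (Suc a) b c) = 0)"

text \<open>The additive maps \<open>F ds\<close> allow for the product of matrix entries to stand on either side of,
  or in between, the factors that depend on \<open>ds\<close>.\<close>

lemma alternating_sum_prodM:
  assumes M: "adjacent_rel M"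
    and add: "\<And>ds y z. F ds (y + z) = F ds y + F ds z"
    and sc: "\<And>ds x z. F ds (sc x * z) = sc x * F ds z"
    and swap: "\<And>xs c d ys z. c < d \<Longrightarrow> F (xs @ d # c # ys) z = F (xs @ c # d # ys) (sc \<kappa> * z)"
    and same: "\<And>xs c ys z. F (xs @ c # c # ys) z = 0"
  shows "alternating (\<lambda>es. \<Sum>ds\<in>tuples N (length es). F ds (prodM M a ds es))"
proof -
  let ?G = "\<lambda>es. \<Sum>ds\<in>tuples N (length es). F ds (prodM M a ds es)"
  let ?m = "\<lambda>xs :: nat list. a + length xs"
  let ?phi = "\<lambda>k x y e f. M k x e * M (Suc k) y f + sc \<kappa> * (M k y e * M (Suc k) x f)"
  \<comment> \<open>Exchanging x and y in the row word costs \<kappa> inside \<open>F\<close>, so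
    the terms for (x, y) and (y, x) combine to \<open>?phi\<close>, the expression controlled by
    \<open>adjacent_rel\<close>.\<close>
  have expand: "?G (xs @ e # f # ys) =
     (\<Sum>ps\<in>tuples N (length xs). \<Sum>rs\<in>tuples N (length ys). \<Sum>x\<in>{1..N}. \<Sum>y\<in>{y\<in>{1..N}. x < y}.
       F (ps @ x # y # rs) (prodM M a ps xs * ?phi (?m xs) x y e f * prodM M (Suc (Suc (?m xs))) rs ys))"
    for xs e f ys
  proof -
    have "?G (xs @ e # f # ys) = (\<Sum>ps\<in>tuples N (length xs). \<Sum>x\<in>{1..N}. \<Sum>y\<in>{1..N}. \<Sum>rs\<in>tuples N (length ys).
       F (ps @ x # y # rs) (prodM M a (ps @ x # y # rs) (xs @ e # f # ys)))"
      using sum_tuples_add[of "\<lambda>ds. F ds (prodM M a ds (xs @ e # f # ys))" N "length xs" "Suc (Suc (length ys))"]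
      by (simp add: sum_tuples_Suc)
    also have "\<dots> = (\<Sum>ps\<in>tuples N (length xs). \<Sum>x\<in>{1..N}. \<Sum>y\<in>{1..N}. \<Sum>rs\<in>tuples N (length ys).
       F (ps @ x # y # rs) (prodM M a ps xs * (M (?m xs) x e * M (Suc (?m xs)) y f) * prodM M (Suc (Suc (?m xs))) rs ys))"
      by (intro sum.cong refl arg_cong[where f = "F _"]) (simp add: prodM_append tuples_length mult.assoc)
    also have "\<dots> = (\<Sum>ps\<in>tuples N (length xs). \<Sum>rs\<in>tuples N (length ys). \<Sum>x\<in>{1..N}. \<Sum>y\<in>{1..N}.
       F (ps @ x # y # rs) (prodM M a ps xs * (M (?m xs) x e * M (Suc (?m xs)) y f) * prodM M (Suc (Suc (?m xs))) rs ys))"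
      by (intro sum.cong refl sum_swap3)
    also have "\<dots> = (\<Sum>ps\<in>tuples N (length xs). \<Sum>rs\<in>tuples N (length ys). \<Sum>x\<in>{1..N}. \<Sum>y\<in>{y\<in>{1..N}. x < y}.
       F (ps @ x # y # rs) (prodM M a ps xs * ?phi (?m xs) x y e f * prodM M (Suc (Suc (?m xs))) rs ys))"
      (is "(\<Sum>ps\<in>_. \<Sum>rs\<in>_. ?L ps rs) = (\<Sum>ps\<in>_. \<Sum>rs\<in>_. ?R ps rs)")
    proof (rule sum.cong[OF refl], rule sum.cong[OF refl])
      fix ps rs
      let ?z = "\<lambda>x y. prodM M a ps xs * (M (?m xs) x e * M (Suc (?m xs)) y f) * prodM M (Suc (Suc (?m xs))) rs ys"
      have "F (ps @ x # y # rs) (?z x y) + F (ps @ y # x # rs) (?z y x) =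
        F (ps @ x # y # rs) (prodM M a ps xs * ?phi (?m xs) x y e f * prodM M (Suc (Suc (?m xs))) rs ys)"
        if "x < y" for x y
      proof -
        have "prodM M a ps xs * ?phi (?m xs) x y e f * prodM M (Suc (Suc (?m xs))) rs ys = ?z x y + sc \<kappa> * ?z y x"
          by (simp only: distrib_left distrib_right) (simp only: sc_left mult.assoc)
        then show ?thesis by (simp only: swap[OF that] add)
      qed
      then show "?L ps rs = ?R ps rs"
        by (subst sum_pairs_less) (simp_all add: same)
    qed
    finally show ?thesis .
  qed
  show ?thesis
  proof (rule alternatingI)
    fix xs c d ys assume cd: "c < (d::nat)"
    have phi: "?phi k x y d c = sc \<kappa> * ?phi k x y c d" if "x < y" for k x y
      using M that cd unfolding adjacent_rel_def by blast
    show "?G (xs @ d # c # ys) = sc \<kappa> * ?G (xs @ c # d # ys)"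
      unfolding expand
    proof (simp only: sum_distrib_left sc[symmetric], intro sum.cong refl)
      fix ps rs x y assume "y \<in> {y \<in> {1..N}. x < y}"
      then have "?phi (?m xs) x y d c = sc \<kappa> * ?phi (?m xs) x y c d" using phi by blast
      then show "F (ps @ x # y # rs) (prodM M a ps xs * ?phi (?m xs) x y d c * prodM M (Suc (Suc (?m xs))) rs ys)
        = F (ps @ x # y # rs) (sc \<kappa> * (prodM M a ps xs * ?phi (?m xs) x y c d * prodM M (Suc (Suc (?m xs))) rs ys))"
        by (simp only: sc_left mult.assoc)
    qed
  next
    fix xs c ys
    have phi: "?phi k x y c c = 0" if "x < y" for k x y
      using M that unfolding adjacent_rel_def by blast
    have F0: "F ds 0 = 0" for ds using add[of ds 0 0] by simp
    show "?G (xs @ c # c # ys) = 0"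
      unfolding expand
    proof (intro sum.neutral ballI)
      fix ps rs x y assume "y \<in> {y \<in> {1..N}. x < y}"
      then have "?phi (?m xs) x y c c = 0" using phi by blast
      then show "F (ps @ x # y # rs) (prodM M a ps xs * ?phi (?m xs) x y c c * prodM M (Suc (Suc (?m xs))) rs ys) = 0"
        by (simp only: mult_zero_left mult_zero_right F0)
    qed
  qed
qed

end

section \<open>Moving a matrix entry through a q-minor\<close>

text \<open>The coefficient of E_aa tensor E_bb in R(x,v); \<open>roff\<close> is that of E_ab
  tensor E_ba.\<close>

definition rdiag :: "'k::field \<Rightarrow> 'k \<Rightarrow> 'k \<Rightarrow> nat \<Rightarrow> nat \<Rightarrow> 'k" where
  "rdiag q x v a b = (if a = b then inverse q * x - q * v else x - v)"

definition roff :: "'k::field \<Rightarrow> 'k \<Rightarrow> 'k \<Rightarrow> nat \<Rightarrow> nat \<Rightarrow> 'k" where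
  "roff q x v a b = (if a = b then 0 else if b < a then (inverse q - q) * x else (inverse q - q) * v)"

text \<open>The equation R(x,v) X_1 Y_2 = Y_2 X_1 R(x,v) at row (a,b) and column (c,d), for matrices
  already specialized at x and v.\<close>

definition rtt_rel :: "('k::field \<Rightarrow> 'l::ring_1) \<Rightarrow> 'k \<Rightarrow> 'k \<Rightarrow> 'k \<Rightarrow> (nat \<Rightarrow> nat \<Rightarrow> 'l) \<Rightarrow> (nat \<Rightarrow> nat \<Rightarrow> 'l) \<Rightarrow> bool" where
  "rtt_rel sc q x v X Y \<longleftrightarrow> (\<forall>a b c d.
     sc (rdiag q x v a b) * (X a c * Y b d) + sc (roff q x v a b) * (X b c * Y a d) =
     sc (rdiag q x v c d) * (Y b d * X a c) + sc (roff q x v d c) * (Y b c * X a d))"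

lemma alternating_Cons: "alternation.alternating sc \<kappa> f \<Longrightarrow> alternation sc \<kappa> \<Longrightarrow> alternation.alternating sc \<kappa> (\<lambda>cs. f (z # cs))"
  by (simp add: alternation.alternating_def) (metis append_Cons)

text \<open>The fusion procedure: the ratio q^2 of consecutive parameters is the one at which R(u_a,
  u_{a+1}) becomes singular.\<close>

locale fusion = central_scalars sc for sc :: "'k::field \<Rightarrow> 'l::ring_1" +
  fixes q :: 'k and u :: "nat \<Rightarrow> 'k"
  assumes q_nz: "q \<noteq> 0" and u_Suc: "u (Suc a) = u a / (q * q)"
begin

sublocale alternation sc "- inverse q"
  by unfold_locales (simp add: q_nz)

text \<open>Right multiplication of the row vector \<open>H\<close> by R_{0m} ... R_{01}, where
  \<open>d\<close> is the index in the auxiliary copy 0, the list holds those in copies 1, ..., m,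
  and copy 1 has parameter u_a. The list is consumed from the left, while \<open>H\<close> absorbs
  the letters already settled.\<close>

primrec col :: "'k \<Rightarrow> nat list \<Rightarrow> nat \<Rightarrow> (nat \<Rightarrow> nat list \<Rightarrow> 'l) \<Rightarrow> nat \<Rightarrow> 'l" where
  "col x [] a H d = H d []"
| "col x (c # cs) a H d = sc (rdiag q x (u a) d c) * col x cs (Suc a) (\<lambda>d' cs'. H d' (c # cs')) d
     + sc (roff q x (u a) c d) * col x cs (Suc a) (\<lambda>d' cs'. H d' (d # cs')) c"

text \<open>The same product R_{0m} ... R_{01}, acting from the left on the column vector
  \<open>f\<close>.\<close>

primrec row :: "'k \<Rightarrow> nat list \<Rightarrow> nat \<Rightarrow> (nat \<Rightarrow> nat list \<Rightarrow> 'l) \<Rightarrow> nat \<Rightarrow> 'l" where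
  "row x [] a f j = f j []"
| "row x (b # bs) a f j = row x bs (Suc a)
     (\<lambda>i bs'. sc (rdiag q x (u a) i b) * f i (b # bs') + sc (roff q x (u a) i b) * f b (i # bs')) j"

lemma row_add: "row x bs a (\<lambda>i bs'. f i bs' + g i bs') j = row x bs a f j + row x bs a g j"
proof (induction bs arbitrary: a f g j)
  case (Cons b bs)
  have "row x (b # bs) a (\<lambda>i bs'. f i bs' + g i bs') j = row x bs (Suc a)
     (\<lambda>i bs'. (sc (rdiag q x (u a) i b) * f i (b # bs') + sc (roff q x (u a) i b) * f b (i # bs')) +
              (sc (rdiag q x (u a) i b) * g i (b # bs') + sc (roff q x (u a) i b) * g b (i # bs'))) j"
    by (simp add: distrib_left add_ac)
  then show ?case by (simp only: Cons row.simps)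
qed simp

lemma row_lmult: "row x bs a (\<lambda>i bs'. y * f i bs') j = y * row x bs a f j"
proof (induction bs arbitrary: a f j)
  case (Cons b bs)
  have "row x (b # bs) a (\<lambda>i bs'. y * f i bs') j = row x bs (Suc a)
     (\<lambda>i bs'. y * (sc (rdiag q x (u a) i b) * f i (b # bs') + sc (roff q x (u a) i b) * f b (i # bs'))) j"
    by (simp only: row.simps distrib_left sc_left[of y])
  then show ?case by (simp only: Cons row.simps)
qed simp

lemma col_cong:
  "(\<And>d' cs'. length cs' = length cs \<Longrightarrow> H d' cs' = H' d' cs') \<Longrightarrow> col x cs a H d = col x cs a H' d"
proof (induction cs arbitrary: a H H' d)
  case (Cons c cs)
  have "col x cs (Suc a) (\<lambda>d' cs'. H d' (z # cs')) d = col x cs (Suc a) (\<lambda>d' cs'. H' d' (z # cs')) d" for z d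
    by (rule Cons.IH) (simp add: Cons.prems)
  then show ?case by simp
qed simp

lemma col_lmult: "col x cs a (\<lambda>d' cs'. y * H d' cs') d = y * col x cs a H d"
  by (induction cs arbitrary: a H d) (simp_all only: col.simps distrib_left sc_left[of y])

lemma col_zero: "col x cs a (\<lambda>d' cs'. 0) d = 0"
  by (induction cs arbitrary: a d) simp_all

lemma col_add: "col x cs a (\<lambda>d' cs'. H d' cs' + H' d' cs') d = col x cs a H d + col x cs a H' d"
  by (induction cs arbitrary: a H H' d) (simp_all add: distrib_left add_ac)

lemma col_sum: "finite A \<Longrightarrow> col x cs a (\<lambda>d' cs'. \<Sum>i\<in>A. H i d' cs') d = (\<Sum>i\<in>A. col x cs a (H i) d)"
  by (induction A rule: finite_induct) (simp_all add: col_zero col_add)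

text \<open>R_{0m} ... R_{01} X_0 T_1 ... T_m = T_1 ... T_m X_0 R_{0m} ... R_{01}, obtained by
  applying the RTT relation in one copy after the other.\<close>

lemma row_col_exchange:
  assumes rel: "\<And>k. rtt_rel sc q x (u k) X (t k)"
    and "length bs = length cs"
  shows "row x bs a (\<lambda>i bs'. X i d * prodM t a bs' cs) j = col x cs a (\<lambda>d' cs'. prodM t a bs cs' * X j d') d"
  using assms(2)
proof (induction bs cs arbitrary: a d j rule: list_induct2)
  case (Cons b bs c cs)
  have step: "sc (rdiag q x (u a) i b) * (X i d * prodM t a (b # bs') (c # cs)) + sc (roff q x (u a) i b) * (X b d * prodM t a (i # bs') (c # cs))
    = (sc (rdiag q x (u a) d c) * t a b c) * (X i d * prodM t (Suc a) bs' cs)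
      + (sc (roff q x (u a) c d) * t a b d) * (X i c * prodM t (Suc a) bs' cs)" for i bs'
  proof -
    have "(sc (rdiag q x (u a) i b) * (X i d * t a b c) + sc (roff q x (u a) i b) * (X b d * t a i c)) * prodM t (Suc a) bs' cs
       = (sc (rdiag q x (u a) d c) * (t a b c * X i d) + sc (roff q x (u a) c d) * (t a b d * X i c)) * prodM t (Suc a) bs' cs"
      using rel[of a] unfolding rtt_rel_def by metis
    then show ?thesis by (simp add: distrib_right mult.assoc)
  qed
  have "row x (b # bs) a (\<lambda>i bs'. X i d * prodM t a bs' (c # cs)) j =
     (sc (rdiag q x (u a) d c) * t a b c) * row x bs (Suc a) (\<lambda>i bs'. X i d * prodM t (Suc a) bs' cs) j
     + (sc (roff q x (u a) c d) * t a b d) * row x bs (Suc a) (\<lambda>i bs'. X i c * prodM t (Suc a) bs' cs) j"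
    by (simp only: row.simps step row_add row_lmult)
  also have "\<dots> = col x (c # cs) a (\<lambda>d' cs'. prodM t a (b # bs) cs' * X j d') d"
    by (simp only: Cons.IH col.simps prodM.simps list.sel mult.assoc col_lmult)
  finally show ?case .
qed simp

text \<open>Associativity of row vector, matrix and column vector, for the matrix R_{0m} ... R_{01}
  in its recursive encoding.\<close>

lemma row_col_dual:
  "(\<Sum>j\<in>{1..N}. \<Sum>bs\<in>tuples N m. H j bs * row x bs a f j) = (\<Sum>j\<in>{1..N}. \<Sum>bs\<in>tuples N m. col x bs a H j * f j bs)"
proof (induction m arbitrary: a H f)
  case (Suc m)
  let ?I = "{1..N}"
  let ?C = "\<lambda>b j bs. col x bs (Suc a) (\<lambda>d' cs'. H d' (b # cs')) j"
  have "(\<Sum>j\<in>?I. \<Sum>bs\<in>tuples N (Suc m). H j bs * row x bs a f j) =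
      (\<Sum>b\<in>?I. \<Sum>j\<in>?I. \<Sum>bs\<in>tuples N m. H j (b # bs) * row x bs (Suc a)
        (\<lambda>i bs'. sc (rdiag q x (u a) i b) * f i (b # bs') + sc (roff q x (u a) i b) * f b (i # bs')) j)"
    unfolding sum_tuples_Suc row.simps by (rule sum.swap)
  also have "\<dots> = (\<Sum>b\<in>?I. \<Sum>j\<in>?I. \<Sum>bs\<in>tuples N m. ?C b j bs *
        (sc (rdiag q x (u a) j b) * f j (b # bs) + sc (roff q x (u a) j b) * f b (j # bs)))"
    by (simp only: Suc.IH)
  also have "\<dots> = (\<Sum>b\<in>?I. \<Sum>j\<in>?I. \<Sum>bs\<in>tuples N m. sc (rdiag q x (u a) j b) * ?C b j bs * f j (b # bs))
     + (\<Sum>b\<in>?I. \<Sum>j\<in>?I. \<Sum>bs\<in>tuples N m. sc (roff q x (u a) j b) * ?C b j bs * f b (j # bs))"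
    by (simp add: distrib_left sum.distrib sc_left mult.assoc)
  also have "(\<Sum>b\<in>?I. \<Sum>j\<in>?I. \<Sum>bs\<in>tuples N m. sc (rdiag q x (u a) j b) * ?C b j bs * f j (b # bs))
     = (\<Sum>j\<in>?I. \<Sum>b\<in>?I. \<Sum>bs\<in>tuples N m. sc (rdiag q x (u a) j b) * ?C b j bs * f j (b # bs))"
    by (rule sum.swap)
  also have "(\<Sum>j\<in>?I. \<Sum>b\<in>?I. \<Sum>bs\<in>tuples N m. sc (rdiag q x (u a) j b) * ?C b j bs * f j (b # bs))
     + (\<Sum>b\<in>?I. \<Sum>j\<in>?I. \<Sum>bs\<in>tuples N m. sc (roff q x (u a) j b) * ?C b j bs * f b (j # bs))
     = (\<Sum>j\<in>?I. \<Sum>bs\<in>tuples N (Suc m). col x bs a H j * f j bs)"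
    unfolding sum_tuples_Suc col.simps distrib_right sum.distrib by (rule refl)
  finally show ?case .
qed simp

text \<open>Compares the coefficients of \<open>yd\<close>, \<open>yc\<close> and \<open>ye\<close>;
  an identity in the noncommutative ring is thereby reduced to three identities between
  scalars.\<close>

lemma swap_combination:
  assumes "A1 * A2 * k1 = k * (B1 * B2)"
    "A1 * A3 * k2 + A4 * A6 * k4 = k * (B4 * B5 * k5)"
    "A4 * A5 * k3 = k * (B1 * B3 * k6 + B4 * B6 * k7)"
  shows "sc A1 * (sc A2 * (sc k1 * yd) + sc A3 * (sc k2 * yc)) + sc A4 * (sc A5 * (sc k3 * ye) + sc A6 * (sc k4 * yc))
    = sc k * (sc B1 * (sc B2 * yd + sc B3 * (sc k6 * ye)) + sc B4 * (sc B5 * (sc k5 * yc) + sc B6 * (sc k7 * ye)))"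
proof -
  have "sc A1 * (sc A2 * (sc k1 * yd) + sc A3 * (sc k2 * yc)) + sc A4 * (sc A5 * (sc k3 * ye) + sc A6 * (sc k4 * yc))
    = sc (A1 * A2 * k1) * yd + sc (A1 * A3 * k2 + A4 * A6 * k4) * yc + sc (A4 * A5 * k3) * ye"
    by (simp add: sc_sc sc_add distrib_left distrib_right mult.assoc)
  also have "\<dots> = sc (k * (B1 * B2)) * yd + sc (k * (B4 * B5 * k5)) * yc + sc (k * (B1 * B3 * k6 + B4 * B6 * k7)) * ye"
    by (simp only: assms)
  also have "\<dots> = sc k * (sc B1 * (sc B2 * yd + sc B3 * (sc k6 * ye)) + sc B4 * (sc B5 * (sc k5 * yc) + sc B6 * (sc k7 * ye)))"
    by (simp add: sc_sc sc_add distrib_left distrib_right mult.assoc)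
  finally show ?thesis .
qed

text \<open>The Yang--Baxter equation in the only case that is needed: the spectral parameters of the two
  neighbouring copies differ by $q^2$, where the R-matrix degenerates to a q-antisymmetrizer.\<close>

lemma col_two_alternating:
  fixes Y :: "nat \<Rightarrow> nat \<Rightarrow> nat \<Rightarrow> 'l" and x v :: 'k
  assumes swap: "\<And>e f g. f < g \<Longrightarrow> Y e g f = sc (- inverse q) * Y e f g"
    and same: "\<And>e f. Y e f f = 0"
  defines "Z \<equiv> \<lambda>d c c'. sc (rdiag q x v d c) * (sc (rdiag q x (v / (q * q)) d c') * Y d c c' + sc (roff q x (v / (q * q)) c' d) * Y c' c d)
     + sc (roff q x v c d) * (sc (rdiag q x (v / (q * q)) c c') * Y c d c' + sc (roff q x (v / (q * q)) c' c) * Y c' d c)"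
  shows "c < c' \<Longrightarrow> Z d c' c = sc (- inverse q) * Z d c c'" and "Z d c c = 0"
proof -
  assume cc: "c < c'"
  \<comment> \<open>The position of d relative to c < c' decides which branches of
    \<open>roff\<close> apply and how the values of \<open>Y\<close> are reduced to increasing
    arguments. Each case then amounts to identities of rational functions in q, x and v.\<close>
  consider "d = c" | "d = c'" | "d < c" | "c < d" "d < c'" | "c' < d" by linarith
  then show "Z d c' c = sc (- inverse q) * Z d c c'"
  proof cases
    case 1
    have "sc (rdiag q x v c c') * (sc (rdiag q x (v / (q * q)) c c) * (sc (- inverse q) * Y c c c'))
        + sc (roff q x v c' c) * (sc (roff q x (v / (q * q)) c c') * Y c c c')
      = sc (- inverse q) * (sc (rdiag q x v c c) * (sc (rdiag q x (v / (q * q)) c c') * Y c c c'))"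
      unfolding sc_sc distrib_right[symmetric] sc_add[symmetric]
      using cc q_nz by (intro arg_cong[where f = "\<lambda>z. sc z * _"]) (simp add: rdiag_def roff_def field_simps)
    then show ?thesis using cc by (simp add: Z_def 1 same swap[OF cc] roff_def)
  next
    case 2
    have "sc (rdiag q x v c' c') * (sc (rdiag q x (v / (q * q)) c' c) * (sc (- inverse q) * Y c' c c'))
      = sc (- inverse q) * (sc (rdiag q x v c' c) * (sc (rdiag q x (v / (q * q)) c' c') * Y c' c c')
         + sc (roff q x v c c') * (sc (roff q x (v / (q * q)) c' c) * (sc (- inverse q) * Y c' c c')))"
      unfolding sc_sc distrib_left distrib_right[symmetric] sc_add[symmetric]
      using cc q_nz by (intro arg_cong[where f = "\<lambda>z. sc z * _"]) (simp add: rdiag_def roff_def field_simps)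
    then show ?thesis using cc by (simp add: Z_def 2 same swap[OF cc] roff_def)
  next
    case 3
    have eqs: "Y d c' c = sc (- inverse q) * Y d c c'" "Y c c' d = sc (- inverse q) * Y c d c'"
      "Y c' c d = sc (- inverse q) * Y c' d c"
      using 3 cc by (simp_all add: swap)
    have "Z d c' c = sc (rdiag q x v d c') * (sc (rdiag q x (v / (q * q)) d c) * (sc (- inverse q) * Y d c c') + sc (roff q x (v / (q * q)) c d) * (sc (- inverse q) * Y c d c'))
      + sc (roff q x v c' d) * (sc (rdiag q x (v / (q * q)) c' c) * (sc (1) * Y c' d c) + sc (roff q x (v / (q * q)) c c') * (sc (1) * Y c d c'))"
      by (simp only: Z_def eqs sc_1 mult_1_left)
    also have "\<dots> = sc (- inverse q) * (sc (rdiag q x v d c) * (sc (rdiag q x (v / (q * q)) d c') * Y d c c' + sc (roff q x (v / (q * q)) c' d) * (sc (- inverse q) * Y c' d c))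
      + sc (roff q x v c d) * (sc (rdiag q x (v / (q * q)) c c') * (sc (1) * Y c d c') + sc (roff q x (v / (q * q)) c' c) * (sc (1) * Y c' d c)))"
      by (rule swap_combination) (use 3 cc q_nz in \<open>simp_all add: rdiag_def roff_def field_simps\<close>)
    also have "\<dots> = sc (- inverse q) * Z d c c'"
      by (simp only: Z_def eqs sc_1 mult_1_left)
    finally show ?thesis .
  next
    case 4
    have eqs: "Y d c' c = sc (- inverse q) * Y d c c'" "Y c c' d = sc (- inverse q) * Y c d c'"
      "Y c' d c = sc (- inverse q) * Y c' c d"
      using 4 cc by (simp_all add: swap)
    have "Z d c' c = sc (rdiag q x v d c') * (sc (rdiag q x (v / (q * q)) d c) * (sc (- inverse q) * Y d c c') + sc (roff q x (v / (q * q)) c d) * (sc (- inverse q) * Y c d c'))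
      + sc (roff q x v c' d) * (sc (rdiag q x (v / (q * q)) c' c) * (sc (- inverse q) * Y c' c d) + sc (roff q x (v / (q * q)) c c') * (sc (1) * Y c d c'))"
      by (simp only: Z_def eqs sc_1 mult_1_left)
    also have "\<dots> = sc (- inverse q) * (sc (rdiag q x v d c) * (sc (rdiag q x (v / (q * q)) d c') * Y d c c' + sc (roff q x (v / (q * q)) c' d) * (sc (1) * Y c' c d))
      + sc (roff q x v c d) * (sc (rdiag q x (v / (q * q)) c c') * (sc (1) * Y c d c') + sc (roff q x (v / (q * q)) c' c) * (sc (- inverse q) * Y c' c d)))"
      by (rule swap_combination) (use 4 cc q_nz in \<open>simp_all add: rdiag_def roff_def field_simps\<close>)
    also have "\<dots> = sc (- inverse q) * Z d c c'"
      by (simp only: Z_def eqs sc_1 mult_1_left)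
    finally show ?thesis .
  next
    case 5
    have eqs: "Y d c' c = sc (- inverse q) * Y d c c'" "Y c d c' = sc (- inverse q) * Y c c' d"
      "Y c' d c = sc (- inverse q) * Y c' c d"
      using 5 cc by (simp_all add: swap)
    have "Z d c' c = sc (rdiag q x v d c') * (sc (rdiag q x (v / (q * q)) d c) * (sc (- inverse q) * Y d c c') + sc (roff q x (v / (q * q)) c d) * (sc (1) * Y c c' d))
      + sc (roff q x v c' d) * (sc (rdiag q x (v / (q * q)) c' c) * (sc (- inverse q) * Y c' c d) + sc (roff q x (v / (q * q)) c c') * (sc (- inverse q) * Y c c' d))"
      by (simp only: Z_def eqs sc_1 mult_1_left)
    also have "\<dots> = sc (- inverse q) * (sc (rdiag q x v d c) * (sc (rdiag q x (v / (q * q)) d c') * Y d c c' + sc (roff q x (v / (q * q)) c' d) * (sc (1) * Y c' c d))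
      + sc (roff q x v c d) * (sc (rdiag q x (v / (q * q)) c c') * (sc (- inverse q) * Y c c' d) + sc (roff q x (v / (q * q)) c' c) * (sc (- inverse q) * Y c' c d)))"
      by (rule swap_combination) (use 5 cc q_nz in \<open>simp_all add: rdiag_def roff_def field_simps\<close>)
    also have "\<dots> = sc (- inverse q) * Z d c c'"
      by (simp only: Z_def eqs sc_1 mult_1_left)
    finally show ?thesis .
  qed
next
  consider "d = c" | "d < c" | "c < d" by linarith
  then show "Z d c c = 0"
  proof cases
    case 1
    then show ?thesis by (simp add: Z_def same roff_def)
  next
    case 2
    have "sc (rdiag q x v d c) * (sc (roff q x (v / (q * q)) c d) * (sc (- inverse q) * Y c d c))
       + sc (roff q x v c d) * (sc (rdiag q x (v / (q * q)) c c) * Y c d c) = sc 0 * Y c d c"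
      unfolding sc_sc distrib_left distrib_right[symmetric] sc_add[symmetric]
      using 2 q_nz by (intro arg_cong[where f = "\<lambda>z. sc z * _"]) (simp add: rdiag_def roff_def field_simps)
    then show ?thesis using 2 by (simp add: Z_def same swap[OF 2] roff_def[of _ _ _ c c])
  next
    case 3
    have "sc (rdiag q x v d c) * (sc (roff q x (v / (q * q)) c d) * Y c c d)
       + sc (roff q x v c d) * (sc (rdiag q x (v / (q * q)) c c) * (sc (- inverse q) * Y c c d)) = sc 0 * Y c c d"
      unfolding sc_sc distrib_left distrib_right[symmetric] sc_add[symmetric]
      using 3 q_nz by (intro arg_cong[where f = "\<lambda>z. sc z * _"]) (simp add: rdiag_def roff_def field_simps)
    then show ?thesis using 3 by (simp add: Z_def same swap[OF 3] roff_def[of _ _ _ c c])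
  qed
qed

text \<open>Only the R-matrices at the two exchanged positions need an argument, given by
  \<open>col_two_alternating\<close>. Those at later positions are absorbed into the vector
  \<open>Y\<close>; those at earlier positions replace \<open>H\<close> by its values with a fixed
  first letter, which are again alternating.\<close>

lemma alternating_col:
  assumes "\<And>d. alternating (H d)"
  shows "alternating (\<lambda>cs. col x cs a H d)"
proof -
  have step: "(c < c' \<longrightarrow> col x (xs @ c' # c # ys) a H d = sc (- inverse q) * col x (xs @ c # c' # ys) a H d)
      \<and> col x (xs @ c # c # ys) a H d = 0"
    if "\<And>d. alternating (H d)" for xs c c' ys a d H
    using that
  proof (induction xs arbitrary: a d H)
    case Nil
    define Y where "Y = (\<lambda>e f g. col x ys (Suc (Suc a)) (\<lambda>d' cs'. H d' (f # g # cs')) e)"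
    have "Y e g f = sc (- inverse q) * Y e f g" if "f < g" for e f g
    proof -
      have "H d' (g # f # cs') = sc (- inverse q) * H d' (f # g # cs')" for d' cs'
        using alternating_swap[OF Nil[of d'] that, of "[]" cs'] by simp
      then show ?thesis by (simp only: Y_def col_lmult)
    qed
    moreover have "Y e f f = 0" for e f
    proof -
      have "H d' (f # f # cs') = 0" for d' cs'
        using alternating_same[OF Nil[of d'], of "[]" f cs'] by simp
      then show ?thesis by (simp add: Y_def col_zero)
    qed
    ultimately show ?case
      using col_two_alternating(1)[where Y = Y and x = x and v = "u a" and c = c and c' = c' and d = d]
        col_two_alternating(2)[where Y = Y and x = x and v = "u a" and c = c and d = d]
      by (simp add: u_Suc Y_def)
  next
    case (Cons z xs)
    have alt: "alternating (\<lambda>cs. H d (w # cs))" for d w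
      by (rule alternating_Cons[OF Cons.prems alternation_axioms])
    have IH: "(c < c' \<longrightarrow> col x (xs @ c' # c # ys) (Suc a) (\<lambda>d cs. H d (w # cs)) d =
          sc (- inverse q) * col x (xs @ c # c' # ys) (Suc a) (\<lambda>d cs. H d (w # cs)) d)
      \<and> col x (xs @ c # c # ys) (Suc a) (\<lambda>d cs. H d (w # cs)) d = 0" for w d
      by (rule Cons.IH[of "\<lambda>d cs. H d (w # cs)"], rule alt)
    show ?case
    proof (intro conjI impI)
      assume "c < c'"
      then have sw: "col x (xs @ c' # c # ys) (Suc a) (\<lambda>d cs. H d (w # cs)) d =
          sc (- inverse q) * col x (xs @ c # c' # ys) (Suc a) (\<lambda>d cs. H d (w # cs)) d" for w d
        using IH by blast
      show "col x ((z # xs) @ c' # c # ys) a H d = sc (- inverse q) * col x ((z # xs) @ c # c' # ys) a H d"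
        by (simp only: append_Cons col.simps sw distrib_left sc_left[of "sc (- inverse q)"])
    next
      have "col x (xs @ c # c # ys) (Suc a) (\<lambda>d cs. H d (w # cs)) d = 0" for w d
        using IH by blast
      then show "col x ((z # xs) @ c # c # ys) a H d = 0" by simp
    qed
  qed
  show ?thesis by (rule alternatingI) (use step[of H] assms in blast)+
qed

primrec bprod :: "'k \<Rightarrow> nat \<Rightarrow> nat \<Rightarrow> 'k" where
  "bprod x a 0 = 1"
| "bprod x a (Suc m) = (x - u a) * bprod x (Suc a) m"

text \<open>Any exchange would put i into the list, where \<open>G\<close> vanishes, so only the
  diagonal factors x - u_k for distinct indices survive.\<close>

lemma col_not_mem:
  assumes "i \<notin> set bs" "\<And>i' bs'. i \<in> set bs' \<Longrightarrow> G i' bs' = 0"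
  shows "col x bs a G i = sc (bprod x a (length bs)) * G i bs"
  using assms
proof (induction bs arbitrary: a G)
  case (Cons b bs)
  have "col x bs (Suc a) (\<lambda>d' cs'. G d' (i # cs')) b = 0"
    by (simp add: Cons.prems(2) col_zero)
  moreover have "col x bs (Suc a) (\<lambda>d' cs'. G d' (b # cs')) i = sc (bprod x (Suc a) (length bs)) * G i (b # bs)"
    using Cons.prems by (intro Cons.IH) auto
  ultimately show ?case using Cons.prems(1) by (simp add: rdiag_def sc_sc)
qed simp

text \<open>The R-matrices preserve the multiset of all indices, the auxiliary one included.\<close>

lemma col_zero_mset:
  assumes "\<And>i' bs'. add_mset i' (mset bs') = add_mset i (mset bs) \<Longrightarrow> H i' bs' = 0"
  shows "col x bs a H i = 0"
  using assms
proof (induction bs arbitrary: a H i)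
  case (Cons b bs)
  have "col x bs (Suc a) (\<lambda>d' cs'. H d' (b # cs')) i = 0"
    by (rule Cons.IH, rule Cons.prems) (simp add: add_mset_commute)
  moreover have "col x bs (Suc a) (\<lambda>d' cs'. H d' (i # cs')) b = 0"
    by (rule Cons.IH, rule Cons.prems) (simp add: add_mset_commute)
  ultimately show ?case by simp
qed simp

text \<open>The scalar of R_{0m} ... R_{01} on alternating vectors whose auxiliary index repeats one
  of the others: one factor for equal indices, the rest for distinct ones.\<close>

definition aprod :: "'k \<Rightarrow> nat \<Rightarrow> nat \<Rightarrow> 'k" where
  "aprod x a m = (inverse q * x - q * u a) * bprod x (Suc a) (m - 1)"

text \<open>Both sides are alternating in the list, so i may be moved to its front. There the first
  R-matrix sees two equal indices, and the letter i in front makes every later exchange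
  vanish.\<close>

lemma col_mem:
  assumes H: "\<And>d. alternating (H d)" and i: "i \<in> set bs"
  shows "col x bs a H i = sc (aprod x a (length bs)) * H i bs"
proof (cases "distinct bs")
  case False
  then show ?thesis
    using alternating_not_distinct[OF alternating_col[OF H] False] alternating_not_distinct[OF H False] by simp
next
  case True
  define cs where "cs = remove1 i bs"
  have cs: "mset bs = mset (i # cs)" "length bs = Suc (length cs)" "i \<notin> set cs"
    using i True by (auto simp: cs_def length_remove1) (metis length_pos_if_in_set Suc_pred)
  let ?m = "length bs"
  have "col x (i # cs) a H i = sc (inverse q * x - q * u a) * (sc (bprod x (Suc a) (length cs)) * H i (i # cs))"
  proof -
    have "col x cs (Suc a) (\<lambda>d' cs'. H d' (i # cs')) i = sc (bprod x (Suc a) (length cs)) * H i (i # cs)"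
      by (rule col_not_mem) (use cs(3) in \<open>auto intro!: alternating_not_distinct[OF H]\<close>)
    then show ?thesis by (simp add: rdiag_def roff_def)
  qed
  then have eq: "col x (i # cs) a H i = sc (aprod x a ?m) * H i (i # cs)"
    by (simp add: aprod_def sc_sc cs)
  show ?thesis
  proof (rule alternating_eqI[where f = "\<lambda>cs. col x cs a H i" and g = "\<lambda>cs. sc (aprod x a ?m) * H i cs", OF alternating_col[OF H] _ cs(1) eq])
    show "alternating (\<lambda>cs. sc (aprod x a ?m) * H i cs)"
    proof (rule alternatingI)
      fix xs c d ys assume "c < (d::nat)"
      then show "sc (aprod x a ?m) * H i (xs @ d # c # ys) = sc (- inverse q) * (sc (aprod x a ?m) * H i (xs @ c # d # ys))"
        by (simp only: alternating_swap[OF H] sc_left[of "sc (aprod x a ?m)"])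
    qed (simp add: alternating_same[OF H])
  qed
qed

lemma aprod_nz:
  assumes "\<And>k. x \<noteq> u k" "\<And>k. inverse q * x \<noteq> q * u k"
  shows "aprod x a m \<noteq> 0"
proof -
  have "bprod x a m \<noteq> 0" for a m by (induction m arbitrary: a) (use assms in auto)
  then show ?thesis using assms by (simp add: aprod_def)
qed

text \<open>The q-minor with row set \<open>I\<close>, column word \<open>es\<close> and parameters
  u_a, u_{a+1}, ...; the columns need be neither ordered nor distinct.\<close>

definition minor :: "(nat \<Rightarrow> nat \<Rightarrow> nat \<Rightarrow> 'l) \<Rightarrow> nat \<Rightarrow> nat \<Rightarrow> nat set \<Rightarrow> nat list \<Rightarrow> 'l" where
  "minor t N a I es = (\<Sum>ds\<in>tuples N (length es). sc (wt I ds) * prodM t a ds es)"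

lemma alternating_minor: "adjacent_rel t \<Longrightarrow> alternating (minor t N a I)"
  unfolding minor_def
  by (rule alternating_sum_prodM[where F = "\<lambda>ds z. sc (wt I ds) * z"])
    (simp_all add: distrib_left alternating_same[OF alternating_wt] alternating_swap[OF alternating_wt],
     simp_all add: sc_mult[symmetric] sc_sc mult.commute)

text \<open>The exchange relation is placed between the q-sign vector of \<open>I\<close> with j in
  the auxiliary copy, and the column word with d there. As j is among the rows and d among the
  columns, both sides acquire the same scalar \<open>aprod\<close>, which cancels.\<close>

lemma minor_commute:
  assumes rel: "\<And>k. rtt_rel sc q x (u k) X (t k)" and t: "adjacent_rel t"
    and nz: "\<And>k. x \<noteq> u k" "\<And>k. inverse q * x \<noteq> q * u k"
    and j: "j \<in> I" "I \<subseteq> {1..N}" and d: "d \<in> set cs"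
  shows "X j d * minor t N a I cs = minor t N a I cs * X j d"
proof -
  let ?m = "length cs"
  \<comment> \<open>The row vector e_j tensor the q-sign of \<open>I\<close>. Since j is in
    \<open>I\<close>, it vanishes unless the auxiliary index repeats a letter, which is the
    situation of \<open>col_mem\<close>.\<close>
  define H where "H = (\<lambda>i bs. if i = j then sc (wt I bs) else 0)"
  have altH: "alternating (H i)" for i
    using alternating_wt by (auto simp: H_def alternating_def)
  have "(\<Sum>bs\<in>tuples N ?m. sc (wt I bs) * row x bs a (\<lambda>i bs'. X i d * prodM t a bs' cs) j)
      = (\<Sum>i\<in>{1..N}. if i = j then \<Sum>bs\<in>tuples N ?m. sc (wt I bs) * row x bs a (\<lambda>i bs'. X i d * prodM t a bs' cs) j else 0)"
    using j by (subst sum.delta) auto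
  also have "\<dots> = (\<Sum>i\<in>{1..N}. \<Sum>bs\<in>tuples N ?m. H i bs * row x bs a (\<lambda>i bs'. X i d * prodM t a bs' cs) i)"
    by (rule sum.cong) (auto simp: H_def)
  also have "\<dots> = (\<Sum>i\<in>{1..N}. \<Sum>bs\<in>tuples N ?m. col x bs a H i * (X i d * prodM t a bs cs))"
    by (rule row_col_dual)
  also have "\<dots> = (\<Sum>i\<in>{1..N}. \<Sum>bs\<in>tuples N ?m. sc (aprod x a ?m) * H i bs * (X i d * prodM t a bs cs))"
  proof (intro sum.cong refl)
    fix i bs assume bs: "bs \<in> tuples N ?m"
    have "col x bs a H i = sc (aprod x a (length bs)) * H i bs"
    proof (cases "i \<in> set bs")
      case True
      then show ?thesis by (rule col_mem[OF altH])
    next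
      case False
      then have H0: "H i bs = 0" using j(1) by (auto simp: H_def wt_def)
      \<comment> \<open>Here all indices are distinct if \<open>bs\<close> is, and the R-matrices
        preserve this, whereas j occurs twice wherever \<open>H\<close> is nonzero.\<close>
      have "col x bs a H i = 0"
      proof (cases "distinct bs")
        case True
        show ?thesis
        proof (rule col_zero_mset)
          fix i' bs' assume "add_mset i' (mset bs') = add_mset i (mset bs)"
          then have "mset (i' # bs') = mset (i # bs)" by simp
          then have "distinct (i' # bs')" using True False by (metis distinct.simps(2) mset_eq_imp_distinct_iff)
          then show "H i' bs' = 0" using j(1) by (auto simp: H_def wt_def)
        qed
      qed (rule alternating_not_distinct[OF alternating_col[OF altH]])
      then show ?thesis by (simp add: H0)
    qed
    then show "col x bs a H i * (X i d * prodM t a bs cs) = sc (aprod x a ?m) * H i bs * (X i d * prodM t a bs cs)"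
      by (simp add: tuples_length[OF bs])
  qed
  also have "\<dots> = (\<Sum>i\<in>{1..N}. if i = j then \<Sum>bs\<in>tuples N ?m. sc (aprod x a ?m) * sc (wt I bs) * (X j d * prodM t a bs cs) else 0)"
    by (rule sum.cong) (auto simp: H_def)
  also have "\<dots> = (\<Sum>bs\<in>tuples N ?m. sc (aprod x a ?m) * sc (wt I bs) * (X j d * prodM t a bs cs))"
    using j by (subst sum.delta) auto
  also have "\<dots> = sc (aprod x a ?m) * (X j d * minor t N a I cs)"
    unfolding minor_def sum_distrib_left by (intro sum.cong refl) (simp only: mult.assoc sc_left[of "X j d"])
  finally have left: "(\<Sum>bs\<in>tuples N ?m. sc (wt I bs) * row x bs a (\<lambda>i bs'. X i d * prodM t a bs' cs) j)
     = sc (aprod x a ?m) * (X j d * minor t N a I cs)" .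
  \<comment> \<open>The same quantity with the R-matrices moved over to the column side.\<close>
  have "(\<Sum>bs\<in>tuples N ?m. sc (wt I bs) * row x bs a (\<lambda>i bs'. X i d * prodM t a bs' cs) j)
     = (\<Sum>bs\<in>tuples N ?m. sc (wt I bs) * col x cs a (\<lambda>d' cs'. prodM t a bs cs' * X j d') d)"
    by (intro sum.cong refl) (simp add: row_col_exchange[OF rel] tuples_length)
  also have "\<dots> = col x cs a (\<lambda>d' cs'. \<Sum>bs\<in>tuples N ?m. sc (wt I bs) * (prodM t a bs cs' * X j d')) d"
    by (subst col_sum) (simp_all add: col_lmult)
  also have "\<dots> = col x cs a (\<lambda>d' cs'. minor t N a I cs' * X j d') d"
    by (rule col_cong) (simp add: minor_def sum_distrib_right mult.assoc)
  also have "\<dots> = sc (aprod x a ?m) * (minor t N a I cs * X j d)"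
  proof (rule col_mem[OF _ d])
    show "alternating (\<lambda>cs'. minor t N a I cs' * X j d')" for d'
      using alternating_minor[OF t, of N a I] by (simp add: alternating_def mult.assoc)
  qed
  finally have "sc (aprod x a ?m) * (X j d * minor t N a I cs) = sc (aprod x a ?m) * (minor t N a I cs * X j d)"
    by (simp only: left)
  then show ?thesis by (rule sc_cancel[rotated]) (rule aprod_nz[OF nz])
qed

end

section \<open>The pair map f and the recursion for p' on words\<close>

lemma card_nz_nonempty: "card B \<noteq> 0 \<Longrightarrow> B \<noteq> {}"
  by auto

lemma sum_permutations_of_set_Cons:
  assumes "finite A" "A \<noteq> {}"
  shows "(\<Sum>xs\<in>permutations_of_set A. f xs) = (\<Sum>x\<in>A. \<Sum>xs\<in>permutations_of_set (A - {x}). f (x # xs))"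
proof -
  have "(\<Sum>xs\<in>permutations_of_set A. f xs) = (\<Sum>xs\<in>(\<Union>x\<in>A. (#) x ` permutations_of_set (A - {x})). f xs)"
    by (subst permutations_of_set_nonempty[OF assms(2)]) (rule refl)
  also have "\<dots> = (\<Sum>x\<in>A. \<Sum>xs\<in>(#) x ` permutations_of_set (A - {x}). f xs)"
    by (rule sum.UNION_disjoint) (use assms in auto)
  also have "\<dots> = (\<Sum>x\<in>A. \<Sum>xs\<in>permutations_of_set (A - {x}). f (x # xs))"
    by (rule sum.cong[OF refl], subst sum.reindex) auto
  finally show ?thesis .
qed

lemma sum_permutations_of_set_rev:
  "(\<Sum>xs\<in>permutations_of_set A. f (rev xs)) = (\<Sum>xs\<in>permutations_of_set A. f xs)"
  by (rule sum.reindex_bij_witness[of _ rev rev]) (auto simp: permutations_of_set_def)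

lemma sum_permutations_of_set_snoc:
  assumes "finite A" "A \<noteq> {}"
  shows "(\<Sum>xs\<in>permutations_of_set A. f xs) = (\<Sum>x\<in>A. \<Sum>xs\<in>permutations_of_set (A - {x}). f (xs @ [x]))"
proof -
  have "(\<Sum>xs\<in>permutations_of_set A. f xs) = (\<Sum>xs\<in>permutations_of_set A. f (rev xs))"
    by (simp only: sum_permutations_of_set_rev)
  also have "\<dots> = (\<Sum>x\<in>A. \<Sum>xs\<in>permutations_of_set (A - {x}). f (rev xs @ [x]))"
    by (subst sum_permutations_of_set_Cons[OF assms]) simp
  also have "\<dots> = (\<Sum>x\<in>A. \<Sum>xs\<in>permutations_of_set (A - {x}). f (xs @ [x]))"
    by (rule sum.cong[OF refl], rule sum_permutations_of_set_rev)
  finally show ?thesis .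
qed

text \<open>The order of summation follows the expansion: first the row l lost at the right end,
  then the row k lost at the left end.\<close>

lemma sum_permutations_of_set_ends:
  assumes "finite A" "card A \<ge> 2"
  shows "(\<Sum>xs\<in>permutations_of_set A. f xs) =
    (\<Sum>l\<in>A. \<Sum>k\<in>A - {l}. \<Sum>ys\<in>permutations_of_set (A - {l} - {k}). f (k # ys @ [l]))"
proof -
  have "(\<Sum>xs\<in>permutations_of_set A. f xs) = (\<Sum>l\<in>A. \<Sum>xs\<in>permutations_of_set (A - {l}). f (xs @ [l]))"
    by (rule sum_permutations_of_set_snoc) (use assms in auto)
  also have "\<dots> = (\<Sum>l\<in>A. \<Sum>k\<in>A - {l}. \<Sum>ys\<in>permutations_of_set (A - {l} - {k}). f ((k # ys) @ [l]))"
  proof (rule sum.cong[OF refl], rule sum_permutations_of_set_Cons)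
    fix l assume "l \<in> A"
    then have "card (A - {l}) \<noteq> 0" using assms by simp
    then show "A - {l} \<noteq> {}" by (rule card_nz_nonempty)
  qed (use assms in simp)
  finally show ?thesis by simp
qed

lemma sorted_list_of_set_Max:
  fixes A :: "nat set"
  assumes "finite A" "A \<noteq> {}"
  shows "sorted_list_of_set A = sorted_list_of_set (A - {Max A}) @ [Max A]"
proof (rule sorted_list_of_set_unique[THEN iffD1])
  show "finite A" by fact
  show "sorted_wrt (<) (sorted_list_of_set (A - {Max A}) @ [Max A]) \<and>
     set (sorted_list_of_set (A - {Max A}) @ [Max A]) = A \<and>
     length (sorted_list_of_set (A - {Max A}) @ [Max A]) = card A"
  proof (intro conjI)
    have "y < Max A" if "y \<in> A - {Max A}" for y
    proof (rule le_neq_implies_less)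
      show "y \<le> Max A" by (rule Max_ge) (use that assms(1) in blast)+
      show "y \<noteq> Max A" using that by blast
    qed
    then show "sorted_wrt (<) (sorted_list_of_set (A - {Max A}) @ [Max A])"
      using assms(1) by (simp add: sorted_wrt_append)
    show "set (sorted_list_of_set (A - {Max A}) @ [Max A]) = A"
      using Max_in[OF assms] assms(1) by auto
    have "card A > 0" using assms by (simp add: card_gt_0_iff)
    then show "length (sorted_list_of_set (A - {Max A}) @ [Max A]) = card A"
      using Max_in[OF assms] assms(1) by simp
  qed
qed

lemma sorted_list_of_set_last:
  fixes A :: "nat set"
  assumes "finite A" "A \<noteq> {}"
  shows "sorted_list_of_set A ! (card A - 1) = Max A"
  by (subst sorted_list_of_set_Max[OF assms]) (simp add: nth_append assms)

lemma sorted_list_of_set_nth_minus: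
  fixes A :: "nat set"
  assumes "finite A" "i < card A - 1"
  shows "sorted_list_of_set A ! i = sorted_list_of_set (A - {Max A}) ! i"
proof -
  from assms(2) have "A \<noteq> {}" by auto
  then show ?thesis
    by (subst sorted_list_of_set_Max[OF assms(1)]) (use assms in \<open>simp_all add: nth_append\<close>)
qed

text \<open>Includes two-element sets, where \<open>card A - 3\<close> truncates to 0; the closing
  step for even N can then be handled like the others.\<close>

lemma pair_map_eq:
  assumes "finite A" "card A \<ge> 2"
  defines "x \<equiv> Max A" and "y \<equiv> Max (A - {Max A})"
  shows "pair_map A (k, l) =
    (if k \<noteq> x \<and> l \<noteq> x then (l, k) else if k \<noteq> y \<and> l = x then (y, k)
     else if k = x \<and> l \<noteq> y then (l, y) else (y, sorted_list_of_set A ! (card A - 3)))"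
proof -
  have A: "A \<noteq> {}" using assms(2) by auto
  have c1: "card (A - {Max A}) = card A - 1" using assms A by simp
  have "card (A - {Max A}) \<noteq> 0" unfolding c1 using assms(2) by linarith
  then have A': "A - {Max A} \<noteq> {}" by (rule card_nz_nonempty)
  have "sorted_list_of_set A ! (card A - 2) = y"
    using sorted_list_of_set_last[of "A - {Max A}"] A' assms(1,2) c1
    by (subst sorted_list_of_set_nth_minus) (auto simp: y_def numeral_2_eq_2)
  moreover have "sorted_list_of_set A ! (card A - 1) = x"
    using sorted_list_of_set_last[OF assms(1) A] by (simp add: x_def)
  ultimately show ?thesis by (simp add: pair_map_def Let_def)
qed

lemma sorted_list_of_set_third_last:
  fixes A :: "nat set"
  assumes "finite A" "card A \<ge> 3"
  shows "sorted_list_of_set A ! (card A - 3) = Max (A - {Max A} - {Max (A - {Max A})})"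
proof -
  have A: "A \<noteq> {}" using assms(2) by auto
  have c1: "card (A - {Max A}) = card A - 1" using assms A by simp
  have "card (A - {Max A}) \<noteq> 0" unfolding c1 using assms(2) by linarith
  then have A': "A - {Max A} \<noteq> {}" by (rule card_nz_nonempty)
  then have c2: "card (A - {Max A} - {Max (A - {Max A})}) = card A - 2"
    using Max_in[OF _ A'] assms(1) c1 by simp
  have "card (A - {Max A} - {Max (A - {Max A})}) \<noteq> 0" unfolding c2 using assms(2) by linarith
  then have A'': "A - {Max A} - {Max (A - {Max A})} \<noteq> {}" by (rule card_nz_nonempty)
  have h: "card A - 3 < card A - 1" using assms(2) by linarith
  have h': "card A - 3 < card (A - {Max A}) - 1" unfolding c1 using assms(2) by linarith
  have h'': "card A - 3 = card A - 2 - 1" using assms(2) by linarith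
  have fin: "finite (A - {Max A})" "finite (A - {Max A} - {Max (A - {Max A})})" 
    using assms(1) by (simp_all only: finite_Diff)
  have "sorted_list_of_set A ! (card A - 3) = sorted_list_of_set (A - {Max A}) ! (card A - 3)"
    using sorted_list_of_set_nth_minus[OF assms(1) h] .
  also have "\<dots> = sorted_list_of_set (A - {Max A} - {Max (A - {Max A})}) ! (card A - 3)"
    using sorted_list_of_set_nth_minus[OF fin(1) h'] .
  also have "\<dots> = Max (A - {Max A} - {Max (A - {Max A})})"
    using sorted_list_of_set_last[OF fin(2) A''] unfolding c2 h'' .
  finally show ?thesis .
qed

text \<open>The value does not depend on k. Hence the next column to be removed can be fixed once l
  is known, before the sum over k is formed.\<close>

lemma fst_pair_map:
  assumes "finite A" "card A \<ge> 2" "k \<noteq> l"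
  shows "fst (pair_map A (k, l)) = (if l = Max A then Max (A - {Max A}) else l)"
  unfolding pair_map_eq[OF assms(1,2)] using assms(3) by auto

text \<open>The columns in play while the rows are \<open>A\<close>: the elements of
  \<open>A\<close> except the largest, and a column \<open>c\<close> that will be the last. The
  recursion starts with A = {1..N} and c = N, where these are all of \<open>A\<close>. A multiset is
  used because \<open>c\<close> is arbitrary.\<close>

definition cols_of :: "nat set \<Rightarrow> nat \<Rightarrow> nat multiset" where
  "cols_of A c = (if A = {} then {#} else add_mset c (mset_set (A - {Max A})))"

text \<open>The origin of f: after two rows and two columns have been removed, the columns left
  again have the form \<open>cols_of\<close> over the rows left. The second component of f is the
  column that has lost its row, or the largest column if none has.\<close>

lemma pair_map_cols_of:
  assumes fin: "finite A" and card: "card A \<ge> 2" and kl: "k \<in> A" "l \<in> A" "k \<noteq> l"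
  shows "mset_set (A - {Max A} - {fst (pair_map A (k, l))}) = cols_of (A - {l} - {k}) (snd (pair_map A (k, l)))"
proof (cases "card A = 2")
  \<comment> \<open>With two elements no row is left over, and \<open>cols_of\<close> of the empty
    set is empty whatever second component \<open>pair_map\<close> yields.\<close>
  case True
  with kl have A: "A = {k, l}" by (metis card_2_iff doubleton_eq_iff insertE singletonD)
  have "A - {Max A} - {fst (pair_map A (k, l))} = {}"
  proof (cases "k < l")
    case True
    then have "Max A = l" "A - {l} = {k}" using A by (auto simp: max_def)
    then show ?thesis by (simp add: fst_pair_map[OF fin card kl(3)])
  next
    case False
    then have "Max A = k" "A - {k} = {l}" using A kl by (auto simp: max_def)
    then show ?thesis using kl by (simp add: fst_pair_map[OF fin card kl(3)])
  qed
  moreover have "A - {l} - {k} = {}" using A by auto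
  ultimately show ?thesis by (simp only: cols_of_def mset_set.empty if_True simp_thms)
next
  case False
  define x where "x = Max A"
  define y where "y = Max (A - {x})"
  have A: "A \<noteq> {}" using card by auto
  have xA: "x \<in> A" unfolding x_def using fin A by (rule Max_in)
  have c1: "card (A - {x}) = card A - 1" using fin xA by simp
  then have "card (A - {x}) \<noteq> 0" using card by simp
  then have A': "A - {x} \<noteq> {}" by (rule card_nz_nonempty)
  have finx: "finite (A - {x})" "finite (A - {x} - {y})" "finite (A - {l} - {k})" using fin by simp_all
  have yA: "y \<in> A - {x}" unfolding y_def by (rule Max_in[OF finx(1) A'])
  have "card (A - {x} - {y}) = card A - 2" using fin yA c1 by simp
  then have "card (A - {x} - {y}) \<noteq> 0" using card False by simp
  then have A'': "A - {x} - {y} \<noteq> {}" by (rule card_nz_nonempty)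
  define z where "z = Max (A - {x} - {y})"
  have zA: "z \<in> A - {x} - {y}" unfolding z_def by (rule Max_in[OF finx(2) A''])
  have third: "sorted_list_of_set A ! (card A - 3) = z"
    using sorted_list_of_set_third_last[OF fin] card False by (simp add: z_def x_def y_def)
  have lex: "a \<le> x" if "a \<in> A" for a unfolding x_def using fin that by (rule Max_ge)
  have ley: "a \<le> y" if "a \<in> A" "a \<noteq> x" for a
    unfolding y_def by (rule Max_ge) (use fin that in simp_all)
  have lez: "a \<le> z" if "a \<in> A" "a \<noteq> x" "a \<noteq> y" for a
    unfolding z_def by (rule Max_ge) (use fin that in simp_all)
  have pm: "pair_map A (k, l) = (if k \<noteq> x \<and> l \<noteq> x then (l, k) else if k \<noteq> y \<and> l = x then (y, k)
     else if k = x \<and> l \<noteq> y then (l, y) else (y, z))"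
    by (subst pair_map_eq[OF fin card]) (simp only: x_def[symmetric] y_def[symmetric] third)
  have nonempty: "A - {l} - {k} \<noteq> {}"
  proof
    assume "A - {l} - {k} = {}"
    then have "A \<subseteq> {k, l}" by auto
    then have "card A \<le> 2" using card_mono[of "{k, l}" A] kl by simp
    then show False using card False by simp
  qed
  have MaxI: "Max (A - {l} - {k}) = w" if "w \<in> A" "w \<noteq> l" "w \<noteq> k" "\<And>a. a \<in> A \<Longrightarrow> a \<noteq> l \<Longrightarrow> a \<noteq> k \<Longrightarrow> a \<le> w" for w
    by (rule Max_eqI[OF finx(3)]) (use that in simp_all)
  have ins: "add_mset c (mset_set B) = mset_set (insert c B)" if "finite B" "c \<notin> B" for c :: nat and B
    using that by simp
  have goal: ?thesis if "pair_map A (k, l) = (j, c)" "Max (A - {l} - {k}) = w" "c \<notin> A - {l} - {k} - {w}"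
      "A - {x} - {j} = insert c (A - {l} - {k} - {w})" for w j c
    unfolding cols_of_def x_def[symmetric] that(1,2) fst_conv snd_conv that(4)
    using nonempty fin that(3) by (simp only: if_False) (rule mset_set.insert, simp_all)
  \<comment> \<open>The clauses in the definition of f; the last two cases are the two orders of the
    pair of largest elements, which f treats alike.\<close>
  consider "k \<noteq> x" "l \<noteq> x" | "l = x" "k \<noteq> y" "k \<noteq> x" | "k = x" "l \<noteq> y" "l \<noteq> x" | "k = y" "l = x" | "k = x" "l = y"
    using kl by blast
  then show ?thesis
  proof cases
    case 1
    have "pair_map A (k, l) = (l, k)" unfolding pm using 1 by simp
    moreover have "Max (A - {l} - {k}) = x" by (rule MaxI) (use 1 xA lex in blast)+
    ultimately show ?thesis by (rule goal) (use 1 kl xA in blast)+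
  next
    case 2
    have "pair_map A (k, l) = (y, k)" unfolding pm using 2 by simp
    moreover have "Max (A - {l} - {k}) = y" by (rule MaxI) (use 2 yA ley in blast)+
    ultimately show ?thesis by (rule goal) (use 2 kl yA in blast)+
  next
    case 3
    have "pair_map A (k, l) = (l, y)" unfolding pm using 3 by simp
    moreover have "Max (A - {l} - {k}) = y" by (rule MaxI) (use 3 yA ley in blast)+
    ultimately show ?thesis by (rule goal) (use 3 kl yA in blast)+
  next
    case 4
    have "pair_map A (k, l) = (y, z)" unfolding pm using 4 kl by simp
    moreover have "Max (A - {l} - {k}) = z" by (rule MaxI) (use 4 yA zA lez in blast)+
    ultimately show ?thesis by (rule goal) (use 4 kl yA zA in blast)+
  next
    case 5
    have "pair_map A (k, l) = (y, z)" unfolding pm using 5 kl by simp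
    moreover have "Max (A - {l} - {k}) = z" by (rule MaxI) (use 5 yA zA lez in blast)+
    ultimately show ?thesis by (rule goal) (use 5 kl yA zA in blast)+
  qed
qed

text \<open>Step i of the recursion fixes p'_i and p'_{N-i}, while p'_{N-i+1} is known from the step
  before. Accordingly \<open>c\<close> is the value already assigned to the last place, and the
  second component of the pair map is handed on as the last value of the inner word.\<close>

function prime_list :: "nat set \<Rightarrow> nat \<Rightarrow> nat list \<Rightarrow> nat list" where
  "prime_list A c xs = (case xs of [] \<Rightarrow> [] | [x] \<Rightarrow> [c] | _ \<Rightarrow>
     (let (j, c') = pair_map A (hd xs, last xs)
      in j # prime_list (A - {last xs} - {hd xs}) c' (butlast (tl xs)) @ [c]))"
  by pat_completeness auto
termination
  by (relation "measure (\<lambda>(A, c, xs). length xs)") auto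

declare prime_list.simps [simp del]

lemma prime_list_Nil [simp]: "prime_list A c [] = []"
  by (simp add: prime_list.simps)

lemma prime_list_single [simp]: "prime_list A c [x] = [c]"
  by (simp add: prime_list.simps)

lemma prime_list_ends:
  "prime_list A c (k # ys @ [l]) = fst (pair_map A (k, l)) #
     prime_list (A - {l} - {k}) (snd (pair_map A (k, l))) ys @ [c]"
  by (subst prime_list.simps) (auto simp: case_prod_beta split: list.splits)

lemma list_ends_cases:
  obtains "xs = []" | x where "xs = [x]" | k ys l where "xs = k # ys @ [l]"
  by (metis append_butlast_last_id list.exhaust)

text \<open>Every value taken out is one of the current columns, by \<open>pair_map_cols_of\<close>.
  Thus the inversions of p' can be counted in the column words that occur in the expansion.\<close>

lemma mset_prime_list:
  assumes "xs \<in> permutations_of_set A"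
  shows "mset (prime_list A c xs) = cols_of A c"
  using assms
proof (induction xs arbitrary: A c rule: length_induct)
  case (1 xs)
  from 1(2) have A: "finite A" "card A = length xs" "A = set xs" "distinct xs"
    by (auto simp: permutations_of_set_def distinct_card)
  show ?case
  proof (cases rule: list_ends_cases[of xs])
    case 1
    then show ?thesis using A by (simp add: cols_of_def)
  next
    case (2 x)
    then show ?thesis using A by (simp add: cols_of_def)
  next
    case (3 k ys l)
    let ?j = "fst (pair_map A (k, l))"
    have kl: "k \<in> A" "l \<in> A" "k \<noteq> l" "card A \<ge> 2" using A 3 by auto
    have "ys \<in> permutations_of_set (A - {l} - {k})"
      using A 3 by (auto simp: permutations_of_set_def)
    then have "mset (prime_list (A - {l} - {k}) (snd (pair_map A (k, l))) ys) = mset_set (A - {Max A} - {?j})"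
      using 1(1) 3 pair_map_cols_of[OF A(1) kl(4,1-3)] by simp
    moreover have "?j \<in> A - {Max A}"
    proof -
      have "A \<noteq> {}" using kl by blast
      then have "card (A - {Max A}) = card A - 1" using A(1) by (intro card_Diff_singleton Max_in)
      then have "card (A - {Max A}) \<noteq> 0" using kl(4) by linarith
      then have "A - {Max A} \<noteq> {}" by (rule card_nz_nonempty)
      then show ?thesis using Max_in[of "A - {Max A}"] kl A(1) unfolding fst_pair_map[OF A(1) kl(4) kl(3)] by simp
    qed
    ultimately have "mset (?j # prime_list (A - {l} - {k}) (snd (pair_map A (k, l))) ys) = mset_set (A - {Max A})"
      using A(1) by (simp add: mset_set.remove[of "A - {Max A}" ?j])
    moreover have "A \<noteq> {}" using kl by blast
    ultimately show ?thesis
      by (simp add: 3 prime_list_ends cols_of_def)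
  qed
qed

section \<open>Products of a q-minor of T with entries of T-bar\<close>

text \<open>\<open>t i\<close> stands for T(u_i) and \<open>tb i\<close> for T-bar(u_i^{-1}). The
  last two conditions make the scalar that is cancelled in \<open>minor_commute\<close>
  nonzero.\<close>

locale sklyanin = fusion sc q u for sc :: "'k::field \<Rightarrow> 'l::ring_1" and q u +
  fixes N :: nat and t tb :: "nat \<Rightarrow> nat \<Rightarrow> nat \<Rightarrow> 'l"
  assumes relTT: "rtt_rel sc q (u i) (u j) (t i) (t j)"
    and relBB: "rtt_rel sc q (inverse (u i)) (inverse (u j)) (tb i) (tb j)"
    and relBT: "rtt_rel sc q (inverse (u i)) (u j) (tb i) (t j)"
    and u_nz: "u i \<noteq> 0" and q2: "q * q \<noteq> 1"
    and nz1: "inverse (u i) \<noteq> u j"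
    and nz2: "inverse q * inverse (u i) \<noteq> q * u j"
begin

abbreviation \<kappa> where "\<kappa> \<equiv> - inverse q"

definition tbt :: "nat \<Rightarrow> nat \<Rightarrow> nat \<Rightarrow> 'l" where "tbt a d e = tb a e d"

lemma qinv_nz: "inverse q - q \<noteq> 0"
  using q2 q_nz by (simp add: field_simps)

lemma rtt_relD:
  "rtt_rel sc q x v X Y \<Longrightarrow>
     sc (rdiag q x v a b) * (X a c * Y b d) + sc (roff q x v a b) * (X b c * Y a d) =
     sc (rdiag q x v c d) * (Y b d * X a c) + sc (roff q x v d c) * (Y b c * X a d)"
  unfolding rtt_rel_def by blast

text \<open>At u_{a+1} = u_a/q^2 the coefficients of R for equal indices vanish, and on a pair of
  distinct indices R has rank one. Dividing by the common factor k leaves the q-antisymmetrized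
  relation.\<close>

lemma adjacent_t: "adjacent_rel t"
  unfolding adjacent_rel_def
proof (intro allI impI conjI)
  fix a b b' c :: nat assume bb: "b < b'"
  define k where "k = (inverse q - q) * u a"
  have k: "k \<noteq> 0" using qinv_nz u_nz by (simp add: k_def)
  have diag: "x \<noteq> y \<Longrightarrow> rdiag q (u a) (u (Suc a)) x y = k * \<kappa>" "rdiag q (u a) (u (Suc a)) x x = 0"
    and off: "y < x \<Longrightarrow> roff q (u a) (u (Suc a)) x y = k" "x < y \<Longrightarrow> roff q (u a) (u (Suc a)) x y = k * \<kappa> * \<kappa>" for x y
    using q_nz by (simp_all add: rdiag_def roff_def k_def u_Suc field_simps)
  let ?phi = "\<lambda>c d. t a b c * t (Suc a) b' d + sc \<kappa> * (t a b' c * t (Suc a) b d)"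
  have lhs: "sc k * ?phi c d = sc (rdiag q (u a) (u (Suc a)) c d) * (t (Suc a) b d * t a b' c)
       + sc (roff q (u a) (u (Suc a)) d c) * (t (Suc a) b c * t a b' d)" for c d
    using rtt_relD[OF relTT[of a "Suc a"], of b' b c d] bb
    by (simp add: diag off distrib_left sc_sc add.commute)
  {
    fix d assume cd: "c < d"
    have "sc k * ?phi d c = sc k * (sc \<kappa> * ?phi c d)"
    proof -
      have "sc k * ?phi d c = sc (k * \<kappa>) * (t (Suc a) b c * t a b' d) + sc (k * \<kappa> * \<kappa>) * (t (Suc a) b d * t a b' c)"
        using cd by (subst lhs) (simp add: diag off)
      also have "\<dots> = sc \<kappa> * (sc (k * \<kappa>) * (t (Suc a) b d * t a b' c) + sc k * (t (Suc a) b c * t a b' d))"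
        by (simp only: distrib_left sc_sc mult.commute[of \<kappa>] add.commute)
      also have "\<dots> = sc \<kappa> * (sc k * ?phi c d)"
        using cd by (subst lhs) (simp add: diag off)
      also have "\<dots> = sc k * (sc \<kappa> * ?phi c d)" by (simp only: sc_sc mult.commute)
      finally show ?thesis .
    qed
    then show "?phi d c = sc \<kappa> * ?phi c d" by (rule sc_cancel[OF k])
  }
  have "sc k * ?phi c c = sc k * 0"
    by (subst lhs) (simp add: diag roff_def)
  then show "?phi c c = 0" by (rule sc_cancel[OF k])
qed

text \<open>Transposition exchanges rows and columns, so the degenerate R-matrix on the right-hand
  side of the RTT relation is used. As the parameters are inverted, the copies enter in the order
  a+1, a.\<close>

lemma adjacent_tbt: "adjacent_rel tbt"
  unfolding adjacent_rel_def tbt_def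
proof (intro allI impI conjI)
  fix a b b' e :: nat assume bb: "b < b'"
  define k where "k = (inverse q - q) * inverse (u a)"
  have k: "k \<noteq> 0" using qinv_nz u_nz by (simp add: k_def)
  have k': "k * (- q) \<noteq> 0" using k q_nz by simp
  let ?x = "inverse (u (Suc a))" and ?v = "inverse (u a)"
  have diag: "x \<noteq> y \<Longrightarrow> rdiag q ?x ?v x y = k * (- q)" "rdiag q ?x ?v x x = 0"
    and off: "y < x \<Longrightarrow> roff q ?x ?v x y = k * q * q" "x < y \<Longrightarrow> roff q ?x ?v x y = k" for x y
    using q_nz u_nz[of a] by (simp_all add: rdiag_def roff_def k_def u_Suc field_simps)
  let ?phi = "\<lambda>e f. tb a e b * tb (Suc a) f b' + sc \<kappa> * (tb a e b' * tb (Suc a) f b)"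
  have kq: "k * (- q) * \<kappa> = k" and kq': "\<kappa> * (k * (- q)) = k" "\<kappa> * (k * q * q) = k * (- q)"
    using q_nz by (simp_all add: field_simps)
  have rhs: "sc (k * (- q)) * ?phi e f = sc (rdiag q ?x ?v f e) * (tb (Suc a) f b' * tb a e b)
       + sc (roff q ?x ?v f e) * (tb (Suc a) e b' * tb a f b)" for e f
    using rtt_relD[OF relBB[of "Suc a" a], of f e b' b] bb
    by (simp only: distrib_left sc_sc kq diag off less_imp_neq[symmetric] not_False_eq_True)
  {
    fix f assume ef: "e < f"
    have "sc (k * (- q)) * ?phi f e = sc (k * (- q)) * (sc \<kappa> * ?phi e f)"
    proof -
      have "sc (k * (- q)) * ?phi f e = sc (k * (- q)) * (tb (Suc a) e b' * tb a f b) + sc k * (tb (Suc a) f b' * tb a e b)"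
        using ef by (subst rhs) (simp add: diag off)
      also have "\<dots> = sc \<kappa> * (sc (k * (- q)) * (tb (Suc a) f b' * tb a e b) + sc (k * q * q) * (tb (Suc a) e b' * tb a f b))"
        by (simp only: distrib_left sc_sc kq' add.commute)
      also have "\<dots> = sc \<kappa> * (sc (k * (- q)) * ?phi e f)"
        using ef by (subst rhs) (simp add: diag off)
      also have "\<dots> = sc (k * (- q)) * (sc \<kappa> * ?phi e f)" by (simp only: sc_sc mult.commute)
      finally show ?thesis .
    qed
    then show "?phi f e = sc \<kappa> * ?phi e f" by (rule sc_cancel[OF k'])
  }
  have "sc (k * (- q)) * ?phi e e = sc (k * (- q)) * 0"
    by (subst rhs) (simp add: diag roff_def)
  then show "?phi e e = 0" by (rule sc_cancel[OF k'])
qed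

abbreviation tau where "tau \<equiv> minor t N"

lemmas alternating_tau = alternating_minor[OF adjacent_t, of N]

text \<open>A Sklyanin minor with rows \<open>I\<close> and columns \<open>es\<close>, freed from
  the scalar contributed by the R-matrices: all entries of T stand before those of the transposed
  T-bar.\<close>

definition sig :: "nat \<Rightarrow> nat set \<Rightarrow> nat list \<Rightarrow> 'l" where
  "sig a I es = (\<Sum>ds\<in>tuples N (length es). tau a I ds * prodM tbt a ds es)"

text \<open>The opposite order of the two groups of factors; the expansions lead from
  \<open>sig\<close> to \<open>sigb\<close> and back.\<close>

definition sigb :: "nat \<Rightarrow> nat set \<Rightarrow> nat list \<Rightarrow> 'l" where
  "sigb a I es = (\<Sum>ds\<in>tuples N (length es). prodM tbt a ds es * tau a I ds)"

text \<open>The q-minor is alternating in \<open>ds\<close>, and multiplication by it from the left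
  is the additive map \<open>F ds\<close>; for \<open>sigb\<close> it acts from the right.\<close>

lemma alternating_sig: "alternating (sig a I)"
  unfolding sig_def
proof (rule alternating_sum_prodM[OF adjacent_tbt, where F = "\<lambda>ds z. tau a I ds * z"])
  show "tau a I (xs @ d # c # ys) * z = tau a I (xs @ c # d # ys) * (sc \<kappa> * z)" if "c < d" for xs c d ys z
    by (simp only: alternating_swap[OF alternating_tau that] sc_left[of "tau a I _"] mult.assoc)
qed (simp_all add: distrib_left alternating_same[OF alternating_tau] sc_left[of "tau a I _"])

lemma alternating_sigb: "alternating (sigb a I)"
  unfolding sigb_def
proof (rule alternating_sum_prodM[OF adjacent_tbt, where F = "\<lambda>ds z. z * tau a I ds"])
  show "z * tau a I (xs @ d # c # ys) = sc \<kappa> * z * tau a I (xs @ c # d # ys)" if "c < d" for xs c d ys z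
    by (simp only: alternating_swap[OF alternating_tau that] sc_left[of z] mult.assoc)
qed (simp_all add: distrib_right alternating_same[OF alternating_tau] mult.assoc)

text \<open>Laplace expansion along the first column, by splitting off the first letter of the row
  word.\<close>

lemma tau_Cons:
  assumes I: "I \<subseteq> {1..N}"
  shows "tau a I (e # es) = (\<Sum>k\<in>I. sc (\<kappa> ^ card {x\<in>I. x < k}) * (t a k e * tau (Suc a) (I - {k}) es))"
proof -
  have fin: "finite I" using I finite_subset by blast
  have "tau a I (e # es) = (\<Sum>k\<in>{1..N}. \<Sum>ds\<in>tuples N (length es). sc (wt I (k # ds)) * (t a k e * prodM t (Suc a) ds es))"
    by (simp add: minor_def sum_tuples_Suc)
  also have "\<dots> = (\<Sum>k\<in>I. \<Sum>ds\<in>tuples N (length es). sc (wt I (k # ds)) * (t a k e * prodM t (Suc a) ds es))"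
    by (rule sum.mono_neutral_right) (use I in \<open>auto simp: wt_Cons[OF fin] simp del: sum.neutral intro!: sum.neutral\<close>)
  also have "\<dots> = (\<Sum>k\<in>I. sc (\<kappa> ^ card {x\<in>I. x < k}) * (t a k e * tau (Suc a) (I - {k}) es))"
  proof (rule sum.cong[OF refl])
    fix k assume "k \<in> I"
    then show "(\<Sum>ds\<in>tuples N (length es). sc (wt I (k # ds)) * (t a k e * prodM t (Suc a) ds es)) =
        sc (\<kappa> ^ card {x\<in>I. x < k}) * (t a k e * tau (Suc a) (I - {k}) es)"
      unfolding minor_def sum_distrib_left wt_Cons[OF fin]
      by (intro sum.cong refl) (simp only: if_True sc_left[of "t a k e"] sc_sc)
  qed
  finally show ?thesis .
qed

lemma tau_snoc:
  assumes I: "I \<subseteq> {1..N}"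
  shows "tau a I (es @ [e]) = (\<Sum>l\<in>I. sc (\<kappa> ^ card {x\<in>I. l < x}) * (tau a (I - {l}) es * t (a + length es) l e))"
proof -
  have fin: "finite I" using I finite_subset by blast
  have "tau a I (es @ [e]) = (\<Sum>ds\<in>tuples N (length es). \<Sum>l\<in>{1..N}. sc (wt I (ds @ [l])) * (prodM t a ds es * t (a + length es) l e))"
    by (simp add: minor_def sum_tuples_snoc prodM_append tuples_length cong: sum.cong)
  also have "\<dots> = (\<Sum>l\<in>{1..N}. \<Sum>ds\<in>tuples N (length es). sc (wt I (ds @ [l])) * (prodM t a ds es * t (a + length es) l e))"
    by (rule sum.swap)
  also have "\<dots> = (\<Sum>l\<in>I. \<Sum>ds\<in>tuples N (length es). sc (wt I (ds @ [l])) * (prodM t a ds es * t (a + length es) l e))"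
    by (rule sum.mono_neutral_right) (use I in \<open>auto simp: wt_snoc[OF fin] simp del: sum.neutral intro!: sum.neutral\<close>)
  also have "\<dots> = (\<Sum>l\<in>I. sc (\<kappa> ^ card {x\<in>I. l < x}) * (tau a (I - {l}) es * t (a + length es) l e))"
  proof (rule sum.cong[OF refl])
    fix l assume "l \<in> I"
    then show "(\<Sum>ds\<in>tuples N (length es). sc (wt I (ds @ [l])) * (prodM t a ds es * t (a + length es) l e)) =
        sc (\<kappa> ^ card {x\<in>I. l < x}) * (tau a (I - {l}) es * t (a + length es) l e)"
      unfolding minor_def sum_distrib_left sum_distrib_right wt_snoc[OF fin]
      by (intro sum.cong refl) (simp only: if_True sc_sc mult.assoc)
  qed
  finally show ?thesis .
qed

lemma tb_tau_commute:
  assumes "j \<in> I" "I \<subseteq> {1..N}" "d \<in> set cs"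
  shows "tb i j d * tau a I cs = tau a I cs * tb i j d"
  by (rule minor_commute[OF relBT adjacent_t nz1 nz2 assms])

lemma prodM_tbt_tau_commute:
  assumes "length ds = length bs" "set bs \<subseteq> I" "I \<subseteq> {1..N}" "set ds \<subseteq> set cs"
  shows "prodM tbt i ds bs * tau a I cs = tau a I cs * prodM tbt i ds bs"
  using assms
proof (induction ds bs arbitrary: i rule: list_induct2)
  case (Cons d ds b bs)
  have 1: "tbt i d b * tau a I cs = tau a I cs * tbt i d b"
    unfolding tbt_def by (rule tb_tau_commute) (use Cons.prems in auto)
  have 2: "prodM tbt (Suc i) ds bs * tau a I cs = tau a I cs * prodM tbt (Suc i) ds bs"
    by (rule Cons.IH) (use Cons.prems in auto)
  have "prodM tbt i (d # ds) (b # bs) * tau a I cs = tbt i d b * (prodM tbt (Suc i) ds bs * tau a I cs)"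
    by (simp add: mult.assoc)
  also have "\<dots> = tbt i d b * tau a I cs * prodM tbt (Suc i) ds bs"
    by (simp only: 2 mult.assoc)
  also have "\<dots> = tau a I cs * prodM tbt i (d # ds) (b # bs)"
    by (simp only: 1) (simp add: mult.assoc)
  finally show ?case .
qed simp

definition S :: "nat \<Rightarrow> nat \<Rightarrow> nat \<Rightarrow> 'l" where
  "S i l c = (\<Sum>d\<in>{1..N}. t i l d * tb i c d)"

definition Sb :: "nat \<Rightarrow> nat \<Rightarrow> nat \<Rightarrow> 'l" where
  "Sb i k j = (\<Sum>d\<in>{1..N}. tb i j d * t i k d)"

text \<open>The T-bar entries belonging to \<open>bs\<close> have their rows in \<open>I\<close> and
  their summation indices among the columns of the q-minor, so they pass to its left. Expanding the
  q-minor along its last column puts t(l,d) next to the one T-bar entry left, and the sum over d is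
  an entry of S. That last T-bar entry never moves, which is why \<open>c\<close> is
  unrestricted.\<close>

lemma sig_snoc:
  assumes I: "I \<subseteq> {1..N}" and bs: "set bs \<subseteq> I"
  shows "sig a I (bs @ [c]) = (\<Sum>l\<in>I. sc (\<kappa> ^ card {x\<in>I. l < x}) * (sigb a (I - {l}) bs * S (a + length bs) l c))"
proof -
  let ?m = "length bs"
  have "sig a I (bs @ [c]) = (\<Sum>ds\<in>tuples N ?m. \<Sum>d\<in>{1..N}. tau a I (ds @ [d]) * (prodM tbt a ds bs * tb (a + ?m) c d))"
    by (simp add: sig_def sum_tuples_snoc prodM_append tuples_length tbt_def cong: sum.cong)
  also have "\<dots> = (\<Sum>ds\<in>tuples N ?m. \<Sum>d\<in>{1..N}. \<Sum>l\<in>I. sc (\<kappa> ^ card {x\<in>I. l < x}) *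
      (prodM tbt a ds bs * tau a (I - {l}) ds * (t (a + ?m) l d * tb (a + ?m) c d)))"
  proof (rule sum.cong[OF refl], rule sum.cong[OF refl])
    fix ds d assume ds: "ds \<in> tuples N ?m"
    have "tau a I (ds @ [d]) * (prodM tbt a ds bs * tb (a + ?m) c d) = prodM tbt a ds bs * tau a I (ds @ [d]) * tb (a + ?m) c d"
      by (subst prodM_tbt_tau_commute[OF tuples_length[OF ds] bs I]) (auto simp: mult.assoc)
    also have "\<dots> = (\<Sum>l\<in>I. sc (\<kappa> ^ card {x\<in>I. l < x}) *
      (prodM tbt a ds bs * tau a (I - {l}) ds * (t (a + ?m) l d * tb (a + ?m) c d)))"
      unfolding tau_snoc[OF I] tuples_length[OF ds] sum_distrib_left sum_distrib_right
      by (intro sum.cong refl) (simp only: sc_left[of "prodM tbt a ds bs"] mult.assoc)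
    finally show "tau a I (ds @ [d]) * (prodM tbt a ds bs * tb (a + ?m) c d) = (\<Sum>l\<in>I. sc (\<kappa> ^ card {x\<in>I. l < x}) *
      (prodM tbt a ds bs * tau a (I - {l}) ds * (t (a + ?m) l d * tb (a + ?m) c d)))" .
  qed
  also have "\<dots> = (\<Sum>l\<in>I. \<Sum>ds\<in>tuples N ?m. \<Sum>d\<in>{1..N}. sc (\<kappa> ^ card {x\<in>I. l < x}) *
      (prodM tbt a ds bs * tau a (I - {l}) ds * (t (a + ?m) l d * tb (a + ?m) c d)))"
    by (rule sum_swap3)
  also have "\<dots> = (\<Sum>l\<in>I. sc (\<kappa> ^ card {x\<in>I. l < x}) * (sigb a (I - {l}) bs * S (a + ?m) l c))"
    unfolding sigb_def S_def sum_product unfolding sum_distrib_left by (rule refl)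
  finally show ?thesis .
qed

text \<open>The mirror image of \<open>sig_snoc\<close>: the T-bar entries of \<open>bs\<close> pass
  to the right of the q-minor, the one of column j stays on the left and meets t(k,d) from the
  expansion along the first column. The order T-bar, T produces an entry of the transposed
  S-bar.\<close>

lemma sigb_Cons:
  assumes I: "I \<subseteq> {1..N}" and bs: "set bs \<subseteq> I"
  shows "sigb a I (j # bs) = (\<Sum>k\<in>I. sc (\<kappa> ^ card {x\<in>I. x < k}) * (Sb a k j * sig (Suc a) (I - {k}) bs))"
proof -
  let ?m = "length bs"
  have "sigb a I (j # bs) = (\<Sum>d\<in>{1..N}. \<Sum>ds\<in>tuples N ?m. tb a j d * prodM tbt (Suc a) ds bs * tau a I (d # ds))"
    by (simp add: sigb_def sum_tuples_Suc tbt_def)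
  also have "\<dots> = (\<Sum>d\<in>{1..N}. \<Sum>ds\<in>tuples N ?m. \<Sum>k\<in>I. sc (\<kappa> ^ card {x\<in>I. x < k}) *
      ((tb a j d * t a k d) * (tau (Suc a) (I - {k}) ds * prodM tbt (Suc a) ds bs)))"
  proof (rule sum.cong[OF refl], rule sum.cong[OF refl])
    fix ds d assume ds: "ds \<in> tuples N ?m"
    have "prodM tbt (Suc a) ds bs * tau a I (d # ds) = tau a I (d # ds) * prodM tbt (Suc a) ds bs"
      by (rule prodM_tbt_tau_commute[OF tuples_length[OF ds] bs I]) auto
    then have "tb a j d * prodM tbt (Suc a) ds bs * tau a I (d # ds) = tb a j d * tau a I (d # ds) * prodM tbt (Suc a) ds bs"
      by (simp only: mult.assoc)
    also have "\<dots> = (\<Sum>k\<in>I. sc (\<kappa> ^ card {x\<in>I. x < k}) *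
      ((tb a j d * t a k d) * (tau (Suc a) (I - {k}) ds * prodM tbt (Suc a) ds bs)))"
      unfolding tau_Cons[OF I] sum_distrib_left sum_distrib_right
      by (intro sum.cong refl) (simp only: sc_left[of "tb a j d"] mult.assoc)
    finally show "tb a j d * prodM tbt (Suc a) ds bs * tau a I (d # ds) = (\<Sum>k\<in>I. sc (\<kappa> ^ card {x\<in>I. x < k}) *
      ((tb a j d * t a k d) * (tau (Suc a) (I - {k}) ds * prodM tbt (Suc a) ds bs)))" .
  qed
  also have "\<dots> = (\<Sum>k\<in>I. \<Sum>d\<in>{1..N}. \<Sum>ds\<in>tuples N ?m. sc (\<kappa> ^ card {x\<in>I. x < k}) *
      ((tb a j d * t a k d) * (tau (Suc a) (I - {k}) ds * prodM tbt (Suc a) ds bs)))"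
    by (rule sum_swap3)
  also have "\<dots> = (\<Sum>k\<in>I. sc (\<kappa> ^ card {x\<in>I. x < k}) * (Sb a k j * sig (Suc a) (I - {k}) bs))"
    unfolding sig_def Sb_def sum_product unfolding sum_distrib_left by (rule refl)
  finally show ?thesis .
qed

end

section \<open>The expansion over all permutations\<close>

lemma length_filter_mset_cong: "mset xs = mset ys \<Longrightarrow> length (filter P xs) = length (filter P ys)"
  by (metis mset_filter size_mset)

lemma inv_list_ends:
  assumes "mset zs = mset b'" "mset bs = mset (j # b')"
  shows "inv_list (j # zs @ [c]) = length (filter ((<) c) bs) + length (filter (\<lambda>y. y < j) b') + inv_list zs"
  using length_filter_mset_cong[OF assms(1), of "(<) c"] length_filter_mset_cong[OF assms(1), of "\<lambda>y. y < j"]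
    length_filter_mset_cong[OF assms(2), of "(<) c"]
  by (simp add: inv_list_snoc)

lemma prodM_ends:
  assumes "length ys = length zs"
  shows "prodM M a (k # ys @ [l]) (j # zs @ [c]) = M a k j * (prodM M (Suc a) ys zs * M (Suc a + length zs) l c)"
  using prodM_append[OF assms, of M "Suc a" "[l]" "[c]"] by simp

context sklyanin
begin

lemma wt_permutation: "xs \<in> permutations_of_set I \<Longrightarrow> \<kappa> ^ inv_list xs = wt I xs"
  by (simp add: wt_def permutations_of_set_def)

lemma sig_empty: "sig a {} [] = 1" and sigb_empty: "sigb a {} [] = 1"
  by (simp_all add: sig_def sigb_def minor_def wt_def)

abbreviation "Smix n \<equiv> \<lambda>i. if i \<le> n then Sb i else S i"

text \<open>One round: a last column is removed, then a first one. The relation between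
  \<open>a\<close> and \<open>n\<close> puts half of the remaining positions a, a+1, ..., rounded
  down, at or below n; so the left factor is an S-bar and the right factor an S. Inversions of the
  row word carry \<kappa>, those of the column word its inverse.\<close>

lemma sig_expansion_step:
  assumes I: "I \<subseteq> {1..N}" and card: "card I \<ge> 2" and a: "a + card I div 2 = Suc n"
    and es: "mset es = cols_of I c"
    and IH: "\<And>k l es c. k \<in> I \<Longrightarrow> l \<in> I \<Longrightarrow> k \<noteq> l \<Longrightarrow> mset es = cols_of (I - {l} - {k}) c \<Longrightarrow>
      sc (inverse \<kappa> ^ inv_list es) * sig (Suc a) (I - {l} - {k}) es =
      (\<Sum>ys\<in>permutations_of_set (I - {l} - {k}). sc (\<kappa> ^ inv_list ys * inverse \<kappa> ^ inv_list (prime_list (I - {l} - {k}) c ys)) *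
        prodM (Smix n) (Suc a) ys (prime_list (I - {l} - {k}) c ys))"
  shows "sc (inverse \<kappa> ^ inv_list es) * sig a I es =
      (\<Sum>xs\<in>permutations_of_set I. sc (\<kappa> ^ inv_list xs * inverse \<kappa> ^ inv_list (prime_list I c xs)) *
        prodM (Smix n) a xs (prime_list I c xs))"
proof -
  have fin: "finite I" using I finite_subset by blast
  have ne: "I \<noteq> {}" using card by auto
  \<comment> \<open>The columns are rearranged with c in the last place, so that all others lie in
    \<open>I\<close>.\<close>
  define bs where "bs = sorted_list_of_set (I - {Max I})"
  have finI: "finite (I - {Max I})" using fin by simp
  have set_bs: "set bs = I - {Max I}" and dbs: "distinct bs"
    unfolding bs_def by (rule set_sorted_list_of_set[OF finI], rule distinct_sorted_list_of_set)
  have bs: "mset bs = mset_set (I - {Max I})"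
    using mset_set_set[OF dbs] unfolding set_bs by (rule sym)
  have cardM: "card (I - {Max I}) = card I - 1" using fin ne by (intro card_Diff_singleton Max_in)
  have lbs: "length bs = card I - 1" by (simp add: bs_def cardM)
  let ?i\<kappa> = "inverse \<kappa>"
  let ?G = "\<lambda>l. card {x\<in>I. l < x}" and ?L = "\<lambda>l k. card {x\<in>I - {l}. x < k}"
  let ?C = "length (filter ((<) c) bs)"
  let ?s = "Suc a + (card I - 2)"
  have s: "a + length bs = ?s" using card lbs by simp
  have "mset es = mset (bs @ [c])" using es ne by (simp add: cols_of_def bs)
  from alternating_perm_inverse[OF alternating_sig this]
  have "sc (?i\<kappa> ^ inv_list es) * sig a I es = sc (?i\<kappa> ^ inv_list (bs @ [c])) * sig a I (bs @ [c])" .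
  also have "\<dots> = (\<Sum>l\<in>I. sc (?i\<kappa> ^ inv_list (bs @ [c])) * (sc (\<kappa> ^ ?G l) * (sigb a (I - {l}) bs * S ?s l c)))"
    by (subst sig_snoc[OF I]) (simp_all only: sum_distrib_left s set_bs Diff_subset)
  also have "\<dots> = (\<Sum>l\<in>I. \<Sum>k\<in>I - {l}. \<Sum>ys\<in>permutations_of_set (I - {l} - {k}).
      sc (\<kappa> ^ inv_list (k # ys @ [l]) * ?i\<kappa> ^ inv_list (prime_list I c (k # ys @ [l]))) *
        prodM (Smix n) a (k # ys @ [l]) (prime_list I c (k # ys @ [l])))"
  proof (rule sum.cong[OF refl])
    fix l assume l: "l \<in> I"
    \<comment> \<open>The next column to go, common to all k: the column l, which has just lost its
      row, unless l is the largest row and hence not in \<open>bs\<close>.\<close>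
    define j where "j = (if l = Max I then Max (I - {Max I}) else l)"
    have j: "fst (pair_map I (k, l)) = j" if "k \<noteq> l" for k
      using fst_pair_map[OF fin card that] by (simp add: j_def)
    have "card (I - {Max I}) \<noteq> 0" using cardM card by linarith
    then have "I - {Max I} \<noteq> {}" by (rule card_nz_nonempty)
    then have jI: "j \<in> I - {Max I}" using Max_in[OF finI] l by (simp add: j_def)
    define b' where "b' = remove1 j bs"
    have set_b': "set b' = I - {Max I} - {j}" and db': "distinct b'"
      unfolding b'_def using set_remove1_eq[OF dbs] distinct_remove1[OF dbs] set_bs by simp_all
    have b': "mset bs = mset (j # b')" "mset b' = mset_set (I - {Max I} - {j})"
    proof -
      show "mset bs = mset (j # b')" 
      proof -
        have "j \<in># mset bs" using jI set_bs by (simp only: set_mset_mset)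
        then show ?thesis by (simp only: b'_def mset.simps mset_remove1 insert_DiffM)
      qed
      show "mset b' = mset_set (I - {Max I} - {j})" using mset_set_set[OF db'] unfolding set_b' by (rule sym)
    qed
    \<comment> \<open>The condition for expanding \<open>sigb\<close>, and the reason for the choice
      of j: the lost row l must not remain as a column of b'.\<close>
    have setb': "set b' \<subseteq> I - {l}" unfolding set_b' j_def by (cases "l = Max I") auto
    have Il: "I - {l} \<subseteq> {1..N}" using I by auto
    have "sc (?i\<kappa> ^ inv_list (bs @ [c])) * (sc (\<kappa> ^ ?G l) * (sigb a (I - {l}) bs * S ?s l c)) =
       sc (?i\<kappa> ^ ?C * \<kappa> ^ ?G l) * ((sc (?i\<kappa> ^ inv_list bs) * sigb a (I - {l}) bs) * S ?s l c)"
      by (simp only: inv_list_snoc power_add sc_sc mult.assoc) (simp only: mult_ac)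
    also have "sc (?i\<kappa> ^ inv_list bs) * sigb a (I - {l}) bs = sc (?i\<kappa> ^ inv_list (j # b')) * sigb a (I - {l}) (j # b')"
      by (rule alternating_perm_inverse[OF alternating_sigb b'(1)])
    also have "sigb a (I - {l}) (j # b') = (\<Sum>k\<in>I - {l}. sc (\<kappa> ^ ?L l k) * (Sb a k j * sig (Suc a) (I - {l} - {k}) b'))"
      by (rule sigb_Cons[OF Il setb'])
    also have "sc (?i\<kappa> ^ ?C * \<kappa> ^ ?G l) * ((sc (?i\<kappa> ^ inv_list (j # b')) *
          (\<Sum>k\<in>I - {l}. sc (\<kappa> ^ ?L l k) * (Sb a k j * sig (Suc a) (I - {l} - {k}) b'))) * S ?s l c) =
       (\<Sum>k\<in>I - {l}. \<Sum>ys\<in>permutations_of_set (I - {l} - {k}).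
         sc (\<kappa> ^ inv_list (k # ys @ [l]) * ?i\<kappa> ^ inv_list (prime_list I c (k # ys @ [l]))) *
           prodM (Smix n) a (k # ys @ [l]) (prime_list I c (k # ys @ [l])))"
      unfolding sum_distrib_left sum_distrib_right
    proof (rule sum.cong[OF refl])
      fix k assume k: "k \<in> I - {l}"
      define c' where "c' = snd (pair_map I (k, l))"
      let ?J = "I - {l} - {k}"
      \<comment> \<open>Puts the remaining columns into the form on which the induction hypothesis
        operates, with c' as the new last column.\<close>
      have mb': "mset b' = cols_of ?J c'"
        using pair_map_cols_of[OF fin card, of k l] k l j[of k] by (simp add: b'(2) c'_def)
      have IH': "sc (?i\<kappa> ^ inv_list b') * sig (Suc a) ?J b' =
        (\<Sum>ys\<in>permutations_of_set ?J. sc (\<kappa> ^ inv_list ys * ?i\<kappa> ^ inv_list (prime_list ?J c' ys)) *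
        prodM (Smix n) (Suc a) ys (prime_list ?J c' ys))"
        by (rule IH) (use k l mb' in auto)
      let ?D = "length (filter (\<lambda>y. y < j) b')"
      have "sc (?i\<kappa> ^ ?C * \<kappa> ^ ?G l) * (sc (?i\<kappa> ^ inv_list (j # b')) * (sc (\<kappa> ^ ?L l k) * (Sb a k j * sig (Suc a) ?J b')) * S ?s l c)
        = sc (\<kappa> ^ ?G l * \<kappa> ^ ?L l k * (?i\<kappa> ^ ?C * ?i\<kappa> ^ ?D)) * (Sb a k j * ((sc (?i\<kappa> ^ inv_list b') * sig (Suc a) ?J b') * S ?s l c))"
        by (simp only: inv_list.simps power_add sc_left[of "Sb a k j"] sc_sc mult.assoc) (simp only: mult_ac)
      also have "\<dots> = (\<Sum>ys\<in>permutations_of_set ?J.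
         sc (\<kappa> ^ inv_list (k # ys @ [l]) * ?i\<kappa> ^ inv_list (prime_list I c (k # ys @ [l]))) *
           prodM (Smix n) a (k # ys @ [l]) (prime_list I c (k # ys @ [l])))"
        unfolding IH' sum_distrib_left sum_distrib_right
      proof (rule sum.cong[OF refl])
        fix ys assume ys: "ys \<in> permutations_of_set ?J"
        define zs where "zs = prime_list ?J c' ys"
        have zs: "mset zs = mset b'" unfolding zs_def mset_prime_list[OF ys] mb' ..
        have pl: "prime_list I c (k # ys @ [l]) = j # zs @ [c]"
          using j[of k] k by (simp add: prime_list_ends zs_def c'_def)
        have lzs: "length zs = card I - 2"
          using mset_eq_length[OF zs] mset_eq_length[OF b'(1)] lbs by simp
        have "length ys = card ?J" using ys by (rule length_finite_permutations_of_set)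
        also have "\<dots> = card I - 2" using k l fin by simp
        finally have lys: "length ys = length zs" unfolding lzs .
        \<comment> \<open>The inversions of the ends are counted within \<open>I\<close>: l with all
          larger rows, then k with all smaller rows other than l.\<close>
        have e1: "\<kappa> ^ inv_list (k # ys @ [l]) = \<kappa> ^ ?G l * \<kappa> ^ ?L l k * \<kappa> ^ inv_list ys"
        proof -
          have p: "k # ys @ [l] \<in> permutations_of_set I"
            using ys k l by (auto simp: permutations_of_set_def)
          have "wt I ((k # ys) @ [l]) = \<kappa> ^ ?G l * (\<kappa> ^ ?L l k * wt ?J ys)"
            using k l fin by (subst wt_snoc, simp, subst wt_Cons) simp_all
          then show ?thesis by (simp only: wt_permutation[OF p] wt_permutation[OF ys] mult.assoc append_Cons)
        qed
        have e2: "?i\<kappa> ^ inv_list (j # zs @ [c]) = ?i\<kappa> ^ ?C * ?i\<kappa> ^ ?D * ?i\<kappa> ^ inv_list zs"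
          by (simp only: inv_list_ends[OF zs b'(1)] power_add)
        have an: "a \<le> n" "\<not> ?s \<le> n" using a card by linarith+
        have "prodM (Smix n) a (k # ys @ [l]) (j # zs @ [c]) = Sb a k j * (prodM (Smix n) (Suc a) ys zs * S ?s l c)"
          unfolding prodM_ends[OF lys] lzs using an by simp
        then show "sc (\<kappa> ^ ?G l * \<kappa> ^ ?L l k * (?i\<kappa> ^ ?C * ?i\<kappa> ^ ?D)) *
           (Sb a k j * (sc (\<kappa> ^ inv_list ys * ?i\<kappa> ^ inv_list (prime_list ?J c' ys)) * prodM (Smix n) (Suc a) ys (prime_list ?J c' ys) * S ?s l c)) =
           sc (\<kappa> ^ inv_list (k # ys @ [l]) * ?i\<kappa> ^ inv_list (prime_list I c (k # ys @ [l]))) *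
           prodM (Smix n) a (k # ys @ [l]) (prime_list I c (k # ys @ [l]))"
          unfolding pl zs_def[symmetric] e1 e2
          by (simp only: sc_left[of "Sb a k j"] sc_sc mult.assoc) (simp only: mult_ac)
      qed
      finally show "sc (?i\<kappa> ^ ?C * \<kappa> ^ ?G l) * (sc (?i\<kappa> ^ inv_list (j # b')) * (sc (\<kappa> ^ ?L l k) * (Sb a k j * sig (Suc a) ?J b')) * S ?s l c) =
        (\<Sum>ys\<in>permutations_of_set ?J.
         sc (\<kappa> ^ inv_list (k # ys @ [l]) * ?i\<kappa> ^ inv_list (prime_list I c (k # ys @ [l]))) *
           prodM (Smix n) a (k # ys @ [l]) (prime_list I c (k # ys @ [l])))" .
    qed
    finally show "sc (?i\<kappa> ^ inv_list (bs @ [c])) * (sc (\<kappa> ^ ?G l) * (sigb a (I - {l}) bs * S ?s l c)) =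
       (\<Sum>k\<in>I - {l}. \<Sum>ys\<in>permutations_of_set (I - {l} - {k}).
         sc (\<kappa> ^ inv_list (k # ys @ [l]) * ?i\<kappa> ^ inv_list (prime_list I c (k # ys @ [l]))) *
           prodM (Smix n) a (k # ys @ [l]) (prime_list I c (k # ys @ [l])))" .
  qed
  also have "\<dots> = (\<Sum>xs\<in>permutations_of_set I. sc (\<kappa> ^ inv_list xs * inverse \<kappa> ^ inv_list (prime_list I c xs)) *
        prodM (Smix n) a xs (prime_list I c xs))"
    by (rule sum_permutations_of_set_ends[OF fin card, symmetric])
  finally show ?thesis .
qed

lemma sig_expansion:
  assumes "I \<subseteq> {1..N}" "a + card I div 2 = Suc n" "mset es = cols_of I c"
  shows "sc (inverse \<kappa> ^ inv_list es) * sig a I es =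
      (\<Sum>xs\<in>permutations_of_set I. sc (\<kappa> ^ inv_list xs * inverse \<kappa> ^ inv_list (prime_list I c xs)) *
        prodM (Smix n) a xs (prime_list I c xs))"
  using assms
proof (induction "card I" arbitrary: a I es c rule: less_induct)
  case less
  have fin: "finite I" using less.prems(1) finite_subset by blast
  consider "I = {}" | l where "I = {l}" | "card I \<ge> 2"
  proof -
    have "card I = 0 \<or> card I = 1 \<or> card I \<ge> 2" by linarith
    then show ?thesis using that fin by (metis card_0_eq card_1_singletonE)
  qed
  then show ?case
  proof cases
    case 1
    then have "es = []" using less.prems(3) by (simp add: cols_of_def)
    then show ?thesis using 1 by (simp add: sig_empty)
  next
    case (2 l)
    then have es: "es = [c]" using less.prems(3) by (simp add: cols_of_def)
    have "sig a {l} ([] @ [c]) = sc (\<kappa> ^ card {x\<in>{l}. l < x}) * (sigb a ({l} - {l}) [] * S (a + 0) l c)"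
      using less.prems(1) 2 by (subst sig_snoc) simp_all
    moreover have "card {x\<in>{l}. l < x} = 0" by simp
    \<comment> \<open>For odd N the middle position lies just beyond n, so the single remaining
      factor is an entry of S.\<close>
    moreover have "a = Suc n" using less.prems(2) 2 by simp
    ultimately have "sig a {l} [c] = S (Suc n) l c" by (simp only: append_Nil sigb_empty Diff_cancel add_0_right power_0 sc_1 mult_1_left)
    then show ?thesis using \<open>a = Suc n\<close> by (simp add: 2 es)
  next
    case 3
    show ?thesis
    proof (rule sig_expansion_step[OF less.prems(1) 3 less.prems(2,3)])
      fix k l es c assume kl: "k \<in> I" "l \<in> I" "k \<noteq> l" and es: "mset es = cols_of (I - {l} - {k}) c"
      have card: "card (I - {l} - {k}) = card I - 2" using kl fin by simp
      show "sc (inverse \<kappa> ^ inv_list es) * sig (Suc a) (I - {l} - {k}) es =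
      (\<Sum>ys\<in>permutations_of_set (I - {l} - {k}). sc (\<kappa> ^ inv_list ys * inverse \<kappa> ^ inv_list (prime_list (I - {l} - {k}) c ys)) *
        prodM (Smix n) (Suc a) ys (prime_list (I - {l} - {k}) c ys))"
      proof (rule less.hyps[OF _ _ _ es])
        show "card (I - {l} - {k}) < card I" using card 3 by linarith
        show "I - {l} - {k} \<subseteq> {1..N}" using less.prems(1) by blast
        show "Suc a + card (I - {l} - {k}) div 2 = Suc n"
          unfolding card using less.prems(2) 3 by linarith
      qed
    qed
  qed
qed

end

section \<open>From words back to permutations\<close>

lemma inv_list_map_upt:
  "inv_list (map p [a..<b]) = card {(i, j). a \<le> i \<and> i < j \<and> j < b \<and> p j < p i}"
proof (induction b)
  case 0
  have "{(i, j). a \<le> i \<and> i < j \<and> j < 0 \<and> p j < p i} = {}" by auto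
  then show ?case by simp
next
  case (Suc b)
  let ?P = "\<lambda>b. {(i, j). a \<le> i \<and> i < j \<and> j < b \<and> p j < p i}"
  let ?Q = "{i. a \<le> i \<and> i < b \<and> p b < p i}"
  show ?case
  proof (cases "a \<le> b")
    case False
    then have "?P (Suc b) = {}" by auto
    then show ?thesis using False by (simp only: upt_rec[of a] less_Suc_eq_le) simp
  next
    case True
    have fin: "finite (?P b)" by (rule finite_subset[of _ "{..<b} \<times> {..<b}"]) auto
    have "finite ?Q" by (rule finite_subset[of _ "{..<b}"]) auto
    then have fin': "finite ((\<lambda>i. (i, b)) ` ?Q)" by (rule finite_imageI)
    have un: "?P (Suc b) = ?P b \<union> (\<lambda>i. (i, b)) ` ?Q" by (auto simp: less_Suc_eq)
    have disj: "?P b \<inter> (\<lambda>i. (i, b)) ` ?Q = {}" by auto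
    have "card ((\<lambda>i. (i, b)) ` ?Q) = card ?Q" by (rule card_image) (simp add: inj_on_def)
    then have "card (?P (Suc b)) = card (?P b) + card ?Q"
      unfolding un card_Un_disjoint[OF fin fin' disj] by (simp only:)
    moreover have "length (filter (\<lambda>x. p b < x) (map p [a..<b])) = card ?Q"
    proof -
      have "length (filter (\<lambda>x. p b < x) (map p [a..<b])) = length (filter (\<lambda>i. p b < p i) [a..<b])"
        by (simp add: filter_map comp_def)
      also have "\<dots> = card (set (filter (\<lambda>i. p b < p i) [a..<b]))"
        by (rule distinct_card[symmetric]) simp
      also have "set (filter (\<lambda>i. p b < p i) [a..<b]) = ?Q" by auto
      finally show ?thesis .
    qed
    ultimately show ?thesis using True Suc by (simp add: inv_list_snoc)
  qed
qed

lemma inversions_eq_inv_list: "inversions N p = inv_list (map p [1..<Suc N])"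
  unfolding inversions_def inv_list_map_upt by (simp only: less_Suc_eq_le)

lemma prodM_map_upt:
  "prodM M a (map f [a..<b]) (map g [a..<b]) = prod_list (map (\<lambda>i. M i (f i) (g i)) [a..<b])"
proof (induction "b - a" arbitrary: a)
  case (Suc d)
  then have "[a..<b] = a # [Suc a..<b]" by (simp add: upt_rec)
  then show ?case using Suc.hyps(1)[of "Suc a"] Suc.hyps(2) by simp
qed simp

lemma omega_set_eq:
  assumes "p permutes {1..N}" "2 * k \<le> N"
  shows "omega_set N p k = p ` {Suc k..N - k}"
  using assms(2)
proof (induction k)
  case 0
  then show ?case using permutes_image[OF assms(1)] by simp
next
  case (Suc k)
  have inj: "inj p" using assms(1) by (rule permutes_inj)
  have "omega_set N p (Suc k) = p ` {Suc k..N - k} - p ` {Suc k, N - k}"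
    using Suc by simp
  also have "\<dots> = p ` ({Suc k..N - k} - {Suc k, N - k})"
    by (rule image_set_diff[OF inj, symmetric])
  also have "{Suc k..N - k} - {Suc k, N - k} = {Suc (Suc k)..N - Suc k}"
    by auto
  finally show ?case .
qed

text \<open>Reconciles the separate rule for p'_n when N = 2n, which takes the smaller element, with
  the pair map on a two-element set.\<close>

lemma pair_map_two:
  assumes "k \<noteq> l"
  shows "fst (pair_map {k, l} (k, l)) = Min {k, l}"
proof -
  have c: "card {k, l} \<ge> 2" using assms by simp
  show ?thesis
  proof (cases "k < l")
    case True
    then have "Max {k, l} = l" "{k, l} - {l} = {k}" "Min {k, l} = k" by auto
    then show ?thesis by (simp add: fst_pair_map[OF _ c assms])
  next
    case False
    then have "Max {k, l} = k" "Min {k, l} = l" using assms by auto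
    then show ?thesis using assms by (simp add: fst_pair_map[OF _ c assms])
  qed
qed

text \<open>The induction works because the last value of the inner word is p' at N - k - 1, which
  \<open>perm_prime\<close> takes from the same step as the value at k + 1.\<close>

lemma prime_list_omega_set:
  assumes p: "p permutes {1..N}" and "2 * k \<le> N"
  shows "prime_list (omega_set N p k) (perm_prime N p (N - k)) (map p [Suc k..<Suc (N - k)])
    = map (perm_prime N p) [Suc k..<Suc (N - k)]"
  using assms(2)
proof (induction "N - 2 * k" arbitrary: k rule: less_induct)
  case less
  consider "N = 2 * k" | "N = 2 * k + 1" | "N \<ge> 2 * k + 2" using less.prems by linarith
  then show ?case
  proof cases
    case 1
    then show ?thesis by simp
  next
    case 2
    then have "[Suc k..<Suc (N - k)] = [Suc k]" "N - k = Suc k" by (simp_all add: upt_rec)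
    then show ?thesis by simp
  next
    case 3
    define A where "A = omega_set N p k"
    have upt: "[Suc k..<Suc (N - k)] = Suc k # [Suc (Suc k)..<Suc (N - Suc k)] @ [N - k]"
    proof -
      have "[Suc k..<Suc (N - k)] = [Suc k..<N - k] @ [N - k]" using 3 by simp
      also have "[Suc k..<N - k] = Suc k # [Suc (Suc k)..<N - k]" by (rule upt_conv_Cons) (use 3 in linarith)
      also have "[Suc (Suc k)..<N - k] = [Suc (Suc k)..<Suc (N - Suc k)]" using 3 by (simp only: Suc_diff_Suc)
      finally show ?thesis by (simp only: append_Cons)
    qed
    let ?c = "snd (pair_map A (p (Suc k), p (N - k)))"
    have inj: "inj p" using p by (rule permutes_inj)
    have A': "A - {p (N - k)} - {p (Suc k)} = omega_set N p (Suc k)" unfolding A_def omega_set.simps by blast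
    have fst: "fst (pair_map A (p (Suc k), p (N - k))) = perm_prime N p (Suc k)"
    proof (cases "N = 2 * k + 2")
      case True
      have "{Suc k..N - k} = {Suc k, N - k}" using True by auto
      then have AA: "A = {p (Suc k), p (N - k)}"
        unfolding A_def omega_set_eq[OF p less.prems] by simp
      have "Suc k \<noteq> N - k" using True by linarith
      then have "p (Suc k) \<noteq> p (N - k)" using injD[OF inj, of "Suc k" "N - k"] by blast
      from pair_map_two[OF this] have "fst (pair_map A (p (Suc k), p (N - k))) = Min A"
        unfolding AA .
      moreover have "perm_prime N p (Suc k) = Min A"
      proof -
        have h: "Suc k \<in> {1..N}" "Suc k \<noteq> N" "2 * Suc k = N" "\<not> 2 * Suc k < N" using True by auto
        show ?thesis unfolding perm_prime_def Let_def A_def using h by (simp only: if_False if_True simp_thms diff_Suc_1)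
      qed
      ultimately show ?thesis by simp
    next
      case False
      then have h: "2 * Suc k < N" "Suc k \<noteq> N" "Suc k \<in> {1..N}" "N - Suc k + 1 = N - k" using 3 by auto
      show ?thesis unfolding perm_prime_def Let_def A_def using h by (simp only: if_False if_True simp_thms diff_Suc_1)
    qed
    have inner: "prime_list (omega_set N p (Suc k)) ?c (map p [Suc (Suc k)..<Suc (N - Suc k)])
      = map (perm_prime N p) [Suc (Suc k)..<Suc (N - Suc k)]"
    proof (cases "N = 2 * k + 2")
      case True
      then show ?thesis by simp
    next
      case False
      define j where "j = N - Suc k"
      have j: "j \<in> {1..N}" "j \<noteq> N" "\<not> 2 * j < N" "2 * j \<noteq> N" "N - j = Suc k" "N - Suc k + 1 = N - k"
        using 3 False by (auto simp: j_def)
      have "perm_prime N p j = ?c"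
        unfolding perm_prime_def Let_def A_def using j by (simp only: if_False simp_thms diff_Suc_1)
      then have "?c = perm_prime N p (N - Suc k)" by (simp add: j_def)
      moreover have "N - 2 * Suc k < N - 2 * k" "2 * Suc k \<le> N" using 3 by simp_all
      ultimately show ?thesis using less.hyps[of "Suc k"] by (simp only:)
    qed
    show ?thesis
      unfolding upt list.map map_append prime_list_ends A_def[symmetric] A' fst inner by simp
  qed
qed

lemma prime_list_perm:
  assumes "p permutes {1..N}" "N \<ge> 1"
  shows "prime_list {1..N} N (map p [1..<Suc N]) = map (perm_prime N p) [1..<Suc N]"
  using prime_list_omega_set[OF assms(1), of 0] assms(2) by (simp add: perm_prime_def[of N p N])

lemma sum_permutes_list:
  "(\<Sum>p | p permutes {1..N}. F (map p [1..<Suc N])) = (\<Sum>xs\<in>permutations_of_set {1..N}. F xs)"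
proof (rule sum.reindex_bij_witness[of _ "\<lambda>xs i. if i \<in> {1..N} then xs ! (i - 1) else i" "\<lambda>p. map p [1..<Suc N]"])
  fix p assume "p \<in> {p. p permutes {1..N}}"
  then have p: "p permutes {1..N}" by simp
  show "(\<lambda>i. if i \<in> {1..N} then map p [1..<Suc N] ! (i - 1) else i) = p"
  proof
    fix i show "(if i \<in> {1..N} then map p [1..<Suc N] ! (i - 1) else i) = p i"
      using permutes_not_in[OF p, of i] by (auto simp: nth_append simp del: upt_Suc)
  qed
  have "set (map p [1..<Suc N]) = {1..N}"
    using permutes_image[OF p] by (simp only: set_map set_upt atLeastLessThanSuc_atLeastAtMost)
  moreover have "distinct (map p [1..<Suc N])"
    using permutes_inj[OF p] by (simp add: distinct_map inj_on_def inj_def del: upt_Suc)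
  ultimately show "map p [1..<Suc N] \<in> permutations_of_set {1..N}" by (simp add: permutations_of_set_def)
next
  fix xs assume xs: "xs \<in> permutations_of_set {1..N}"
  then have l: "length xs = N" using length_finite_permutations_of_set[OF xs] by simp
  let ?p = "\<lambda>i. if i \<in> {1..N} then xs ! (i - 1) else i"
  show eq: "map ?p [1..<Suc N] = xs"
    by (rule nth_equalityI) (simp_all add: l del: upt_Suc)
  have sx: "set xs = {1..N}" "distinct xs" using xs by (auto simp: permutations_of_set_def)
  have "bij_betw ?p {1..N} {1..N}"
    unfolding bij_betw_def
  proof
    have "?p ` {1..N} = set (map ?p [1..<Suc N])"
      by (simp only: set_map set_upt atLeastLessThanSuc_atLeastAtMost)
    then show im: "?p ` {1..N} = {1..N}" by (simp only: eq sx)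
    show "inj_on ?p {1..N}" by (rule eq_card_imp_inj_on) (simp_all only: im finite_atLeastAtMost)
  qed
  then have "?p permutes {1..N}" by (rule bij_imp_permutes) (simp only: if_False)
  then show "?p \<in> {p. p permutes {1..N}}" by simp
qed simp

context sklyanin
begin

text \<open>The start of the recursion: 1, ..., N has no inversions and equals the column multiset
  for c = N, in accordance with p'_N = N.\<close>

lemma sig_perm_expansion:
  assumes N: "N \<ge> 2" "N = 2 * n \<or> N = 2 * n + 1"
  shows "sig 1 {1..N} [1..<Suc N] = (\<Sum>p | p permutes {1..N}.
     sc (\<kappa> ^ inversions N p * inverse \<kappa> ^ inversions N (perm_prime N p)) *
     (prod_list (map (\<lambda>i. Sb i (p i) (perm_prime N p i)) [1..<Suc n]) *
      prod_list (map (\<lambda>i. S i (p i) (perm_prime N p i)) [Suc n..<Suc N])))"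
proof -
  have Max: "Max {1..N} = N" using N(1) by (intro Max_eqI) auto
  have inv0: "inv_list [1..<Suc N] = 0"
  proof -
    have "{(i, j). (1::nat) \<le> i \<and> i < j \<and> j < Suc N \<and> id j < id i} = {}" by auto
    then show ?thesis using inv_list_map_upt[of id 1 "Suc N"] by (simp only: list.map_id card.empty)
  qed
  have cols: "mset [1..<Suc N] = cols_of {1..N} N"
  proof -
    have "{1..N} - {N} = set [1..<N]" by auto
    then have "mset_set ({1..N} - {N}) = mset [1..<N]" by (simp only: mset_set_set distinct_upt)
    moreover have "[1..<Suc N] = [1..<N] @ [N]" using N(1) by simp
    ultimately show ?thesis using N(1) unfolding cols_of_def Max by simp
  qed
  have "sig 1 {1..N} [1..<Suc N] = sc (inverse \<kappa> ^ inv_list [1..<Suc N]) * sig 1 {1..N} [1..<Suc N]"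
    by (simp only: inv0 power_0 sc_1 mult_1_left)
  also have "\<dots> = (\<Sum>xs\<in>permutations_of_set {1..N}. sc (\<kappa> ^ inv_list xs * inverse \<kappa> ^ inv_list (prime_list {1..N} N xs)) *
        prodM (Smix n) 1 xs (prime_list {1..N} N xs))"
    by (rule sig_expansion) (use N cols in auto)
  also have "\<dots> = (\<Sum>p | p permutes {1..N}. sc (\<kappa> ^ inv_list (map p [1..<Suc N]) * inverse \<kappa> ^ inv_list (prime_list {1..N} N (map p [1..<Suc N]))) *
        prodM (Smix n) 1 (map p [1..<Suc N]) (prime_list {1..N} N (map p [1..<Suc N])))"
    by (rule sum_permutes_list[symmetric])
  also have "\<dots> = (\<Sum>p | p permutes {1..N}.
     sc (\<kappa> ^ inversions N p * inverse \<kappa> ^ inversions N (perm_prime N p)) *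
     (prod_list (map (\<lambda>i. Sb i (p i) (perm_prime N p i)) [1..<Suc n]) *
      prod_list (map (\<lambda>i. S i (p i) (perm_prime N p i)) [Suc n..<Suc N])))"
  proof (rule sum.cong[OF refl])
    fix p assume "p \<in> {p. p permutes {1..N}}"
    then have p: "p permutes {1..N}" by simp
    have pl: "prime_list {1..N} N (map p [1..<Suc N]) = map (perm_prime N p) [1..<Suc N]"
      by (rule prime_list_perm[OF p]) (use N in simp)
    have "[1..<Suc N] = [1..<Suc n] @ [Suc n..<Suc N]"
    proof -
      have h: "Suc n + (N - n) = Suc N" "(1::nat) \<le> Suc n" using N by auto
      show ?thesis using upt_add_eq_append[OF h(2), of "N - n"] unfolding h(1) .
    qed
    then have "prod_list (map (\<lambda>i. Smix n i (p i) (perm_prime N p i)) [1..<Suc N]) =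
      prod_list (map (\<lambda>i. Smix n i (p i) (perm_prime N p i)) [1..<Suc n]) * prod_list (map (\<lambda>i. Smix n i (p i) (perm_prime N p i)) [Suc n..<Suc N])"
      by (simp only: map_append prod_list.append)
    also have "map (\<lambda>i. Smix n i (p i) (perm_prime N p i)) [1..<Suc n] = map (\<lambda>i. Sb i (p i) (perm_prime N p i)) [1..<Suc n]"
      by (rule map_cong) auto
    also have "map (\<lambda>i. Smix n i (p i) (perm_prime N p i)) [Suc n..<Suc N] = map (\<lambda>i. S i (p i) (perm_prime N p i)) [Suc n..<Suc N]"
      by (rule map_cong) auto
    finally show "sc (\<kappa> ^ inv_list (map p [1..<Suc N]) * inverse \<kappa> ^ inv_list (prime_list {1..N} N (map p [1..<Suc N]))) *
        prodM (Smix n) 1 (map p [1..<Suc N]) (prime_list {1..N} N (map p [1..<Suc N])) =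
      sc (\<kappa> ^ inversions N p * inverse \<kappa> ^ inversions N (perm_prime N p)) *
     (prod_list (map (\<lambda>i. Sb i (p i) (perm_prime N p i)) [1..<Suc n]) *
      prod_list (map (\<lambda>i. S i (p i) (perm_prime N p i)) [Suc n..<Suc N]))"
      by (simp only: pl prodM_map_upt inversions_eq_inv_list)
  qed
  finally show ?thesis .
qed

end

section \<open>Reordering the product that defines the Sklyanin determinant\<close>

text \<open>A row vector times a matrix placed in copy i; \<open>pop\<close> is the analogue for two
  copies. The vectors are functions of arbitrary multi-indices, so that identities between operators
  are plain equalities of functions.\<close>

definition cop :: "nat \<Rightarrow> nat \<Rightarrow> (nat \<Rightarrow> nat \<Rightarrow> 'l::ring_1) \<Rightarrow> ((nat \<Rightarrow> nat) \<Rightarrow> 'l) \<Rightarrow> ((nat \<Rightarrow> nat) \<Rightarrow> 'l)" where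
  "cop N i M H = (\<lambda>e. \<Sum>x\<in>{1..N}. H (e(i := x)) * M x (e i))"

definition pop :: "nat \<Rightarrow> nat \<Rightarrow> nat \<Rightarrow> (nat \<Rightarrow> nat \<Rightarrow> nat \<Rightarrow> nat \<Rightarrow> 'l::ring_1) \<Rightarrow> ((nat \<Rightarrow> nat) \<Rightarrow> 'l) \<Rightarrow> ((nat \<Rightarrow> nat) \<Rightarrow> 'l)" where
  "pop N i j M H = (\<lambda>e. \<Sum>x\<in>{1..N}. \<Sum>y\<in>{1..N}. H (e(i := x, j := y)) * M x (e i) y (e j))"

text \<open>The factors of a matrix product in reading order: on a row vector the leftmost acts
  first.\<close>

definition run :: "('a \<Rightarrow> 'a) list \<Rightarrow> 'a \<Rightarrow> 'a" where
  "run fs = fold (\<lambda>f. f) fs"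

lemma run_Nil [simp]: "run [] H = H"
  and run_Cons [simp]: "run (f # fs) H = run fs (f H)"
  and run_append: "run (fs @ gs) H = run gs (run fs H)"
  by (simp_all add: run_def)

definition run_eq :: "('a \<Rightarrow> 'a) list \<Rightarrow> ('a \<Rightarrow> 'a) list \<Rightarrow> bool" (infix "\<approx>" 50) where
  "fs \<approx> gs \<longleftrightarrow> run fs = run gs"

lemma run_eq_refl [simp]: "fs \<approx> fs"
  by (simp add: run_eq_def)

lemma run_eq_sym: "fs \<approx> gs \<Longrightarrow> gs \<approx> fs"
  by (simp add: run_eq_def)

lemma run_eq_trans [trans]: "fs \<approx> gs \<Longrightarrow> gs \<approx> hs \<Longrightarrow> fs \<approx> hs"
  by (simp add: run_eq_def)

lemma run_eq_append: "fs \<approx> gs \<Longrightarrow> fs' \<approx> gs' \<Longrightarrow> fs @ fs' \<approx> gs @ gs'"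
  by (simp add: run_eq_def fun_eq_iff run_append)

lemma run_eq_middle: "fs \<approx> gs \<Longrightarrow> hs @ fs @ ks \<approx> hs @ gs @ ks"
  by (simp add: run_eq_append)

definition commutes :: "('a \<Rightarrow> 'a) \<Rightarrow> ('a \<Rightarrow> 'a) \<Rightarrow> bool" where
  "commutes f g \<longleftrightarrow> (\<forall>H. f (g H) = g (f H))"

lemma commutes_sym: "commutes f g \<Longrightarrow> commutes g f"
  by (simp add: commutes_def)

lemma run_eq_commute: "(\<And>f. f \<in> set fs \<Longrightarrow> commutes f g) \<Longrightarrow> fs @ [g] \<approx> [g] @ fs"
proof (induction fs)
  case (Cons f fs)
  have "[f] @ fs @ [g] \<approx> [f] @ [g] @ fs"
    by (rule run_eq_append) (use Cons in auto)
  also have "[f] @ [g] @ fs \<approx> [g] @ [f] @ fs"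
    using Cons.prems[of f] run_eq_append[of "[f, g]" "[g, f]" fs fs]
    by (simp add: run_eq_def commutes_def fun_eq_iff)
  finally show ?case by simp
qed simp

text \<open>Each \<open>g j\<close> moves left to the end of its own block and crosses only blocks
  of other indices.\<close>

lemma run_eq_interleave:
  assumes "distinct js" "\<And>j j' f. j \<in> set js \<Longrightarrow> j' \<in> set js \<Longrightarrow> j \<noteq> j' \<Longrightarrow> f \<in> set (A j') \<Longrightarrow> commutes f (g j)"
  shows "concat (map A js) @ map g js \<approx> concat (map (\<lambda>j. A j @ [g j]) js)"
  using assms
proof (induction js)
  case (Cons j js)
  have "A j @ (concat (map A js) @ [g j]) @ map g js \<approx> A j @ ([g j] @ concat (map A js)) @ map g js"
    by (intro run_eq_middle run_eq_commute) (use Cons.prems in auto)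
  also have "\<dots> = (A j @ [g j]) @ (concat (map A js) @ map g js)" by simp
  also have "\<dots> \<approx> (A j @ [g j]) @ concat (map (\<lambda>j. A j @ [g j]) js)"
    by (intro run_eq_append run_eq_refl Cons.IH) (use Cons.prems in auto)
  finally show ?case by simp
qed simp

lemma sum_swap22:
  "(\<Sum>a\<in>A. \<Sum>b\<in>B. \<Sum>c\<in>C. \<Sum>d\<in>D. f a b c d) = (\<Sum>c\<in>C. \<Sum>d\<in>D. \<Sum>a\<in>A. \<Sum>b\<in>B. f a b c d)"
proof -
  have "(\<Sum>a\<in>A. \<Sum>b\<in>B. \<Sum>c\<in>C. \<Sum>d\<in>D. f a b c d) = (\<Sum>c\<in>C. \<Sum>a\<in>A. \<Sum>b\<in>B. \<Sum>d\<in>D. f a b c d)"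
    by (rule sum_swap3)
  also have "\<dots> = (\<Sum>c\<in>C. \<Sum>d\<in>D. \<Sum>a\<in>A. \<Sum>b\<in>B. f a b c d)"
    by (rule sum.cong[OF refl], rule sum_swap3)
  finally show ?thesis .
qed

lemma sum_swap_outer:
  "(\<Sum>a\<in>A. \<Sum>b\<in>B. \<Sum>c\<in>C. \<Sum>d\<in>D. f a b c d) = (\<Sum>d\<in>D. \<Sum>b\<in>B. \<Sum>a\<in>A. \<Sum>c\<in>C. f a b c d)"
proof -
  have "(\<Sum>a\<in>A. \<Sum>b\<in>B. \<Sum>c\<in>C. \<Sum>d\<in>D. f a b c d) = (\<Sum>a\<in>A. \<Sum>d\<in>D. \<Sum>b\<in>B. \<Sum>c\<in>C. f a b c d)"
    by (rule sum.cong[OF refl], rule sum_swap3)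
  also have "\<dots> = (\<Sum>d\<in>D. \<Sum>a\<in>A. \<Sum>b\<in>B. \<Sum>c\<in>C. f a b c d)"
    by (rule sum.swap)
  also have "\<dots> = (\<Sum>d\<in>D. \<Sum>b\<in>B. \<Sum>a\<in>A. \<Sum>c\<in>C. f a b c d)"
    by (rule sum.cong[OF refl], rule sum.swap)
  finally show ?thesis .
qed

lemma sum_delta2:
  assumes "finite A" "finite B"
  shows "(\<Sum>y\<in>A. \<Sum>x\<in>B. if y = b then if x = c then K else 0 else 0) = (if b \<in> A \<and> c \<in> B then K else 0)"
proof -
  have "(\<Sum>x\<in>B. if y = b then if x = c then K else 0 else 0) = (if y = b then if c \<in> B then K else 0 else 0)" for y
    by (cases "y = b") (simp_all add: assms(2))
  then show ?thesis by (simp add: assms(1))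
qed

definition upd_from :: "(nat \<Rightarrow> nat) \<Rightarrow> nat \<Rightarrow> nat list \<Rightarrow> nat \<Rightarrow> nat" where
  "upd_from e a ds = (\<lambda>i. if a \<le> i \<and> i < a + length ds then ds ! (i - a) else e i)"

lemma run_cop:
  assumes "a \<le> b"
  shows "run (map (\<lambda>i. cop N i (M i)) [a..<b]) H e =
    (\<Sum>ds\<in>tuples N (b - a). H (upd_from e a ds) * prodM M a ds (map e [a..<b]))"
  using assms
proof (induction b arbitrary: e rule: dec_induct)
  case base
  have "upd_from e a [] = e" by (auto simp: upd_from_def)
  then show ?case by simp
next
  case (step b)
  have "run (map (\<lambda>i. cop N i (M i)) [a..<Suc b]) H e =
    (\<Sum>x\<in>{1..N}. (\<Sum>ds\<in>tuples N (b - a). H (upd_from (e(b := x)) a ds) * prodM M a ds (map (e(b := x)) [a..<b])) * M b x (e b))"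
    unfolding upt_Suc_append[OF step.hyps(1)] map_append list.map run_append run_Cons run_Nil
    by (subst cop_def) (simp only: step.IH)
  also have "\<dots> = (\<Sum>x\<in>{1..N}. \<Sum>ds\<in>tuples N (b - a). H (upd_from e a (ds @ [x])) * prodM M a (ds @ [x]) (map e [a..<Suc b]))"
    unfolding sum_distrib_right
  proof (rule sum.cong[OF refl], rule sum.cong[OF refl])
    fix x ds assume ds: "ds \<in> tuples N (b - a)"
    have l: "length ds = b - a" using ds by (rule tuples_length)
    have m: "map (e(b := x)) [a..<b] = map e [a..<b]" by (rule map_cong) auto
    have "upd_from (e(b := x)) a ds = upd_from e a (ds @ [x])"
      using step.hyps l by (auto simp: upd_from_def nth_append fun_eq_iff)
    moreover have "prodM M a (ds @ [x]) (map e [a..<Suc b]) = prodM M a ds (map e [a..<b]) * M b x (e b)"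
      using step.hyps l prodM_append[of ds "map e [a..<b]" M a "[x]" "[e b]"] by simp
    ultimately show "H (upd_from (e(b := x)) a ds) * prodM M a ds (map (e(b := x)) [a..<b]) * M b x (e b) =
      H (upd_from e a (ds @ [x])) * prodM M a (ds @ [x]) (map e [a..<Suc b])"
      by (simp only: m mult.assoc)
  qed
  also have "\<dots> = (\<Sum>ds\<in>tuples N (Suc b - a). H (upd_from e a ds) * prodM M a ds (map e [a..<Suc b]))"
    unfolding Suc_diff_le[OF step.hyps(1)] sum_tuples_snoc by (rule sum.swap)
  finally show ?case .
qed

text \<open>The operators sum over {1..N} while multi-indices are arbitrary; since entries outside
  this range vanish, the RTT relation keeps its form there.\<close>

locale sklyanin_op = sklyanin sc q u N t tb
  for sc :: "'k::field \<Rightarrow> 'l::ring_1" and q u and N :: nat and t tb :: "nat \<Rightarrow> nat \<Rightarrow> nat \<Rightarrow> 'l" +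
  assumes t_out: "a \<notin> {1..N} \<or> b \<notin> {1..N} \<Longrightarrow> t i a b = 0"
    and tb_out: "a \<notin> {1..N} \<or> b \<notin> {1..N} \<Longrightarrow> tb i a b = 0"
begin

text \<open>The coefficient of E_ab tensor E_cd in R^t. Transposition turns E_ba tensor E_ab into
  E_ab tensor E_ab, so the off-diagonal part only links vectors with equal indices in the two
  copies.\<close>

definition rt :: "'k \<Rightarrow> 'k \<Rightarrow> nat \<Rightarrow> nat \<Rightarrow> nat \<Rightarrow> nat \<Rightarrow> 'k" where
  "rt x v a b c d = (if a = b \<and> c = d then rdiag q x v a c else 0) + (if c = a \<and> d = b \<and> a \<noteq> b then roff q x v b a else 0)"

abbreviation "Top i \<equiv> cop N i (t i)"
abbreviation "Bop i \<equiv> cop N i (tbt i)"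
abbreviation "Sop i \<equiv> cop N i (S i)"
abbreviation "Rop i j \<equiv> pop N i j (\<lambda>a b c d. sc (rt (inverse (u i)) (u j) a b c d))"

lemma cop_pop_commute:
  assumes "k \<noteq> i" "k \<noteq> j"
  shows "commutes (cop N k M) (pop N i j (\<lambda>a b c d. sc (\<rho> a b c d)))"
  unfolding commutes_def
proof (intro allI ext)
  fix H and e :: "nat \<Rightarrow> nat"
  have upd: "e(k := x, i := a, j := b) = e(i := a, j := b, k := x)" for x a b
    using assms by (auto simp: fun_eq_iff)
  have "cop N k M (pop N i j (\<lambda>a b c d. sc (\<rho> a b c d)) H) e =
    (\<Sum>x\<in>{1..N}. \<Sum>a\<in>{1..N}. \<Sum>b\<in>{1..N}. H (e(i := a, j := b, k := x)) * sc (\<rho> a (e i) b (e j)) * M x (e k))"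
    using assms by (simp add: cop_def pop_def sum_distrib_right upd)
  also have "\<dots> = (\<Sum>a\<in>{1..N}. \<Sum>b\<in>{1..N}. \<Sum>x\<in>{1..N}. H (e(i := a, j := b, k := x)) * sc (\<rho> a (e i) b (e j)) * M x (e k))"
    by (rule sum_swap3[symmetric])
  also have "\<dots> = (\<Sum>a\<in>{1..N}. \<Sum>b\<in>{1..N}. \<Sum>x\<in>{1..N}. H (e(i := a, j := b, k := x)) * M x (e k) * sc (\<rho> a (e i) b (e j)))"
    by (simp only: mult.assoc sc_central)
  also have "\<dots> = pop N i j (\<lambda>a b c d. sc (\<rho> a b c d)) (cop N k M H) e"
    using assms by (simp add: cop_def pop_def sum_distrib_right)
  finally show "cop N k M (pop N i j (\<lambda>a b c d. sc (\<rho> a b c d)) H) e = pop N i j (\<lambda>a b c d. sc (\<rho> a b c d)) (cop N k M H) e" .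
qed

lemma pop_pop_commute:
  assumes "k \<noteq> i" "k \<noteq> j" "l \<noteq> i" "l \<noteq> j"
  shows "commutes (pop N k l (\<lambda>a b c d. sc (\<rho>' a b c d))) (pop N i j (\<lambda>a b c d. sc (\<rho> a b c d)))"
  unfolding commutes_def
proof (intro allI ext)
  fix H and e :: "nat \<Rightarrow> nat"
  have upd: "e(k := x, l := y, i := a, j := b) = e(i := a, j := b, k := x, l := y)" for x y a b
    using assms by (auto simp: fun_eq_iff)
  have "pop N k l (\<lambda>a b c d. sc (\<rho>' a b c d)) (pop N i j (\<lambda>a b c d. sc (\<rho> a b c d)) H) e =
    (\<Sum>x\<in>{1..N}. \<Sum>y\<in>{1..N}. \<Sum>a\<in>{1..N}. \<Sum>b\<in>{1..N}. H (e(i := a, j := b, k := x, l := y)) * sc (\<rho> a (e i) b (e j)) * sc (\<rho>' x (e k) y (e l)))"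
    using assms by (simp add: pop_def sum_distrib_right upd)
  also have "\<dots> = (\<Sum>a\<in>{1..N}. \<Sum>b\<in>{1..N}. \<Sum>x\<in>{1..N}. \<Sum>y\<in>{1..N}. H (e(i := a, j := b, k := x, l := y)) * sc (\<rho> a (e i) b (e j)) * sc (\<rho>' x (e k) y (e l)))"
    by (rule sum_swap22)
  also have "\<dots> = (\<Sum>a\<in>{1..N}. \<Sum>b\<in>{1..N}. \<Sum>x\<in>{1..N}. \<Sum>y\<in>{1..N}. H (e(i := a, j := b, k := x, l := y)) * sc (\<rho>' x (e k) y (e l)) * sc (\<rho> a (e i) b (e j)))"
    by (simp only: mult.assoc sc_mult[symmetric] mult.commute)
  also have "\<dots> = pop N i j (\<lambda>a b c d. sc (\<rho> a b c d)) (pop N k l (\<lambda>a b c d. sc (\<rho>' a b c d)) H) e"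
    using assms by (simp add: pop_def sum_distrib_right)
  finally show "pop N k l (\<lambda>a b c d. sc (\<rho>' a b c d)) (pop N i j (\<lambda>a b c d. sc (\<rho> a b c d)) H) e =
    pop N i j (\<lambda>a b c d. sc (\<rho> a b c d)) (pop N k l (\<lambda>a b c d. sc (\<rho>' a b c d)) H) e" .
qed

lemma sum_rt_left:
  assumes b: "b \<in> {1..N}" and "E \<in> {1..N} \<or> f E = 0 \<and> g E = 0"
  shows "(\<Sum>y\<in>{1..N}. \<Sum>x\<in>{1..N}. f x * (sc (rt X v x E b y) * g y)) =
    sc (rdiag q X v E b) * (f E * g b) + sc (roff q X v E b) * (f b * g E)"
proof -
  have "(\<Sum>y\<in>{1..N}. \<Sum>x\<in>{1..N}. f x * (sc (rt X v x E b y) * g y)) =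
     (\<Sum>y\<in>{1..N}. \<Sum>x\<in>{1..N}. (if y = b then if x = E then sc (rdiag q X v E b) * (f E * g b) else 0 else 0) +
       (if y = E then if x = b then sc (roff q X v E b) * (f b * g E) else 0 else 0))"
    by (intro sum.cong refl) (auto simp: rt_def sc_add distrib_left distrib_right sc_left[of "f _"] roff_def)
  also have "\<dots> = (if E \<in> {1..N} then sc (rdiag q X v E b) * (f E * g b) else 0) + (if E \<in> {1..N} then sc (roff q X v E b) * (f b * g E) else 0)"
    using b by (simp only: sum.distrib sum_delta2[OF finite_atLeastAtMost finite_atLeastAtMost] simp_thms)
  also have "\<dots> = sc (rdiag q X v E b) * (f E * g b) + sc (roff q X v E b) * (f b * g E)"
    using assms(2) by auto
  finally show ?thesis .
qed

lemma sum_rt_right: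
  assumes z: "z \<in> {1..N}" and "F \<in> {1..N} \<or> f F = 0 \<and> g F = 0"
  shows "(\<Sum>w\<in>{1..N}. \<Sum>y\<in>{1..N}. g y * (sc (rt X v z w y F) * f w)) =
    sc (rdiag q X v z F) * (g F * f z) + sc (roff q X v F z) * (g z * f F)"
proof -
  have "(\<Sum>w\<in>{1..N}. \<Sum>y\<in>{1..N}. g y * (sc (rt X v z w y F) * f w)) =
     (\<Sum>w\<in>{1..N}. \<Sum>y\<in>{1..N}. (if w = z then if y = F then sc (rdiag q X v z F) * (g F * f z) else 0 else 0) +
       (if w = F then if y = z then sc (roff q X v F z) * (g z * f F) else 0 else 0))"
    by (intro sum.cong refl) (auto simp: rt_def sc_add distrib_left distrib_right sc_left[of "g _"] roff_def)
  also have "\<dots> = (if F \<in> {1..N} then sc (rdiag q X v z F) * (g F * f z) else 0) + (if F \<in> {1..N} then sc (roff q X v F z) * (g z * f F) else 0)"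
    using z by (simp only: sum.distrib sum_delta2[OF finite_atLeastAtMost finite_atLeastAtMost] simp_thms)
  also have "\<dots> = sc (rdiag q X v z F) * (g F * f z) + sc (roff q X v F z) * (g z * f F)"
    using assms(2) by auto
  finally show ?thesis .
qed

text \<open>The relation between T-bar and T, transposed in the first factor: T-bar^t_i R^t_ij T_j =
  T_j R^t_ij T-bar^t_i.\<close>

lemma Bop_Rop_Top:
  assumes ij: "i \<noteq> j"
  shows "Top j (Rop i j (Bop i H)) = Bop i (Rop i j (Top j H))"
proof
  fix e :: "nat \<Rightarrow> nat"
  let ?I = "{1..N}" and ?E = "e i" and ?F = "e j"
  let ?r = "\<lambda>a b c d. sc (rt (inverse (u i)) (u j) a b c d)"
  have upd3: "e(j := b, i := z) = e(i := z, j := b)" for z b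
    using ij[symmetric] by (rule fun_upd_twist)
  have upd2: "e(i := w, i := z, j := y, j := b) = e(i := z, j := b)" for w y z b
    using ij by (auto simp: fun_eq_iff)
  have "Top j (Rop i j (Bop i H)) e =
    (\<Sum>y\<in>?I. \<Sum>x\<in>?I. \<Sum>b\<in>?I. \<Sum>z\<in>?I. H (e(i := z, j := b)) * (tb i x z * (?r x ?E b y * t j y ?F)))"
    using ij by (simp add: cop_def pop_def tbt_def sum_distrib_right upd3 mult.assoc)
  also have "\<dots> = (\<Sum>b\<in>?I. \<Sum>z\<in>?I. \<Sum>y\<in>?I. \<Sum>x\<in>?I. H (e(i := z, j := b)) * (tb i x z * (?r x ?E b y * t j y ?F)))"
    by (rule sum_swap22)
  also have "\<dots> = (\<Sum>b\<in>?I. \<Sum>z\<in>?I. H (e(i := z, j := b)) * (\<Sum>y\<in>?I. \<Sum>x\<in>?I. tb i x z * (?r x ?E b y * t j y ?F)))"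
    by (simp only: sum_distrib_left)
  also have "\<dots> = (\<Sum>b\<in>?I. \<Sum>z\<in>?I. H (e(i := z, j := b)) * (\<Sum>w\<in>?I. \<Sum>y\<in>?I. t j b y * (?r z w y ?F * tb i ?E w)))"
  proof (rule sum.cong[OF refl], rule sum.cong[OF refl])
    fix b z assume bz: "b \<in> ?I" "z \<in> ?I"
    have "(\<Sum>y\<in>?I. \<Sum>x\<in>?I. tb i x z * (?r x ?E b y * t j y ?F)) =
      sc (rdiag q (inverse (u i)) (u j) ?E b) * (tb i ?E z * t j b ?F) + sc (roff q (inverse (u i)) (u j) ?E b) * (tb i b z * t j ?E ?F)"
      by (rule sum_rt_left[OF bz(1)]) (use t_out tb_out in blast)
    also have "\<dots> = sc (rdiag q (inverse (u i)) (u j) z ?F) * (t j b ?F * tb i ?E z) + sc (roff q (inverse (u i)) (u j) ?F z) * (t j b z * tb i ?E ?F)"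
      by (rule rtt_relD[OF relBT])
    also have "\<dots> = (\<Sum>w\<in>?I. \<Sum>y\<in>?I. t j b y * (?r z w y ?F * tb i ?E w))"
      by (rule sum_rt_right[OF bz(2), symmetric]) (use t_out tb_out in blast)
    finally show "H (e(i := z, j := b)) * (\<Sum>y\<in>?I. \<Sum>x\<in>?I. tb i x z * (?r x ?E b y * t j y ?F)) =
      H (e(i := z, j := b)) * (\<Sum>w\<in>?I. \<Sum>y\<in>?I. t j b y * (?r z w y ?F * tb i ?E w))" by (simp only:)
  qed
  also have "\<dots> = (\<Sum>b\<in>?I. \<Sum>z\<in>?I. \<Sum>w\<in>?I. \<Sum>y\<in>?I. H (e(i := z, j := b)) * (t j b y * (?r z w y ?F * tb i ?E w)))"
    by (simp only: sum_distrib_left)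
  also have "\<dots> = (\<Sum>w\<in>?I. \<Sum>z\<in>?I. \<Sum>y\<in>?I. \<Sum>b\<in>?I. H (e(i := z, j := b)) * (t j b y * (?r z w y ?F * tb i ?E w)))"
    by (rule sum_swap_outer[symmetric])
  also have "\<dots> = Bop i (Rop i j (Top j H)) e"
    using ij by (simp add: cop_def pop_def tbt_def sum_distrib_right upd2 mult.assoc)
  finally show "Top j (Rop i j (Bop i H)) e = Bop i (Rop i j (Top j H)) e" .
qed

lemma Sop_eq: "[Sop i] \<approx> [Top i, Bop i]"
proof -
  have "Sop i H e = Bop i (Top i H) e" for H e
  proof -
    have "Bop i (Top i H) e = (\<Sum>d\<in>{1..N}. \<Sum>x\<in>{1..N}. H (e(i := x)) * (t i x d * tb i (e i) d))"
      by (simp add: cop_def tbt_def sum_distrib_right mult.assoc)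
    also have "\<dots> = Sop i H e"
      by (subst sum.swap) (simp add: cop_def S_def sum_distrib_left)
    finally show ?thesis by simp
  qed
  then show ?thesis by (simp add: run_eq_def fun_eq_iff)
qed

end

text \<open>Ordered by the second index, as the R-matrices accumulate in
  \<open>run_blocks\<close>.\<close>

definition pairs :: "nat \<Rightarrow> (nat \<times> nat) list" where
  "pairs k = concat (map (\<lambda>j. map (\<lambda>i. (i, j)) [1..<j]) [1..<Suc k])"

lemma pairs_Suc: "pairs (Suc k) = pairs k @ map (\<lambda>i. (i, Suc k)) [1..<Suc k]"
  by (simp add: pairs_def)

lemma set_pairs: "set (pairs k) = {(i, j). 1 \<le> i \<and> i < j \<and> j \<le> k}"
proof (induction k)
  case (Suc k)
  show ?case unfolding pairs_Suc set_append Suc by (auto simp: le_Suc_eq)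
qed (auto simp: pairs_def)

lemma distinct_pairs: "distinct (pairs k)"
proof (induction k)
  case (Suc k)
  have "distinct (map (\<lambda>i. (i, Suc k)) [1..<Suc k])"
    by (simp only: distinct_map distinct_upt) (auto simp: inj_on_def)
  then show ?case using Suc unfolding pairs_Suc distinct_append set_pairs by auto
qed (simp add: pairs_def)

lemma run_eq_eq_trans [trans]: "fs \<approx> gs \<Longrightarrow> gs = hs \<Longrightarrow> fs \<approx> hs"
  and eq_run_eq_trans [trans]: "fs = gs \<Longrightarrow> gs \<approx> hs \<Longrightarrow> fs \<approx> hs"
  by simp_all

lemma run_eq_commute_map:
  "(\<And>i. i \<in> set xs \<Longrightarrow> commutes (F i) g) \<Longrightarrow> map F xs @ [g] \<approx> [g] @ map F xs"
  by (rule run_eq_commute) auto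

lemma map_upd_from:
  assumes "length ds = N"
  shows "map (upd_from e 1 ds) [1..<Suc N] = ds"
  by (rule nth_equalityI) (use assms in \<open>auto simp: upd_from_def simp del: upt_Suc\<close>)

context sklyanin_op
begin

lemma Rop_Top: "k \<noteq> i \<Longrightarrow> k \<noteq> j \<Longrightarrow> commutes (Rop i j) (Top k)"
  and Rop_Bop: "k \<noteq> i \<Longrightarrow> k \<noteq> j \<Longrightarrow> commutes (Rop i j) (Bop k)"
  by (rule commutes_sym, rule cop_pop_commute, assumption, assumption)+

lemma Bop_Rop: "k \<noteq> i \<Longrightarrow> k \<noteq> j \<Longrightarrow> commutes (Bop k) (Rop i j)"
  by (rule cop_pop_commute)

text \<open>T_j crosses T-bar^t_i and R^t_ij together by the transposed relation, for i = k down to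
  1; the factors with other indices commute out of the way.\<close>

lemma Bops_Rops_Top:
  assumes "k < j"
  shows "map Bop [1..<Suc k] @ map (\<lambda>i. Rop i j) [1..<Suc k] @ [Top j] \<approx>
    [Top j] @ map (\<lambda>i. Rop i j) [1..<Suc k] @ map Bop [1..<Suc k]"
  using assms
proof (induction k)
  case (Suc k)
  let ?b = "map Bop [1..<Suc k]" and ?r = "map (\<lambda>i. Rop i j) [1..<Suc k]"
  let ?B = "Bop (Suc k)" and ?R = "Rop (Suc k) j" and ?T = "Top j"
  have upt: "[1..<Suc (Suc k)] = [1..<Suc k] @ [Suc k]" by simp
  have 1: "?r @ [?B] \<approx> [?B] @ ?r"
    by (rule run_eq_commute_map, rule Rop_Bop) (use Suc.prems in auto)
  have 2: "[?B] @ [?R] @ [?T] \<approx> [?T] @ [?R] @ [?B]"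
  proof -
    have "Suc k \<noteq> j" using Suc.prems by simp
    then have "run ([?B] @ [?R] @ [?T]) H = run ([?T] @ [?R] @ [?B]) H" for H
      unfolding append.simps run_Cons run_Nil by (rule Bop_Rop_Top)
    then show ?thesis unfolding run_eq_def by (rule ext)
  qed
  have 3: "?b @ [?R] \<approx> [?R] @ ?b"
    by (rule run_eq_commute_map, rule Bop_Rop) (use Suc.prems in auto)
  have IH: "?b @ ?r @ [?T] \<approx> [?T] @ ?r @ ?b" by (rule Suc.IH) (use Suc.prems in linarith)
  have "map Bop [1..<Suc (Suc k)] @ map (\<lambda>i. Rop i j) [1..<Suc (Suc k)] @ [?T] = ?b @ ([?B] @ ?r) @ ([?R] @ [?T])"
    by (simp only: upt map_append list.map append_assoc)
  also have "\<dots> \<approx> ?b @ (?r @ [?B]) @ ([?R] @ [?T])"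
    by (rule run_eq_middle[OF run_eq_sym[OF 1]])
  also have "\<dots> = (?b @ ?r) @ ([?B] @ [?R] @ [?T]) @ []" by (simp only: append_assoc append_Nil2)
  also have "\<dots> \<approx> (?b @ ?r) @ ([?T] @ [?R] @ [?B]) @ []" by (rule run_eq_middle[OF 2])
  also have "\<dots> = [] @ (?b @ ?r @ [?T]) @ ([?R] @ [?B])" by (simp only: append_assoc append_Nil append_Nil2)
  also have "\<dots> \<approx> [] @ ([?T] @ ?r @ ?b) @ ([?R] @ [?B])" by (rule run_eq_middle[OF IH])
  also have "\<dots> = ([?T] @ ?r) @ (?b @ [?R]) @ [?B]" by (simp only: append_assoc append_Nil)
  also have "\<dots> \<approx> ([?T] @ ?r) @ ([?R] @ ?b) @ [?B]" by (rule run_eq_middle[OF 3])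
  also have "\<dots> = [?T] @ map (\<lambda>i. Rop i j) [1..<Suc (Suc k)] @ map Bop [1..<Suc (Suc k)]"
    by (simp only: upt map_append list.map append_assoc)
  finally show ?case .
qed simp

text \<open>Collects every T on the left and every T-bar^t on the right of the R^t_ij with i < j
  \<le> k, while the R^t_ij with j > k wait at the end. The next T_{k+1} then stands behind the
  factors T-bar^t_i and R^t_{i,k+1}, for which the transposed relation is available, and commutes
  with the others. For k = N nothing waits any more.\<close>

lemma run_blocks:
  assumes "k \<le> N"
  shows "concat (map (\<lambda>i. Sop i # map (Rop i) [Suc i..<Suc N]) [1..<Suc k]) \<approx>
    map Top [1..<Suc k] @ map (\<lambda>(i, j). Rop i j) (pairs k) @ map Bop [1..<Suc k] @
    concat (map (\<lambda>j. map (\<lambda>i. Rop i j) [1..<Suc k]) [Suc k..<Suc N])"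
  using assms
proof (induction k)
  case 0
  have "concat (map (\<lambda>j. [] :: (((nat \<Rightarrow> nat) \<Rightarrow> 'l) \<Rightarrow> (nat \<Rightarrow> nat) \<Rightarrow> 'l) list) xs) = []" for xs :: "nat list" by (induction xs) simp_all
  moreover have "[1..<Suc 0] = []" by simp
  ultimately show ?case by (simp only: list.map concat.simps pairs_def append_Nil run_eq_refl)
next
  case (Suc k)
  let ?t = "map Top [1..<Suc k]" and ?g = "map (\<lambda>(i, j). Rop i j) (pairs k)" and ?b = "map Bop [1..<Suc k]"
  let ?r = "map (\<lambda>i. Rop i (Suc k)) [1..<Suc k]"
  let ?J = "[Suc (Suc k)..<Suc N]"
  let ?rest = "concat (map (\<lambda>j. map (\<lambda>i. Rop i j) [1..<Suc k]) ?J)"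
  let ?s = "map (Rop (Suc k)) ?J"
  let ?T = "Top (Suc k)" and ?B = "Bop (Suc k)"
  have upt: "[1..<Suc (Suc k)] = [1..<Suc k] @ [Suc k]" by simp
  have upt': "[Suc k..<Suc N] = Suc k # ?J" using Suc.prems by (intro upt_conv_Cons) simp
  have rest_elem: "\<exists>i j. f = Rop i j \<and> Suc k \<noteq> i \<and> Suc k \<noteq> j" if "f \<in> set ?rest" for f
  proof -
    from that obtain j where j: "j \<in> set ?J" "f \<in> set (map (\<lambda>i. Rop i j) [1..<Suc k])"
      unfolding set_concat set_map[of _ ?J] by blast
    then obtain i where "f = Rop i j" "i \<in> set [1..<Suc k]" unfolding set_map by blast
    moreover have "Suc k \<noteq> i" "Suc k \<noteq> j" using \<open>i \<in> set [1..<Suc k]\<close> j(1) by auto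
    ultimately show ?thesis by blast
  qed
  have restT: "?rest @ [?T] \<approx> [?T] @ ?rest"
    by (rule run_eq_commute) (use rest_elem Rop_Top in blast)
  have restB: "?rest @ [?B] \<approx> [?B] @ ?rest"
    by (rule run_eq_commute) (use rest_elem Rop_Bop in blast)
  have gT: "?g @ [?T] \<approx> [?T] @ ?g"
  proof (rule run_eq_commute_map)
    fix p assume "p \<in> set (pairs k)"
    then obtain i j where "p = (i, j)" "Suc k \<noteq> i" "Suc k \<noteq> j" unfolding set_pairs by auto
    then show "commutes (case p of (i, j) \<Rightarrow> Rop i j) ?T" using Rop_Top by simp
  qed
  have brT: "?b @ ?r @ [?T] \<approx> [?T] @ ?r @ ?b"
    by (rule Bops_Rops_Top) simp
  \<comment> \<open>Sorts each new R^t_{k+1,j} in behind the waiting factors with the same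
    j.\<close>
  have rests: "?rest @ ?s \<approx> concat (map (\<lambda>j. map (\<lambda>i. Rop i j) [1..<Suc k] @ [Rop (Suc k) j]) ?J)"
  proof (rule run_eq_interleave[where A = "\<lambda>j. map (\<lambda>i. Rop i j) [1..<Suc k]" and g = "Rop (Suc k)"])
    show "distinct ?J" by (rule distinct_upt)
    fix j j' f assume j: "j \<in> set ?J" "j' \<in> set ?J" "j \<noteq> j'" "f \<in> set (map (\<lambda>i. Rop i j') [1..<Suc k])"
    then obtain i where "f = Rop i j'" "i \<in> set [1..<Suc k]" by (simp only: set_map) blast
    moreover have "commutes (Rop i j') (Rop (Suc k) j)"
      by (rule pop_pop_commute) (use j calculation in auto)
    ultimately show "commutes f (Rop (Suc k) j)" by simp
  qed
  have "concat (map (\<lambda>i. Sop i # map (Rop i) [Suc i..<Suc N]) [1..<Suc (Suc k)]) =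
      concat (map (\<lambda>i. Sop i # map (Rop i) [Suc i..<Suc N]) [1..<Suc k]) @ ([Sop (Suc k)] @ ?s)"
    unfolding upt by (simp only: map_append concat_append list.map concat.simps append.simps append_Nil2)
  also have "\<dots> \<approx> (?t @ ?g @ ?b @ concat (map (\<lambda>j. map (\<lambda>i. Rop i j) [1..<Suc k]) [Suc k..<Suc N])) @ ([?T, ?B] @ ?s)"
    by (rule run_eq_append[OF Suc.IH run_eq_append[OF Sop_eq run_eq_refl]]) (use Suc.prems in linarith)
  also have "\<dots> = (?t @ ?g @ ?b @ ?r) @ (?rest @ [?T]) @ ([?B] @ ?s)"
    unfolding upt' by (simp only: list.map concat.simps append_assoc append.simps)
  also have "\<dots> \<approx> (?t @ ?g @ ?b @ ?r) @ ([?T] @ ?rest) @ ([?B] @ ?s)" by (rule run_eq_middle[OF restT])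
  also have "\<dots> = (?t @ ?g) @ (?b @ ?r @ [?T]) @ (?rest @ [?B] @ ?s)" by (simp only: append_assoc)
  also have "\<dots> \<approx> (?t @ ?g) @ ([?T] @ ?r @ ?b) @ (?rest @ [?B] @ ?s)" by (rule run_eq_middle[OF brT])
  also have "\<dots> = ?t @ (?g @ [?T]) @ (?r @ ?b @ ?rest @ [?B] @ ?s)" by (simp only: append_assoc)
  also have "\<dots> \<approx> ?t @ ([?T] @ ?g) @ (?r @ ?b @ ?rest @ [?B] @ ?s)" by (rule run_eq_middle[OF gT])
  also have "\<dots> = (?t @ [?T] @ ?g @ ?r @ ?b) @ (?rest @ [?B]) @ ?s" by (simp only: append_assoc)
  also have "\<dots> \<approx> (?t @ [?T] @ ?g @ ?r @ ?b) @ ([?B] @ ?rest) @ ?s" by (rule run_eq_middle[OF restB])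
  also have "\<dots> = (?t @ [?T] @ ?g @ ?r @ ?b @ [?B]) @ (?rest @ ?s)" by (simp only: append_assoc)
  also have "\<dots> \<approx> (?t @ [?T] @ ?g @ ?r @ ?b @ [?B]) @ concat (map (\<lambda>j. map (\<lambda>i. Rop i j) [1..<Suc k] @ [Rop (Suc k) j]) ?J)"
    by (rule run_eq_append[OF run_eq_refl rests])
  also have "\<dots> = map Top [1..<Suc (Suc k)] @ map (\<lambda>(i, j). Rop i j) (pairs (Suc k)) @ map Bop [1..<Suc (Suc k)] @
    concat (map (\<lambda>j. map (\<lambda>i. Rop i j) [1..<Suc (Suc k)]) ?J)"
    unfolding upt pairs_Suc by (simp only: map_append list.map append_assoc map_map comp_def prod.case)
  finally show ?case .
qed

definition good :: "(nat \<Rightarrow> nat) \<Rightarrow> bool" where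
  "good e \<longleftrightarrow> (\<forall>i\<in>{1..N}. e i \<in> {1..N})"

text \<open>The off-diagonal part of R^t only picks up values with equal indices in copies i and j,
  where \<open>h\<close> vanishes; for distinct indices the diagonal coefficient is u_i^{-1} -
  u_j.\<close>

lemma Rop_scalar:
  assumes ij: "i \<noteq> j" "i \<in> {1..N}" "j \<in> {1..N}" and e: "good e"
    and H: "\<And>e. good e \<Longrightarrow> H e = sc c * h e"
    and h: "\<And>e. e i = e j \<Longrightarrow> h e = 0"
  shows "Rop i j H e = sc (c * (inverse (u i) - u j)) * h e"
proof -
  let ?x = "inverse (u i)" and ?v = "u j"
  have "Rop i j H e = (\<Sum>x\<in>{1..N}. \<Sum>y\<in>{1..N}. if x = e i then if y = e j then H e * sc (rdiag q ?x ?v (e i) (e j)) else 0 else 0)"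
    unfolding pop_def
  proof (rule sum.cong[OF refl], rule sum.cong[OF refl])
    fix x y assume xy: "x \<in> {1..N}" "y \<in> {1..N}"
    have ge: "good (e(i := x, j := y))" using e xy by (auto simp: good_def)
    have id: "e(i := e i, j := e j) = e" by simp
    show "H (e(i := x, j := y)) * sc (rt ?x ?v x (e i) y (e j)) =
      (if x = e i then if y = e j then H e * sc (rdiag q ?x ?v (e i) (e j)) else 0 else 0)"
    proof (cases "x = e i \<and> y = e j")
      case True
      then show ?thesis by (simp add: rt_def id)
    next
      case False
      then show ?thesis
      proof (cases "y = x")
        case True
        have "H (e(i := x, j := y)) = 0"
        proof -
          have "h (e(i := x, j := y)) = 0" by (rule h) (use True ij(1) in simp)
          then show ?thesis by (simp only: H[OF ge] mult_zero_right)
        qed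
        then show ?thesis using False by auto
      next
        case yx: False
        then show ?thesis using False by (auto simp: rt_def)
      qed
    qed
  qed
  also have "\<dots> = H e * sc (rdiag q ?x ?v (e i) (e j))"
    using e ij by (subst sum_delta2) (auto simp: good_def)
  also have "\<dots> = sc (c * (?x - ?v)) * h e"
  proof (cases "e i = e j")
    case True
    then show ?thesis by (simp add: H[OF e] h)
  next
    case False
    have "sc c * h e * sc (?x - ?v) = sc (c * (?x - ?v)) * h e"
      by (metis mult.assoc sc_central sc_mult)
    then show ?thesis using False by (simp only: H[OF e] rdiag_def if_False)
  qed
  finally show ?thesis .
qed

lemma run_Rop_scalar:
  assumes "\<And>i j. (i, j) \<in> set ps \<Longrightarrow> i \<noteq> j \<and> i \<in> {1..N} \<and> j \<in> {1..N}"
    and h: "\<And>e i j. (i, j) \<in> set ps \<Longrightarrow> e i = e j \<Longrightarrow> h e = 0"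
    and "\<And>e. good e \<Longrightarrow> H e = sc c * h e" and "good e"
  shows "run (map (\<lambda>(i, j). Rop i j) ps) H e = sc (c * (\<Prod>(i, j)\<leftarrow>ps. inverse (u i) - u j)) * h e"
  using assms(1-3)
proof (induction ps arbitrary: H c)
  case Nil
  then show ?case using assms(4) by simp
next
  case (Cons p ps)
  obtain i j where p: "p = (i, j)" by fastforce
  have ij: "i \<noteq> j" "i \<in> {1..N}" "j \<in> {1..N}" using Cons.prems(1)[of i j] p by simp_all
  have h0: "h e = 0" if "e i = e j" for e by (rule Cons.prems(2)[of i j]) (use that p in simp_all)
  have "Rop i j H e = sc (c * (inverse (u i) - u j)) * h e" if "good e" for e
    by (rule Rop_scalar[OF ij that Cons.prems(3) h0])
  then have "run (map (\<lambda>(i, j). Rop i j) ps) (Rop i j H) e =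
     sc (c * (inverse (u i) - u j) * (\<Prod>(i, j)\<leftarrow>ps. inverse (u i) - u j)) * h e"
  proof (intro Cons.IH)
    fix i j assume *: "(i, j) \<in> set ps"
    then show "i \<noteq> j \<and> i \<in> {1..N} \<and> j \<in> {1..N}" by (intro Cons.prems(1)) simp
    show "h e = 0" if "e i = e j" for e by (rule Cons.prems(2)[of i j e]) (use * that in simp_all)
  qed
  then show ?case by (simp add: p mult.assoc)
qed

text \<open>T_1 ... T_N turns the q-sign vector into the q-minors of T. These vanish on repeated
  columns, so every R^t_ij acts by a scalar, and the T-bar^t_i complete the sum
  \<open>sig\<close>.\<close>

lemma run_sdet:
  assumes N: "N \<ge> 1" and e: "good e"
  shows "run (concat (map (\<lambda>i. Sop i # map (Rop i) [Suc i..<Suc N]) [1..<Suc N])) (\<lambda>e. sc (wt {1..N} (map e [1..<Suc N]))) e =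
    sc (\<Prod>(i, j)\<in>{(i, j). 1 \<le> i \<and> i < j \<and> j \<le> N}. inverse (u i) - u j) * sig 1 {1..N} (map e [1..<Suc N])"
proof -
  let ?H0 = "\<lambda>e. sc (wt {1..N} (map e [1..<Suc N]))"
  let ?h = "\<lambda>e. tau 1 {1..N} (map e [1..<Suc N])"
  let ?g = "\<Prod>(i, j)\<leftarrow>pairs N. inverse (u i) - u j"
  have g: "(\<Prod>(i, j)\<in>{(i, j). 1 \<le> i \<and> i < j \<and> j \<le> N}. inverse (u i) - u j) = ?g"
    unfolding set_pairs[symmetric] by (rule prod.distinct_set_conv_list[OF distinct_pairs])
  have "run (map Top [1..<Suc N]) ?H0 e' = ?h e'" for e'
  proof -
    have "run (map Top [1..<Suc N]) ?H0 e' = (\<Sum>ds\<in>tuples N N. ?H0 (upd_from e' 1 ds) * prodM t 1 ds (map e' [1..<Suc N]))"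
      using run_cop[of 1 "Suc N" N t] by (simp del: upt_Suc)
    also have "\<dots> = (\<Sum>ds\<in>tuples N N. sc (wt {1..N} ds) * prodM t 1 ds (map e' [1..<Suc N]))"
      by (rule sum.cong[OF refl]) (simp only: map_upd_from[OF tuples_length])
    also have "\<dots> = ?h e'" by (simp add: minor_def del: upt_Suc)
    finally show ?thesis .
  qed
  then have hT: "run (map Top [1..<Suc N]) ?H0 = ?h" by (rule ext)
  have hR: "run (map (\<lambda>(i, j). Rop i j) (pairs N)) ?h e' = sc ?g * ?h e'" if "good e'" for e'
  proof -
    have "run (map (\<lambda>(i, j). Rop i j) (pairs N)) ?h e' = sc (1 * ?g) * ?h e'"
    proof (rule run_Rop_scalar[OF _ _ _ that])
      fix i j assume "(i, j) \<in> set (pairs N)"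
      then show ij: "i \<noteq> j \<and> i \<in> {1..N} \<and> j \<in> {1..N}" by (auto simp: set_pairs)
      fix e :: "nat \<Rightarrow> nat" assume "e i = e j"
      have "\<not> distinct (map e [1..<Suc N])"
      proof
        assume "distinct (map e [1..<Suc N])"
        then have "inj_on e {1..N}" by (simp only: distinct_map set_upt atLeastLessThanSuc_atLeastAtMost)
        then show False using ij \<open>e i = e j\<close> by (auto dest: inj_onD)
      qed
      then show "?h e = 0" by (rule alternating_not_distinct[OF alternating_tau])
    qed simp
    then show ?thesis by simp
  qed
  have "run (concat (map (\<lambda>i. Sop i # map (Rop i) [Suc i..<Suc N]) [1..<Suc N])) ?H0 e =
    run (map Bop [1..<Suc N]) (run (map (\<lambda>(i, j). Rop i j) (pairs N)) ?h) e"
  proof -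
    have "concat (map (\<lambda>j. map (\<lambda>i. Rop i j) [1..<Suc N]) [Suc N..<Suc N]) = []" by (simp only: upt_rec[of "Suc N" "Suc N"]) simp
    then show ?thesis
      using run_blocks[OF order_refl] unfolding run_eq_def by (simp only: run_append hT append_Nil2)
  qed
  also have "\<dots> = (\<Sum>ds\<in>tuples N N. run (map (\<lambda>(i, j). Rop i j) (pairs N)) ?h (upd_from e 1 ds) * prodM tbt 1 ds (map e [1..<Suc N]))"
    using run_cop[of 1 "Suc N" N tbt] by (simp del: upt_Suc)
  also have "\<dots> = (\<Sum>ds\<in>tuples N N. sc ?g * (tau 1 {1..N} ds * prodM tbt 1 ds (map e [1..<Suc N])))"
  proof (rule sum.cong[OF refl])
    fix ds assume ds: "ds \<in> tuples N N"
    then have l: "length ds = N" "set ds \<subseteq> {1..N}" by (auto simp: tuples_def)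
    have "good (upd_from e 1 ds)"
      unfolding good_def upd_from_def using l by (auto simp: subset_iff)
    then show "run (map (\<lambda>(i, j). Rop i j) (pairs N)) ?h (upd_from e 1 ds) * prodM tbt 1 ds (map e [1..<Suc N]) =
      sc ?g * (tau 1 {1..N} ds * prodM tbt 1 ds (map e [1..<Suc N]))"
      by (simp only: hR map_upd_from[OF l(1)] mult.assoc)
  qed
  also have "\<dots> = sc ?g * sig 1 {1..N} (map e [1..<Suc N])"
    unfolding sig_def sum_distrib_left by (simp del: upt_Suc)
  finally show ?thesis unfolding g .
qed

end

section \<open>Laurent series over the free algebra and the ideal of relations\<close>

text \<open>The additional terms are zero. Arbitrary lower bounds are convenient, since rescaling
  and multiplication by the variable give a bound but not the exact subdegree.\<close>

lemma fls_times_nth_bounds: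
  fixes f g :: "'a::semiring_0 fls"
  assumes "\<And>i. i < a \<Longrightarrow> fls_nth f i = 0" "\<And>i. i < b \<Longrightarrow> fls_nth g i = 0"
  shows "fls_nth (f * g) n = (\<Sum>i\<in>{a..n - b}. fls_nth f i * fls_nth g (n - i))"
proof -
  let ?A = "{fls_subdegree f..n - fls_subdegree g}" and ?B = "{a..n - b}"
  have "fls_nth (f * g) n = (\<Sum>i\<in>?A. fls_nth f i * fls_nth g (n - i))"
    by (rule fls_times_nth(2))
  also have "\<dots> = (\<Sum>i\<in>?A \<union> ?B. fls_nth f i * fls_nth g (n - i))"
  proof (rule sum.mono_neutral_left)
    show "\<forall>i\<in>?A \<union> ?B - ?A. fls_nth f i * fls_nth g (n - i) = 0"
    proof
      fix i assume "i \<in> ?A \<union> ?B - ?A"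
      then have "i < fls_subdegree f \<or> n - i < fls_subdegree g" by auto
      then show "fls_nth f i * fls_nth g (n - i) = 0"
        using fls_eq0_below_subdegree[of i f] fls_eq0_below_subdegree[of "n - i" g] by auto
    qed
  qed auto
  also have "\<dots> = (\<Sum>i\<in>?B. fls_nth f i * fls_nth g (n - i))"
  proof (rule sum.mono_neutral_right)
    show "\<forall>i\<in>?A \<union> ?B - ?B. fls_nth f i * fls_nth g (n - i) = 0"
    proof
      fix i assume "i \<in> ?A \<union> ?B - ?B"
      then have "i < a \<or> n - i < b" by auto
      then show "fls_nth f i * fls_nth g (n - i) = 0"
        using assms(1)[of i] assms(2)[of "n - i"] by auto
    qed
  qed auto
  finally show ?thesis .
qed

lemma scal_0 [simp]: "scal 0 = 0" and scal_1 [simp]: "scal 1 = 1"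
  and scal_add: "scal (a + b) = scal a + scal b"
  and scal_mult: "scal (a * b) = scal a * scal b"
  by (simp_all add: scal_def single_add mult_single single_one)

text \<open>Induction over the support: a scalar sits at the empty word, and this commutes with each
  single word.\<close>

lemma scal_central: "scal c * x = x * scal c"
proof (induction x rule: update_induct)
  case const
  then show ?case by simp
next
  case (update f a b)
  have "scal c * Poly_Mapping.single a b = Poly_Mapping.single a b * scal c"
    by (simp add: scal_def mult_single mult.commute)
  moreover have "Poly_Mapping.update a b f = f + Poly_Mapping.single a b"
    using update.hyps(1) by (intro poly_mapping_eqI) (auto simp: lookup_update lookup_add lookup_single in_keys_iff)
  ultimately show ?case using update.IH by (simp add: distrib_left distrib_right)
qed

lemma scal_diff: "scal (a - b) = scal a - scal b"
  using scal_add[of "a - b" b] by simp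

lemma scal_sum: "scal (\<Sum>i\<in>A. f i) = (\<Sum>i\<in>A. scal (f i))"
  by (induction A rule: infinite_finite_induct) (simp_all add: scal_add)

lemma fls_scal_nth [simp]: "fls_nth (fls_scal f) k = scal (fls_nth f k)"
  by (simp add: fls_scal.rep_eq)

lemma fls_scal_1 [simp]: "fls_scal 1 = 1"
  by (rule fls_eqI) simp

lemma fls_scal_add: "fls_scal (f + g) = fls_scal f + fls_scal g"
  by (rule fls_eqI) (simp add: scal_add)

lemma fls_scal_diff: "fls_scal (f - g) = fls_scal f - fls_scal g"
  by (rule fls_eqI) (simp add: scal_diff)

lemma fls_scal_mult: "fls_scal (f * g) = fls_scal f * fls_scal g"
proof (rule fls_eqI)
  fix n
  have "fls_nth (fls_scal f * fls_scal g) n =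
    (\<Sum>i\<in>{fls_subdegree f..n - fls_subdegree g}. fls_nth (fls_scal f) i * fls_nth (fls_scal g) (n - i))"
    by (rule fls_times_nth_bounds) simp_all
  then show "fls_nth (fls_scal (f * g)) n = fls_nth (fls_scal f * fls_scal g) n"
    by (simp add: fls_times_nth(2)[of f g] scal_sum scal_mult)
qed

lemma fls_scal_central: "fls_scal c * f = f * fls_scal c"
proof (rule fls_eqI)
  fix n
  let ?a = "fls_subdegree c" and ?b = "fls_subdegree f"
  have "fls_nth (fls_scal c * f) n = (\<Sum>i\<in>{?a..n - ?b}. scal (fls_nth c i) * fls_nth f (n - i))"
    by (subst fls_times_nth_bounds[of ?a _ ?b]) simp_all
  also have "\<dots> = (\<Sum>i\<in>{?b..n - ?a}. fls_nth f i * scal (fls_nth c (n - i)))"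
    by (rule sum.reindex_bij_witness[of _ "\<lambda>i. n - i" "\<lambda>i. n - i"]) (auto simp: scal_central)
  also have "\<dots> = fls_nth (f * fls_scal c) n"
    by (subst fls_times_nth_bounds[of ?b _ ?a]) simp_all
  finally show "fls_nth (fls_scal c * f) n = fls_nth (f * fls_scal c) n" .
qed

lemma fls_scal_const: "fls_scal (fls_const c) = scal_fls c"
  by (rule fls_eqI) (simp add: scal_fls_def)

lemma fls_scal_X: "fls_scal fls_X = fls_X" and fls_scal_X_inv: "fls_scal fls_X_inv = fls_X_inv"
  by (rule fls_eqI, simp)+

lemma ideal_uq_ideal: "ideal (uq_ideal q N) free_ring"
  unfolding uq_ideal_def by (rule ring.genideal_ideal[OF ring_free_ring]) (simp add: free_ring_def)

lemma uq_ideal_lmult: "x \<in> uq_ideal q N \<Longrightarrow> y * x \<in> uq_ideal q N"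
  using ideal.I_l_closed[OF ideal_uq_ideal, of x q N y] by (simp add: free_ring_def)

lemma uq_ideal_rmult: "x \<in> uq_ideal q N \<Longrightarrow> x * y \<in> uq_ideal q N"
  using ideal.I_r_closed[OF ideal_uq_ideal, of x q N y] by (simp add: free_ring_def)

lemma uq_ideal_add: "x \<in> uq_ideal q N \<Longrightarrow> y \<in> uq_ideal q N \<Longrightarrow> x + y \<in> uq_ideal q N"
  using additive_subgroup.a_closed[OF ideal.axioms(1)[OF ideal_uq_ideal], of x q N y] by (simp add: free_ring_def)

lemma uq_ideal_0: "0 \<in> uq_ideal q N"
  using additive_subgroup.zero_closed[OF ideal.axioms(1)[OF ideal_uq_ideal[of q N]]] by (simp add: free_ring_def)

lemma uq_ideal_uminus: "x \<in> uq_ideal q N \<Longrightarrow> - x \<in> uq_ideal q N"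
  using uq_ideal_lmult[of x q N "- 1"] by simp

lemma uq_ideal_sum: "(\<And>i. i \<in> A \<Longrightarrow> f i \<in> uq_ideal q N) \<Longrightarrow> (\<Sum>i\<in>A. f i) \<in> uq_ideal q N"
  by (induction A rule: infinite_finite_induct) (simp_all add: uq_ideal_0 uq_ideal_add)

lemma uq_relations_in_ideal: "x \<in> uq_relations q N \<Longrightarrow> x \<in> uq_ideal q N"
  unfolding uq_ideal_def using ring.genideal_self[OF ring_free_ring, of "uq_relations q N"]
  by (auto simp: free_ring_def)

lemma uq_class_eq_iff: "uq_class q N x = uq_class q N y \<longleftrightarrow> x - y \<in> uq_ideal q N"
proof -
  have cl: "uq_class q N x = {h + x | h. h \<in> uq_ideal q N}" for x
    by (auto simp: uq_class_def a_r_coset_def' free_ring_def)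
  show ?thesis
  proof
    assume "uq_class q N x = uq_class q N y"
    moreover have "x \<in> uq_class q N x" unfolding cl using uq_ideal_0[of q N] by force
    ultimately obtain h where "x = h + y" "h \<in> uq_ideal q N" unfolding cl by blast
    then show "x - y \<in> uq_ideal q N" by simp
  next
    assume xy: "x - y \<in> uq_ideal q N"
    have "uq_class q N x \<subseteq> uq_class q N y" if "x - y \<in> uq_ideal q N" for x y
    proof
      fix z assume "z \<in> uq_class q N x"
      then obtain h where h: "z = h + x" "h \<in> uq_ideal q N" unfolding cl by blast
      then have "z = (h + (x - y)) + y" "h + (x - y) \<in> uq_ideal q N" using that by (simp_all add: uq_ideal_add)
      then show "z \<in> uq_class q N y" unfolding cl by blast
    qed
    from this[OF xy] this[of y x] uq_ideal_uminus[OF xy] show "uq_class q N x = uq_class q N y" by auto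
  qed
qed

section \<open>A ring of series modulo the relations\<close>

definition coeffs_in :: "complex \<Rightarrow> nat \<Rightarrow> free_alg fls \<Rightarrow> bool" where
  "coeffs_in q N f \<longleftrightarrow> (\<forall>k. fls_nth f k \<in> uq_ideal q N)"

lemma coeffs_in_0: "coeffs_in q N 0"
  by (simp add: coeffs_in_def uq_ideal_0)

lemma coeffs_in_add: "coeffs_in q N f \<Longrightarrow> coeffs_in q N g \<Longrightarrow> coeffs_in q N (f + g)"
  by (simp add: coeffs_in_def uq_ideal_add)

lemma coeffs_in_uminus: "coeffs_in q N f \<Longrightarrow> coeffs_in q N (- f)"
  by (simp add: coeffs_in_def uq_ideal_uminus)

lemma coeffs_in_lmult: "coeffs_in q N f \<Longrightarrow> coeffs_in q N (g * f)"
  by (auto simp: coeffs_in_def fls_times_nth(2) intro!: uq_ideal_sum uq_ideal_lmult)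

lemma coeffs_in_rmult: "coeffs_in q N f \<Longrightarrow> coeffs_in q N (f * g)"
  by (auto simp: coeffs_in_def fls_times_nth(2) intro!: uq_ideal_sum uq_ideal_rmult)

text \<open>Types cannot depend on \<open>q\<close> and \<open>N\<close>, so the series rings over all the algebras \<open>Uq q N\<close> are
  put into one product ring, together with the factor \<open>None\<close> that ensures \<open>0 \<noteq> 1\<close>.\<close>

definition ul_rel :: "((complex \<times> nat) option \<Rightarrow> free_alg fls) \<Rightarrow> ((complex \<times> nat) option \<Rightarrow> free_alg fls) \<Rightarrow> bool" where
  "ul_rel F G \<longleftrightarrow> F None = G None \<and> (\<forall>q N. coeffs_in q N (F (Some (q, N)) - G (Some (q, N))))"

quotient_type ul = "(complex \<times> nat) option \<Rightarrow> free_alg fls" / ul_rel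
proof (rule equivpI)
  show "reflp ul_rel" by (simp add: reflp_def ul_rel_def coeffs_in_0)
  show "symp ul_rel"
  proof (rule sympI)
    fix F G assume FG: "ul_rel F G"
    have "coeffs_in q N (G (Some (q, N)) - F (Some (q, N)))" for q N
      using FG coeffs_in_uminus[of q N "F (Some (q, N)) - G (Some (q, N))"] by (simp add: ul_rel_def)
    then show "ul_rel G F" using FG by (simp add: ul_rel_def)
  qed
  show "transp ul_rel"
  proof (rule transpI)
    fix F G H assume FG: "ul_rel F G" and GH: "ul_rel G H"
    have "coeffs_in q N (F (Some (q, N)) - H (Some (q, N)))" for q N
      using FG GH coeffs_in_add[of q N "F (Some (q, N)) - G (Some (q, N))" "G (Some (q, N)) - H (Some (q, N))"]
      by (simp add: ul_rel_def)
    then show "ul_rel F H" using FG GH by (simp add: ul_rel_def)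
  qed
qed

instantiation ul :: ring_1
begin

lift_definition zero_ul :: ul is "\<lambda>_. 0" .

lift_definition one_ul :: ul is "\<lambda>_. 1" .

lift_definition plus_ul :: "ul \<Rightarrow> ul \<Rightarrow> ul" is "\<lambda>F G x. F x + G x"
proof -
  fix F F' G G' assume a: "ul_rel F F'" "ul_rel G G'"
  have "coeffs_in q N (F (Some (q, N)) + G (Some (q, N)) - (F' (Some (q, N)) + G' (Some (q, N))))" for q N
    using a coeffs_in_add[of q N "F (Some (q, N)) - F' (Some (q, N))" "G (Some (q, N)) - G' (Some (q, N))"]
    by (simp add: ul_rel_def algebra_simps)
  then show "ul_rel (\<lambda>x. F x + G x) (\<lambda>x. F' x + G' x)" using a by (simp add: ul_rel_def)
qed

lift_definition uminus_ul :: "ul \<Rightarrow> ul" is "\<lambda>F x. - F x"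
proof -
  fix F F' assume a: "ul_rel F F'"
  have "coeffs_in q N (- F (Some (q, N)) - - F' (Some (q, N)))" for q N
    using a coeffs_in_uminus[of q N "F (Some (q, N)) - F' (Some (q, N))"]
    by (simp add: ul_rel_def algebra_simps)
  then show "ul_rel (\<lambda>x. - F x) (\<lambda>x. - F' x)" using a by (simp add: ul_rel_def)
qed

definition minus_ul :: "ul \<Rightarrow> ul \<Rightarrow> ul" where "x - y = x + - (y::ul)"

lift_definition times_ul :: "ul \<Rightarrow> ul \<Rightarrow> ul" is "\<lambda>F G x. F x * G x"
proof -
  fix F F' G G' assume a: "ul_rel F F'" "ul_rel G G'"
  have "coeffs_in q N (F (Some (q, N)) * G (Some (q, N)) - (F' (Some (q, N)) * G' (Some (q, N))))" for q N
    using a coeffs_in_add[OF coeffs_in_rmult[of q N "F (Some (q, N)) - F' (Some (q, N))" "G (Some (q, N))"]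
      coeffs_in_lmult[of q N "G (Some (q, N)) - G' (Some (q, N))" "F' (Some (q, N))"]]
    by (simp add: ul_rel_def algebra_simps)
  then show "ul_rel (\<lambda>x. F x * G x) (\<lambda>x. F' x * G' x)" using a by (simp add: ul_rel_def)
qed

lemma ul_rel_pointwise: "(\<And>x. F x = G x) \<Longrightarrow> ul_rel F G"
  by (simp add: ul_rel_def coeffs_in_0)

instance
proof
  fix a b c :: ul
  show "a + b + c = a + (b + c)" by transfer (rule ul_rel_pointwise, simp add: add.assoc)
  show "a + b = b + a" by transfer (rule ul_rel_pointwise, simp add: add.commute)
  show "0 + a = a" by transfer (rule ul_rel_pointwise, simp)
  show "- a + a = 0" by transfer (rule ul_rel_pointwise, simp)
  show "a - b = a + - b" by (rule minus_ul_def)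
  show "a * b * c = a * (b * c)" by transfer (rule ul_rel_pointwise, simp add: mult.assoc)
  show "(a + b) * c = a * c + b * c" by transfer (rule ul_rel_pointwise, simp add: distrib_right)
  show "a * (b + c) = a * b + a * c" by transfer (rule ul_rel_pointwise, simp add: distrib_left)
  show "1 * a = a" by transfer (rule ul_rel_pointwise, simp)
  show "a * 1 = a" by transfer (rule ul_rel_pointwise, simp)
  show "(0::ul) \<noteq> 1" by transfer (simp add: ul_rel_def)
qed

end

text \<open>Scalars are constant over all components, so that 1 goes to 1. By contrast
  \<open>iota\<close> is supported in a single component and sends 1 to a central idempotent; this
  is why later formulas carry the factor \<open>iota q N 1\<close>.\<close>

definition scu :: "complex fls \<Rightarrow> ul" where
  "scu c = abs_ul (\<lambda>_. fls_scal c)"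

definition iota :: "complex \<Rightarrow> nat \<Rightarrow> free_alg fls \<Rightarrow> ul" where
  "iota q N f = abs_ul (\<lambda>x. if x = Some (q, N) then f else 0)"

lemma abs_ul_eqI: "(\<And>x. F x = G x) \<Longrightarrow> abs_ul F = abs_ul G"
  by (simp add: ul.abs_eq_iff ul_rel_pointwise)

lemmas abs_ul_simps = plus_ul.abs_eq times_ul.abs_eq

interpretation scu: central_scalars scu
proof
  show "scu 1 = 1" unfolding scu_def one_ul_def by (rule abs_ul_eqI) simp
  show "scu (x + y) = scu x + scu y" for x y
    unfolding scu_def abs_ul_simps by (rule abs_ul_eqI) (rule fls_scal_add)
  show "scu (x * y) = scu x * scu y" for x y
    unfolding scu_def abs_ul_simps by (rule abs_ul_eqI) (rule fls_scal_mult)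
  show "scu x * z = z * scu x" for x z
  proof (induct z rule: ul.abs_induct)
    case (1 Z)
    show ?case unfolding scu_def abs_ul_simps by (rule abs_ul_eqI) (rule fls_scal_central)
  qed
qed

lemma iota_add: "iota q N (f + g) = iota q N f + iota q N g"
  unfolding iota_def abs_ul_simps by (rule abs_ul_eqI) simp

lemma iota_mult: "iota q N (f * g) = iota q N f * iota q N g"
  unfolding iota_def abs_ul_simps by (rule abs_ul_eqI) simp

lemma iota_0 [simp]: "iota q N 0 = 0"
  unfolding iota_def zero_ul_def by (rule abs_ul_eqI) simp

lemma iota_sum: "iota q N (\<Sum>i\<in>A. f i) = (\<Sum>i\<in>A. iota q N (f i))"
  by (induction A rule: infinite_finite_induct) (simp_all add: iota_add)

lemma iota_scal_left: "iota q N (fls_scal c * f) = scu c * iota q N f"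
  unfolding iota_def scu_def abs_ul_simps by (rule abs_ul_eqI) simp

lemma iota_scal_right: "iota q N (f * fls_scal c) = iota q N f * scu c"
  unfolding iota_def scu_def abs_ul_simps by (rule abs_ul_eqI) simp

lemma iota_one_left: "iota q N 1 * iota q N f = iota q N f"
  by (simp only: iota_mult[symmetric] mult_1_left)

lemma iota_one_central: "iota q N 1 * x = x * iota q N 1"
proof (induct x rule: ul.abs_induct)
  case (1 X)
  show ?case unfolding iota_def abs_ul_simps by (rule abs_ul_eqI) simp
qed

text \<open>The idempotent accounts for the empty product.\<close>

lemma iota_prod_list: "iota q N (prod_list fs) = iota q N 1 * prod_list (map (iota q N) fs)"
proof (induction fs)
  case (Cons f fs)
  have "iota q N (prod_list (f # fs)) = iota q N f * (iota q N 1 * prod_list (map (iota q N) fs))"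
    by (simp add: iota_mult Cons)
  also have "\<dots> = iota q N 1 * (iota q N f * prod_list (map (iota q N) fs))"
    by (metis iota_one_central mult.assoc)
  finally show ?case by simp
qed simp

lemma iota_eq_iff: "iota q N f = iota q N g \<longleftrightarrow> coeffs_in q N (f - g)"
  by (auto simp: iota_def ul.abs_eq_iff ul_rel_def coeffs_in_0)

lemma iota_eq_0_iff: "iota q N f = 0 \<longleftrightarrow> coeffs_in q N f"
  using iota_eq_iff[of q N f 0] by simp

lemma uq_series_eq_iff: "uq_series q N f = uq_series q N g \<longleftrightarrow> iota q N f = iota q N g"
  by (auto simp: uq_series_def fun_eq_iff uq_class_eq_iff iota_eq_iff coeffs_in_def)

section \<open>Specializing the two-variable relations at the parameters u_i\<close>

text \<open>The substitution of c X for the variable X; on power series it is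
  \<open>subst_ser\<close>.\<close>

lift_definition fls_rescale :: "complex \<Rightarrow> free_alg fls \<Rightarrow> free_alg fls"
  is "\<lambda>c f k. scal (c powi k) * f k"
  by (auto elim: eventually_mono)

definition fls_outer :: "free_alg fls \<Rightarrow> free_alg fls fls" where
  "fls_outer f = Abs_fls (\<lambda>k. fls_const (fls_nth f k))"

lemma fls_rescale_nth [simp]: "fls_nth (fls_rescale c f) k = scal (c powi k) * fls_nth f k"
  by (simp add: fls_rescale.rep_eq)

lemma fls_outer_nth [simp]: "fls_nth (fls_outer f) k = fls_const (fls_nth f k)"
  unfolding fls_outer_def by (rule nth_Abs_fls_lower_bound[of "fls_subdegree f"]) simp

lemma subst_ser_eq: "subst_ser c f = fls_rescale c (fps_to_fls f)"
proof (rule fls_eqI)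
  fix k show "fls_nth (subst_ser c f) k = fls_nth (fls_rescale c (fps_to_fls f)) k"
    by (cases "k \<ge> 0") (simp_all add: subst_ser_def power_int_def)
qed

lemma outer_ser_eq: "outer_ser f = fls_outer (fps_to_fls f)"
  by (rule fls_eqI) (auto simp: outer_ser_def)

text \<open>\<open>specializes c c' D E\<close>: the series \<open>E\<close> arises from \<open>D\<close> by giving the inner variable the value
  $cX$ and the outer one the value $c'X$; no exponent below $-1$ occurs in the series considered.\<close>

definition specializes :: "complex \<Rightarrow> complex \<Rightarrow> free_alg fls fls \<Rightarrow> free_alg fls \<Rightarrow> bool" where
  "specializes c c' D E \<longleftrightarrow> (\<forall>k. fls_nth E k =
     (\<Sum>r\<in>{-1..k + 1}. scal (c powi r * c' powi (k - r)) * fls_nth (fls_nth D (k - r)) r))"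

lemma specializes_add: "specializes c c' D E \<Longrightarrow> specializes c c' D' E' \<Longrightarrow> specializes c c' (D + D') (E + E')"
  by (simp add: specializes_def distrib_left sum.distrib)

lemma specializes_diff: "specializes c c' D E \<Longrightarrow> specializes c c' D' E' \<Longrightarrow> specializes c c' (D - D') (E - E')"
  by (simp add: specializes_def right_diff_distrib sum_subtractf)

lemma specializes_scal:
  assumes "specializes c c' D E"
  shows "specializes c c' (fls_const (fls_const (scal a)) * D) (scal_fls a * E)"
proof -
  have "scal a * (scal b * x) = scal b * (scal a * x)" for b x
    by (simp only: mult.assoc[symmetric] scal_mult[symmetric] mult.commute)
  then show ?thesis using assms
    unfolding specializes_def scal_fls_def fls_mult_const_nth by (simp only: sum_distrib_left simp_thms)
qed

text \<open>Substitution is compatible with the product of one inner and one outer series, in either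
  order. Both exponents r and k - r are at least -1, so a coefficient of the result is a finite sum
  with r between -1 and k + 1.\<close>

lemma specializes_inner_outer:
  assumes "\<And>i. i < -1 \<Longrightarrow> fls_nth f i = 0" "\<And>i. i < -1 \<Longrightarrow> fls_nth g i = 0"
  shows "specializes c c' (fls_const f * fls_outer g) (fls_rescale c f * fls_rescale c' g)"
    and "specializes c c' (fls_outer g * fls_const f) (fls_rescale c' g * fls_rescale c f)"
proof -
  have comm: "scal a * x * (scal b * y) = scal (a * b) * (x * y)" for a b x y
  proof -
    have "scal a * x * (scal b * y) = scal a * ((x * scal b) * y)" by (simp only: mult.assoc)
    also have "x * scal b = scal b * x" by (rule scal_central[symmetric])
    finally show ?thesis by (simp only: scal_mult mult.assoc)
  qed
  have b: "\<And>i. i < -1 \<Longrightarrow> fls_nth (fls_rescale c f) i = 0" "\<And>i. i < -1 \<Longrightarrow> fls_nth (fls_rescale c' g) i = 0"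
    using assms by simp_all
  have "fls_nth (fls_rescale c f * fls_rescale c' g) k =
      (\<Sum>i\<in>{-1..k - -1}. fls_nth (fls_rescale c f) i * fls_nth (fls_rescale c' g) (k - i))" for k
    by (rule fls_times_nth_bounds[OF b])
  then show "specializes c c' (fls_const f * fls_outer g) (fls_rescale c f * fls_rescale c' g)"
    unfolding specializes_def fls_mult_const_nth fls_outer_nth fls_rescale_nth comm by (simp only: diff_minus_eq_add simp_thms)
  have "fls_nth (fls_rescale c' g * fls_rescale c f) k =
      (\<Sum>i\<in>{-1..k - -1}. fls_nth (fls_rescale c' g) i * fls_nth (fls_rescale c f) (k - i))" for k
    by (rule fls_times_nth_bounds[OF b(2) b(1)])
  moreover have "(\<Sum>i\<in>{-1..k - -1}. fls_nth (fls_rescale c' g) i * fls_nth (fls_rescale c f) (k - i)) =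
    (\<Sum>r\<in>{-1..k + 1}. scal (c powi r * c' powi (k - r)) * (fls_nth g (k - r) * fls_nth f r))" for k
    by (rule sum.reindex_bij_witness[of _ "\<lambda>i. k - i" "\<lambda>i. k - i"]) (auto simp: comm mult.commute[of "c powi _"])
  ultimately show "specializes c c' (fls_outer g * fls_const f) (fls_rescale c' g * fls_rescale c f)"
    unfolding specializes_def fls_mult_const_nth fls_outer_nth by (simp only: simp_thms)
qed

lemma specializes_in_ideal:
  assumes "specializes c c' D E" "\<And>k l. fls_nth (fls_nth D k) l \<in> uq_ideal q N"
  shows "coeffs_in q N E"
  using assms by (auto simp: specializes_def coeffs_in_def intro!: uq_ideal_sum uq_ideal_lmult)

definition mk2 :: "nat \<Rightarrow> nat \<Rightarrow> nat \<Rightarrow> nat" where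
  "mk2 x y = (\<lambda>k. if k = 1 then x else if k = 2 then y else undefined)"

lemma mk2_simps [simp]: "mk2 x y 1 = x" "mk2 x y (Suc 0) = x" "mk2 x y 2 = y"
  by (simp_all add: mk2_def)

lemma one_to_two: "{1..2} = {1, 2::nat}"
  by auto

lemma mk2_in: "x \<in> {1..N} \<Longrightarrow> y \<in> {1..N} \<Longrightarrow> mk2 x y \<in> multi_idx N 2"
  by (auto simp: multi_idx_def one_to_two mk2_def PiE_def extensional_def)

lemma sum_multi_idx_2: "(\<Sum>b\<in>multi_idx N 2. f b) = (\<Sum>x\<in>{1..N}. \<Sum>y\<in>{1..N}. f (mk2 x y))"
proof -
  have "(\<Sum>b\<in>multi_idx N 2. f b) = (\<Sum>(x, y)\<in>{1..N} \<times> {1..N}. f (mk2 x y))"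
  proof (rule sum.reindex_bij_witness[of _ "\<lambda>(x, y). mk2 x y" "\<lambda>b. (b 1, b 2)"])
    fix b assume b: "b \<in> multi_idx N 2"
    then show "(b 1, b 2) \<in> {1..N} \<times> {1..N}" by (auto simp: multi_idx_def one_to_two PiE_def)
    have "mk2 (b 1) (b 2) = b"
      using b by (auto simp: multi_idx_def one_to_two mk2_def PiE_def extensional_def fun_eq_iff)
    then show "(case (b 1, b 2) of (x, y) \<Rightarrow> mk2 x y) = b" "(case (b 1, b 2) of (x, y) \<Rightarrow> f (mk2 x y)) = f b" by simp_all
  next
    fix p assume "p \<in> {1..N} \<times> {1..N}"
    then show "(case p of (x, y) \<Rightarrow> mk2 x y) \<in> multi_idx N 2" by (auto intro: mk2_in)
    show "((case p of (x, y) \<Rightarrow> mk2 x y) 1, (case p of (x, y) \<Rightarrow> mk2 x y) 2) = p" by (simp add: case_prod_beta)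
  qed
  then show ?thesis by (simp add: sum.cartesian_product)
qed

definition RD :: "'b::ring_1 \<Rightarrow> 'b \<Rightarrow> 'b \<Rightarrow> 'b \<Rightarrow> nat \<Rightarrow> nat \<Rightarrow> 'b" where
  "RD Q Q' u v a b = (if a = b then Q' * u - Q * v else u - v)"

definition RO :: "'b::ring_1 \<Rightarrow> 'b \<Rightarrow> 'b \<Rightarrow> 'b \<Rightarrow> nat \<Rightarrow> nat \<Rightarrow> 'b" where
  "RO Q Q' u v a b = (if a = b then 0 else if b < a then (Q' - Q) * u else (Q' - Q) * v)"

lemma R_mat_row_sum:
  assumes "a \<in> {1..N}" "b \<in> {1..N}"
  shows "(\<Sum>x\<in>{1..N}. \<Sum>y\<in>{1..N}. R_mat Q Q' u v a x b y * G x y) = RD Q Q' u v a b * G a b + RO Q Q' u v a b * G b a"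
proof -
  have "(\<Sum>x\<in>{1..N}. \<Sum>y\<in>{1..N}. R_mat Q Q' u v a x b y * G x y) =
    (\<Sum>x\<in>{1..N}. \<Sum>y\<in>{1..N}. (if x = a then if y = b then RD Q Q' u v a b * G a b else 0 else 0)
      + (if x = b then if y = a then RO Q Q' u v a b * G b a else 0 else 0))"
    by (intro sum.cong refl) (auto simp: R_mat_def RD_def RO_def distrib_right)
  then show ?thesis using assms
    by (simp only: sum.distrib sum_delta2[OF finite_atLeastAtMost finite_atLeastAtMost] simp_thms if_True)
qed

lemma R_mat_col_sum:
  assumes "c \<in> {1..N}" "d \<in> {1..N}"
  shows "(\<Sum>x\<in>{1..N}. \<Sum>y\<in>{1..N}. G x y * R_mat Q Q' u v x c y d) = G c d * RD Q Q' u v c d + G d c * RO Q Q' u v d c"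
proof -
  have "(\<Sum>x\<in>{1..N}. \<Sum>y\<in>{1..N}. G x y * R_mat Q Q' u v x c y d) =
    (\<Sum>x\<in>{1..N}. \<Sum>y\<in>{1..N}. (if x = c then if y = d then G c d * RD Q Q' u v c d else 0 else 0)
      + (if x = d then if y = c then G d c * RO Q Q' u v d c else 0 else 0))"
    by (intro sum.cong refl) (auto simp: R_mat_def RD_def RO_def distrib_left)
  then show ?thesis using assms
    by (simp only: sum.distrib sum_delta2[OF finite_atLeastAtMost finite_atLeastAtMost] simp_thms if_True)
qed

lemma in_copy_mk2:
  "in_copy 2 1 M (mk2 x y) (mk2 x' y') = (if y = y' then M x x' else 0)"
  "in_copy 2 2 M (mk2 x y) (mk2 x' y') = (if x = x' then M y y' else 0)"
  "in_copies 2 1 2 M' (mk2 x y) (mk2 x' y') = M' x x' y y'"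
proof -
  have "{1..2} - {1} = {2::nat}" "{1..2} - {2} = {1::nat}" "{1..2} - {1, 2} = ({}::nat set)" by auto
  then show "in_copy 2 1 M (mk2 x y) (mk2 x' y') = (if y = y' then M x x' else 0)"
    "in_copy 2 2 M (mk2 x y) (mk2 x' y') = (if x = x' then M y y' else 0)"
    "in_copies 2 1 2 M' (mk2 x y) (mk2 x' y') = M' x x' y y'"
    by (simp_all add: in_copy_def in_copies_def)
qed

lemma op_mult_mk2: "op_mult N 2 A B (mk2 x y) c = (\<Sum>z\<in>{1..N}. \<Sum>w\<in>{1..N}. A (mk2 x y) (mk2 z w) * B (mk2 z w) c)"
  by (simp add: op_mult_def sum_multi_idx_2)

lemma op_mult_one: 
  assumes "c \<in> multi_idx N m" "finite (multi_idx N m)"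
  shows "op_mult N m A op_one a c = A a c"
proof -
  have "(\<Sum>b\<in>multi_idx N m. A a b * (if b = c then 1 else 0)) = (\<Sum>b\<in>multi_idx N m. if b = c then A a c else 0)"
    by (rule sum.cong) auto
  also have "\<dots> = A a c" using assms by (simp only: sum.delta if_True)
  finally show ?thesis by (simp only: op_mult_def op_one_def)
qed

lemma finite_multi_idx: "finite (multi_idx N m)"
  unfolding multi_idx_def by (rule finite_PiE) auto

lemma op_mult_A1_B2:
  assumes "a \<in> {1..N}" "b \<in> {1..N}" "c \<in> {1..N}" "d \<in> {1..N}"
  shows "op_mult N 2 (in_copy 2 1 A) (in_copy 2 2 B) (mk2 a b) (mk2 c d) = A a c * B b d"
    and "op_mult N 2 (in_copy 2 2 B) (in_copy 2 1 A) (mk2 a b) (mk2 c d) = B b d * A a c"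
proof -
  have "op_mult N 2 (in_copy 2 1 A) (in_copy 2 2 B) (mk2 a b) (mk2 c d) =
    (\<Sum>z\<in>{1..N}. \<Sum>w\<in>{1..N}. if z = c then if w = b then A a c * B b d else 0 else 0)"
    unfolding op_mult_mk2 in_copy_mk2 by (intro sum.cong refl) auto
  then show "op_mult N 2 (in_copy 2 1 A) (in_copy 2 2 B) (mk2 a b) (mk2 c d) = A a c * B b d"
    using assms by (simp only: sum_delta2[OF finite_atLeastAtMost finite_atLeastAtMost] simp_thms if_True)
  have "op_mult N 2 (in_copy 2 2 B) (in_copy 2 1 A) (mk2 a b) (mk2 c d) =
    (\<Sum>z\<in>{1..N}. \<Sum>w\<in>{1..N}. if z = a then if w = d then B b d * A a c else 0 else 0)"
    unfolding op_mult_mk2 in_copy_mk2 by (intro sum.cong refl) auto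
  then show "op_mult N 2 (in_copy 2 2 B) (in_copy 2 1 A) (mk2 a b) (mk2 c d) = B b d * A a c"
    using assms by (simp only: sum_delta2[OF finite_atLeastAtMost finite_atLeastAtMost] simp_thms if_True)
qed

lemma op_mult_assoc: "op_mult N m (op_mult N m A B) C = op_mult N m A (op_mult N m B C)"
proof (intro ext)
  fix a c
  have "op_mult N m (op_mult N m A B) C a c = (\<Sum>x\<in>multi_idx N m. \<Sum>y\<in>multi_idx N m. A a y * (B y x * C x c))"
    by (simp add: op_mult_def sum_distrib_right mult.assoc)
  also have "\<dots> = (\<Sum>y\<in>multi_idx N m. \<Sum>x\<in>multi_idx N m. A a y * (B y x * C x c))" by (rule sum.swap)
  also have "\<dots> = op_mult N m A (op_mult N m B C) a c" by (simp add: op_mult_def sum_distrib_left)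
  finally show "op_mult N m (op_mult N m A B) C a c = op_mult N m A (op_mult N m B C) a c" .
qed

text \<open>Each row and each column of R has at most two nonzero entries, so both triple products
  collapse to the two-term sums of \<open>rtt_rel\<close>.\<close>

lemma RTT_defect_entry:
  fixes q :: complex
  assumes "a \<in> {1..N}" "b \<in> {1..N}" "c \<in> {1..N}" "d \<in> {1..N}"
  defines "Q \<equiv> fls_const (fls_const (scal q))" and "Q' \<equiv> fls_const (fls_const (scal (inverse q)))"
  shows "RTT_defect q N u v A B (mk2 a b) (mk2 c d) =
      RD Q Q' u v a b * (inner_ser (A a c) * outer_ser (B b d)) + RO Q Q' u v a b * (inner_ser (A b c) * outer_ser (B a d))
    - (outer_ser (B b d) * inner_ser (A a c) * RD Q Q' u v c d + outer_ser (B b c) * inner_ser (A a d) * RO Q Q' u v d c)"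
proof -
  let ?R = "in_copies 2 1 2 (R_mat Q Q' u v)"
  let ?A = "in_copy 2 1 (\<lambda>i j. inner_ser (A i j))" and ?B = "in_copy 2 2 (\<lambda>i j. outer_ser (B i j))"
  have cd: "mk2 c d \<in> multi_idx N 2" by (rule mk2_in[OF assms(3,4)])
  have "op_prod N 2 [?R, ?A, ?B] (mk2 a b) (mk2 c d) = op_mult N 2 (op_mult N 2 ?R (op_mult N 2 ?A ?B)) op_one (mk2 a b) (mk2 c d)"
    by (simp add: op_prod_def op_mult_assoc)
  also have "\<dots> = op_mult N 2 ?R (op_mult N 2 ?A ?B) (mk2 a b) (mk2 c d)"
    by (rule op_mult_one[OF cd finite_multi_idx])
  also have "\<dots> = (\<Sum>x\<in>{1..N}. \<Sum>y\<in>{1..N}. R_mat Q Q' u v a x b y * (inner_ser (A x c) * outer_ser (B y d)))"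
    unfolding op_mult_mk2[of N ?R] in_copy_mk2(3) using assms(3,4) by (intro sum.cong refl) (simp only: op_mult_A1_B2(1))
  also have "\<dots> = RD Q Q' u v a b * (inner_ser (A a c) * outer_ser (B b d)) + RO Q Q' u v a b * (inner_ser (A b c) * outer_ser (B a d))"
    by (rule R_mat_row_sum[OF assms(1,2)])
  finally have 1: "op_prod N 2 [?R, ?A, ?B] (mk2 a b) (mk2 c d) =
    RD Q Q' u v a b * (inner_ser (A a c) * outer_ser (B b d)) + RO Q Q' u v a b * (inner_ser (A b c) * outer_ser (B a d))" .
  have "op_prod N 2 [?B, ?A, ?R] (mk2 a b) (mk2 c d) = op_mult N 2 (op_mult N 2 (op_mult N 2 ?B ?A) ?R) op_one (mk2 a b) (mk2 c d)"
    by (simp add: op_prod_def op_mult_assoc)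
  also have "\<dots> = op_mult N 2 (op_mult N 2 ?B ?A) ?R (mk2 a b) (mk2 c d)"
    by (rule op_mult_one[OF cd finite_multi_idx])
  also have "\<dots> = (\<Sum>x\<in>{1..N}. \<Sum>y\<in>{1..N}. (outer_ser (B b y) * inner_ser (A a x)) * R_mat Q Q' u v x c y d)"
    unfolding op_mult_mk2[of N "op_mult N 2 ?B ?A"] in_copy_mk2(3) using assms(1,2) by (intro sum.cong refl) (simp only: op_mult_A1_B2(2))
  also have "\<dots> = outer_ser (B b d) * inner_ser (A a c) * RD Q Q' u v c d + outer_ser (B b c) * inner_ser (A a d) * RO Q Q' u v d c"
    by (rule R_mat_col_sum[OF assms(3,4)])
  finally have 2: "op_prod N 2 [?B, ?A, ?R] (mk2 a b) (mk2 c d) =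
    outer_ser (B b d) * inner_ser (A a c) * RD Q Q' u v c d + outer_ser (B b c) * inner_ser (A a d) * RO Q Q' u v d c" .
  show ?thesis unfolding RTT_defect_def Let_def using 1 2 unfolding Q_def Q'_def by (simp only:)
qed

abbreviation scal2 :: "complex \<Rightarrow> free_alg fls fls" where
  "scal2 a \<equiv> fls_const (fls_const (scal a))"

lemma scal2_central: "scal2 a * Z = Z * scal2 a"
  by (intro fls_eqI) (simp add: scal_central)

lemma scal2_add: "scal2 (a + b) = scal2 a + scal2 b"
  by (intro fls_eqI) (simp add: scal_add)

lemma scal2_minus: "scal2 (- a) = - scal2 a"
  using scal2_add[of a "- a"] by (simp add: eq_neg_iff_add_eq_0 add.commute)

lemma fls_const_fls_X_inv_central: "fls_const fls_X_inv * (Z :: free_alg fls fls) = Z * fls_const fls_X_inv"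
  and fls_const_fls_X_central: "fls_const fls_X * (Z :: free_alg fls fls) = Z * fls_const fls_X"
  by (intro fls_eqI; simp add: fls_X_inv_times_conv_shift fls_X_times_conv_shift)+

lemma fls_const_minus: "fls_const (- (a::'a::ab_group_add)) = - fls_const a"
  by (rule fls_eqI) simp

text \<open>The same complex coefficients serve for the formal variables and for their values;
  linearity is all that specialization has to know about R.\<close>

lemma RD_linear: "\<exists>\<alpha> \<beta>. RD (scal2 q) (scal2 (inverse q)) u v a b = scal2 \<alpha> * u + scal2 \<beta> * v \<and>
   rdiag (fls_const q) U V a b = fls_const \<alpha> * U + fls_const \<beta> * V"
proof (cases "a = b")
  case True
  have "RD (scal2 q) (scal2 (inverse q)) u v a b = scal2 (inverse q) * u + scal2 (- q) * v"
    unfolding RD_def scal2_minus using True by (simp only: simp_thms if_True mult_minus_left add_uminus_conv_diff)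
  moreover have "rdiag (fls_const q) U V a b = fls_const (inverse q) * U + fls_const (- q) * V"
    unfolding rdiag_def fls_const_minus fls_inverse_const using True by (simp only: simp_thms if_True mult_minus_left add_uminus_conv_diff)
  ultimately show ?thesis by blast
next
  case False
  have "RD (scal2 q) (scal2 (inverse q)) u v a b = scal2 1 * u + scal2 (- 1) * v"
    unfolding RD_def scal2_minus using False by (simp add: scal_1)
  moreover have "rdiag (fls_const q) U V a b = fls_const 1 * U + fls_const (- 1) * V"
    unfolding rdiag_def fls_const_minus using False by simp
  ultimately show ?thesis by blast
qed

lemma RO_linear: "\<exists>\<alpha> \<beta>. RO (scal2 q) (scal2 (inverse q)) u v a b = scal2 \<alpha> * u + scal2 \<beta> * v \<and>
   roff (fls_const q) U V a b = fls_const \<alpha> * U + fls_const \<beta> * V"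
proof -
  have s: "scal2 (inverse q - q) = scal2 (inverse q) - scal2 q"
    by (intro fls_eqI) (simp add: scal_diff)
  have c: "fls_const (inverse q - q) = inverse (fls_const q) - fls_const q"
    unfolding fls_inverse_const by (intro fls_eqI) simp
  have z: "scal2 0 = 0" by simp
  consider "a = b" | "b < a" | "a < b" by linarith
  then show ?thesis
  proof cases
    case 1
    then have "RO (scal2 q) (scal2 (inverse q)) u v a b = scal2 0 * u + scal2 0 * v"
      "roff (fls_const q) U V a b = fls_const 0 * U + fls_const 0 * V"
      by (simp_all add: RO_def roff_def)
    then show ?thesis by blast
  next
    case 2
    then have "RO (scal2 q) (scal2 (inverse q)) u v a b = scal2 (inverse q - q) * u + scal2 0 * v"
      unfolding RO_def s z by simp
    moreover have "roff (fls_const q) U V a b = fls_const (inverse q - q) * U + fls_const 0 * V"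
      using 2 unfolding roff_def c by simp
    ultimately show ?thesis by blast
  next
    case 3
    then have "RO (scal2 q) (scal2 (inverse q)) u v a b = scal2 0 * u + scal2 (inverse q - q) * v"
      unfolding RO_def s z by simp
    moreover have "roff (fls_const q) U V a b = fls_const 0 * U + fls_const (inverse q - q) * V"
      using 3 unfolding roff_def c by simp
    ultimately show ?thesis by blast
  qed
qed

text \<open>In the applications \<xi> and \<eta> are the series variable or its inverse.
  Multiplication by u or v before the specialization becomes multiplication by the scalar
  \<open>U\<close> or \<open>V\<close> after it.\<close>

lemma specializes_linear:
  fixes f g :: "free_alg fls"
  assumes u: "u = fls_const \<xi>" and uc: "\<And>Z. u * Z = Z * u" and vc: "\<And>Z. v * Z = Z * v"
    and vo: "\<And>h. v * fls_outer h = fls_outer (\<eta> * h)"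
    and U: "\<And>h. fls_scal U * fls_rescale c h = fls_rescale c (\<xi> * h)"
    and V: "\<And>h. fls_scal V * fls_rescale c' h = fls_rescale c' (\<eta> * h)"
    and b: "\<And>i. i < -1 \<Longrightarrow> fls_nth f i = 0" "\<And>i. i < -1 \<Longrightarrow> fls_nth g i = 0"
      "\<And>i. i < -1 \<Longrightarrow> fls_nth (\<xi> * f) i = 0" "\<And>i. i < -1 \<Longrightarrow> fls_nth (\<eta> * g) i = 0"
  shows "specializes c c' ((scal2 \<alpha> * u + scal2 \<beta> * v) * (fls_const f * fls_outer g))
      (fls_scal (fls_const \<alpha> * U + fls_const \<beta> * V) * (fls_rescale c f * fls_rescale c' g))" (is ?A)
    and "specializes c c' (fls_outer g * fls_const f * (scal2 \<alpha> * u + scal2 \<beta> * v))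
      (fls_scal (fls_const \<alpha> * U + fls_const \<beta> * V) * (fls_rescale c' g * fls_rescale c f))" (is ?B)
proof -
  let ?F = "fls_rescale c f" and ?G = "fls_rescale c' g"
  have L: "(scal2 \<alpha> * u + scal2 \<beta> * v) * Z = scal2 \<alpha> * (u * Z) + scal2 \<beta> * (v * Z)" for Z
    by (simp only: distrib_right mult.assoc)
  have R: "Z * (scal2 \<alpha> * u + scal2 \<beta> * v) = scal2 \<alpha> * (u * Z) + scal2 \<beta> * (v * Z)" for Z
  proof -
    have "Z * (scal2 \<alpha> * u + scal2 \<beta> * v) = (Z * scal2 \<alpha>) * u + (Z * scal2 \<beta>) * v"
      by (simp only: distrib_left mult.assoc)
    also have "\<dots> = scal2 \<alpha> * (Z * u) + scal2 \<beta> * (Z * v)"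
      by (simp only: scal2_central[symmetric, of Z] mult.assoc)
    finally show ?thesis by (simp only: uc[of Z] vc[of Z])
  qed
  have S: "fls_scal (fls_const \<alpha> * U + fls_const \<beta> * V) * W = scal_fls \<alpha> * (fls_scal U * W) + scal_fls \<beta> * (fls_scal V * W)" for W
    by (simp only: fls_scal_add fls_scal_mult fls_scal_const distrib_right mult.assoc)
  have 1: "u * (fls_const f * fls_outer g) = fls_const (\<xi> * f) * fls_outer g"
    by (simp only: u mult.assoc[symmetric] fls_const_mult_const)
  have 2: "v * (fls_const f * fls_outer g) = fls_const f * fls_outer (\<eta> * g)"
    by (simp only: vo[symmetric] mult.assoc[symmetric] vc[of "fls_const f"])
  have 3: "u * (fls_outer g * fls_const f) = fls_outer g * fls_const (\<xi> * f)"
  proof -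
    have "u * (fls_outer g * fls_const f) = (u * fls_outer g) * fls_const f" by (simp only: mult.assoc)
    also have "u * fls_outer g = fls_outer g * u" by (rule uc)
    also have "fls_outer g * u * fls_const f = fls_outer g * (fls_const \<xi> * fls_const f)" by (simp only: mult.assoc u)
    finally show ?thesis by (simp only: fls_const_mult_const)
  qed
  have 4: "v * (fls_outer g * fls_const f) = fls_outer (\<eta> * g) * fls_const f"
    by (simp only: vo[symmetric] mult.assoc)
  have 5: "fls_scal U * (?F * ?G) = fls_rescale c (\<xi> * f) * ?G" "fls_scal V * (?G * ?F) = fls_rescale c' (\<eta> * g) * ?F"
    by (simp_all only: U[symmetric] V[symmetric] mult.assoc)
  have 6: "fls_scal V * (?F * ?G) = ?F * fls_rescale c' (\<eta> * g)" "fls_scal U * (?G * ?F) = ?G * fls_rescale c (\<xi> * f)"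
  proof -
    have "fls_scal V * (?F * ?G) = (fls_scal V * ?F) * ?G" by (simp only: mult.assoc)
    then show "fls_scal V * (?F * ?G) = ?F * fls_rescale c' (\<eta> * g)"
      by (simp only: fls_scal_central[of V ?F] mult.assoc V)
    have "fls_scal U * (?G * ?F) = (fls_scal U * ?G) * ?F" by (simp only: mult.assoc)
    then show "fls_scal U * (?G * ?F) = ?G * fls_rescale c (\<xi> * f)"
      by (simp only: fls_scal_central[of U ?G] mult.assoc U)
  qed
  show ?A unfolding L S 1 2 5 6
    by (intro specializes_add specializes_scal specializes_inner_outer(1)) (rule b, assumption)+
  show ?B unfolding R S 3 4 5 6
    by (intro specializes_add specializes_scal specializes_inner_outer(2)) (rule b, assumption)+
qed

text \<open>The coefficients of the defect lie in the ideal, and each coefficient of its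
  specialization is a finite combination of them. If an index lies outside {1..N}, all terms
  vanish.\<close>

lemma rtt_rel_iota:
  fixes q :: complex
  assumes u: "u = fls_const \<xi>" and uc: "\<And>Z. u * Z = Z * u" and vc: "\<And>Z. v * Z = Z * v"
    and vo: "\<And>h. v * fls_outer h = fls_outer (\<eta> * h)"
    and U: "\<And>h. fls_scal U * fls_rescale c h = fls_rescale c (\<xi> * h)"
    and V: "\<And>h. fls_scal V * fls_rescale c' h = fls_rescale c' (\<eta> * h)"
    and \<xi>: "\<And>h i. i < -1 \<Longrightarrow> fls_nth (\<xi> * fps_to_fls h) i = 0"
    and \<eta>: "\<And>h i. i < -1 \<Longrightarrow> fls_nth (\<eta> * fps_to_fls h) i = 0"
    and ideal: "\<And>x. x \<in> coeffs2 N (RTT_defect q N u v A B) \<Longrightarrow> x \<in> uq_ideal q N"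
    and A0: "\<And>x y. x \<notin> {1..N} \<or> y \<notin> {1..N} \<Longrightarrow> iota q N (subst_ser c (A x y)) = 0"
    and B0: "\<And>x y. x \<notin> {1..N} \<or> y \<notin> {1..N} \<Longrightarrow> iota q N (subst_ser c' (B x y)) = 0"
  shows "rtt_rel scu (fls_const q) U V (\<lambda>x y. iota q N (subst_ser c (A x y))) (\<lambda>x y. iota q N (subst_ser c' (B x y)))"
  unfolding rtt_rel_def
proof (intro allI)
  fix a b x y :: nat
  let ?F = "\<lambda>x y. fls_rescale c (fps_to_fls (A x y))" and ?G = "\<lambda>x y. fls_rescale c' (fps_to_fls (B x y))"
  let ?d = "\<lambda>a b. rdiag (fls_const q) U V a b" and ?o = "\<lambda>a b. roff (fls_const q) U V a b"
  show "scu (?d a b) * (iota q N (subst_ser c (A a x)) * iota q N (subst_ser c' (B b y))) +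
      scu (?o a b) * (iota q N (subst_ser c (A b x)) * iota q N (subst_ser c' (B a y))) =
      scu (?d x y) * (iota q N (subst_ser c' (B b y)) * iota q N (subst_ser c (A a x))) +
      scu (?o y x) * (iota q N (subst_ser c' (B b x)) * iota q N (subst_ser c (A a y)))"
  proof (cases "a \<in> {1..N} \<and> b \<in> {1..N} \<and> x \<in> {1..N} \<and> y \<in> {1..N}")
    case False
    then have "iota q N (subst_ser c (A a x)) = 0 \<or> iota q N (subst_ser c' (B b y)) = 0"
      "iota q N (subst_ser c (A b x)) = 0 \<or> iota q N (subst_ser c' (B a y)) = 0"
      "iota q N (subst_ser c' (B b x)) = 0 \<or> iota q N (subst_ser c (A a y)) = 0"
      using A0[of a x] B0[of b y] A0[of b x] B0[of a y] B0[of b x] A0[of a y] by blast+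
    then have "iota q N (subst_ser c (A a x)) * iota q N (subst_ser c' (B b y)) = 0"
      "iota q N (subst_ser c (A b x)) * iota q N (subst_ser c' (B a y)) = 0"
      "iota q N (subst_ser c' (B b y)) * iota q N (subst_ser c (A a x)) = 0"
      "iota q N (subst_ser c' (B b x)) * iota q N (subst_ser c (A a y)) = 0" by auto
    then show ?thesis by (simp only: mult_zero_right)
  next
    case True
    then have r: "a \<in> {1..N}" "b \<in> {1..N}" "x \<in> {1..N}" "y \<in> {1..N}" by blast+
    have bd: "\<And>h i. i < -1 \<Longrightarrow> fls_nth (fps_to_fls (h :: free_alg fps)) i = 0" by simp
    note sp = specializes_linear[OF u uc vc vo U V bd bd \<xi> \<eta>]
    obtain \<alpha>1 \<beta>1 where 1: "RD (scal2 q) (scal2 (inverse q)) u v a b = scal2 \<alpha>1 * u + scal2 \<beta>1 * v" "?d a b = fls_const \<alpha>1 * U + fls_const \<beta>1 * V"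
      using RD_linear by blast
    obtain \<alpha>2 \<beta>2 where 2: "RO (scal2 q) (scal2 (inverse q)) u v a b = scal2 \<alpha>2 * u + scal2 \<beta>2 * v" "?o a b = fls_const \<alpha>2 * U + fls_const \<beta>2 * V"
      using RO_linear by blast
    obtain \<alpha>3 \<beta>3 where 3: "RD (scal2 q) (scal2 (inverse q)) u v x y = scal2 \<alpha>3 * u + scal2 \<beta>3 * v" "?d x y = fls_const \<alpha>3 * U + fls_const \<beta>3 * V"
      using RD_linear by blast
    obtain \<alpha>4 \<beta>4 where 4: "RO (scal2 q) (scal2 (inverse q)) u v y x = scal2 \<alpha>4 * u + scal2 \<beta>4 * v" "?o y x = fls_const \<alpha>4 * U + fls_const \<beta>4 * V"
      using RO_linear by blast
    define E where "E = fls_scal (?d a b) * (?F a x * ?G b y) + fls_scal (?o a b) * (?F b x * ?G a y)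
      - (fls_scal (?d x y) * (?G b y * ?F a x) + fls_scal (?o y x) * (?G b x * ?F a y))"
    have "specializes c c' (RTT_defect q N u v A B (mk2 a b) (mk2 x y)) E"
      unfolding RTT_defect_entry[OF r] E_def inner_ser_def outer_ser_eq 1 2 3 4
      by (intro specializes_diff specializes_add sp)
    then have "coeffs_in q N E"
    proof (rule specializes_in_ideal)
      fix k l
      show "fls_nth (fls_nth (RTT_defect q N u v A B (mk2 a b) (mk2 x y)) k) l \<in> uq_ideal q N"
        by (rule ideal) (use mk2_in[OF r(1,2)] mk2_in[OF r(3,4)] in \<open>auto simp: coeffs2_def\<close>)
    qed
    then have "iota q N (fls_scal (?d a b) * (?F a x * ?G b y) + fls_scal (?o a b) * (?F b x * ?G a y)) =
      iota q N (fls_scal (?d x y) * (?G b y * ?F a x) + fls_scal (?o y x) * (?G b x * ?F a y))"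
      unfolding iota_eq_iff E_def .
    then show ?thesis
      unfolding iota_add iota_scal_left subst_ser_eq unfolding iota_mult .
  qed
qed

text \<open>The parameter u_i = q^{2-2i} u, in the field of Laurent series with variable
  u^{-1}.\<close>

definition uu :: "complex \<Rightarrow> nat \<Rightarrow> complex fls" where
  "uu q i = fls_const (q powi (2 - 2 * int i)) * fls_X_inv"

abbreviation (input) qpos :: "complex \<Rightarrow> nat \<Rightarrow> complex" where
  "qpos q i \<equiv> q powi (2 * int i - 2)"

text \<open>T(u_i) and T-bar(u_i^{-1}) are both power series in u_i^{-1} = q^{2i-2} u^{-1}, hence
  the same substitution in \<open>tL\<close> and \<open>tbL\<close>.\<close>

definition tL :: "complex \<Rightarrow> nat \<Rightarrow> nat \<Rightarrow> nat \<Rightarrow> nat \<Rightarrow> ul" where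
  "tL q N i a b = iota q N (subst_ser (qpos q i) (t_ser a b))"

definition tbL :: "complex \<Rightarrow> nat \<Rightarrow> nat \<Rightarrow> nat \<Rightarrow> nat \<Rightarrow> ul" where
  "tbL q N i a b = iota q N (subst_ser (qpos q i) (tbar_ser a b))"

lemma qpos_inverse: "q powi (2 - 2 * int i) = inverse (qpos q i)"
  by (simp add: power_int_minus[symmetric])

lemma inverse_uu: "q \<noteq> 0 \<Longrightarrow> inverse (uu q i) = fls_const (qpos q i) * fls_X"
  by (simp add: uu_def fls_inverse_X_inv fls_inverse_const qpos_inverse)

lemma uu_rescale:
  assumes "q \<noteq> 0"
  shows "fls_scal (uu q i) * fls_rescale (qpos q i) h = fls_rescale (qpos q i) (fls_X_inv * h)"
    and "fls_scal (inverse (uu q i)) * fls_rescale (qpos q i) h = fls_rescale (qpos q i) (fls_X * h)"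
proof -
  let ?c = "qpos q i"
  have c: "?c \<noteq> 0" using assms by simp
  have p: "inverse ?c * ?c powi (k + 1) = ?c powi k" "?c * ?c powi (k - 1) = ?c powi k" for k
    using c by (simp_all add: power_int_add power_int_diff)
  show "fls_scal (uu q i) * fls_rescale ?c h = fls_rescale ?c (fls_X_inv * h)"
  proof (rule fls_eqI)
    fix k
    have "fls_nth (fls_scal (uu q i) * fls_rescale ?c h) k = scal (inverse ?c) * (scal (?c powi (k + 1)) * fls_nth h (k + 1))"
      unfolding uu_def qpos_inverse fls_scal_mult fls_scal_const fls_scal_X_inv scal_fls_def mult.assoc
      by (simp only: fls_mult_const_nth fls_X_inv_times_conv_shift fls_shift_nth fls_rescale_nth)
    also have "\<dots> = fls_nth (fls_rescale ?c (fls_X_inv * h)) k"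
      by (simp only: mult.assoc[symmetric] scal_mult[symmetric] p fls_rescale_nth fls_X_inv_times_conv_shift fls_shift_nth)
    finally show "fls_nth (fls_scal (uu q i) * fls_rescale ?c h) k = fls_nth (fls_rescale ?c (fls_X_inv * h)) k" .
  qed
  show "fls_scal (inverse (uu q i)) * fls_rescale ?c h = fls_rescale ?c (fls_X * h)"
  proof (rule fls_eqI)
    fix k
    have "fls_nth (fls_scal (inverse (uu q i)) * fls_rescale ?c h) k = scal ?c * (scal (?c powi (k + - 1)) * fls_nth h (k + - 1))"
      unfolding inverse_uu[OF assms] fls_scal_mult fls_scal_const fls_scal_X scal_fls_def mult.assoc
      by (simp only: fls_mult_const_nth fls_X_times_conv_shift fls_shift_nth fls_rescale_nth)
    also have "\<dots> = fls_nth (fls_rescale ?c (fls_X * h)) k"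
      by (simp only: mult.assoc[symmetric] scal_mult[symmetric] p fls_rescale_nth fls_X_times_conv_shift fls_shift_nth add_uminus_conv_diff)
    finally show "fls_nth (fls_scal (inverse (uu q i)) * fls_rescale ?c h) k = fls_nth (fls_rescale ?c (fls_X * h)) k" .
  qed
qed

lemma tL_out: "a \<notin> {1..N} \<or> b \<notin> {1..N} \<Longrightarrow> tL q N i a b = 0"
  and tbL_out: "a \<notin> {1..N} \<or> b \<notin> {1..N} \<Longrightarrow> tbL q N i a b = 0"
proof -
  assume o: "a \<notin> {1..N} \<or> b \<notin> {1..N}"
  have "gen (GenT a b r) \<in> uq_ideal q N" "gen (GenTbar a b r) \<in> uq_ideal q N" for r
    by (rule uq_relations_in_ideal, unfold uq_relations_def, use o in blast)+
  then have "coeffs_in q N (subst_ser (qpos q i) (t_ser a b))" "coeffs_in q N (subst_ser (qpos q i) (tbar_ser a b))"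
    by (auto simp: coeffs_in_def subst_ser_def t_ser_def tbar_ser_def uq_ideal_0 intro!: uq_ideal_lmult)
  then show "tL q N i a b = 0" "tbL q N i a b = 0" by (simp_all add: tL_def tbL_def iota_eq_0_iff)
qed

lemma fls_X_inv_outer: "fls_X_inv * fls_outer h = fls_outer (fls_X_inv * h)"
  and fls_X_outer: "fls_X * fls_outer h = fls_outer (fls_X * h)"
  by (rule fls_eqI, simp add: fls_X_inv_times_conv_shift fls_X_times_conv_shift)+

lemma fls_X_inv_bound: "i < -1 \<Longrightarrow> fls_nth (fls_X_inv * fps_to_fls (h :: free_alg fps)) i = 0"
  and fls_X_bound: "i < -1 \<Longrightarrow> fls_nth (fls_X * fps_to_fls (h :: free_alg fps)) i = 0"
  by (simp_all add: fls_X_inv_times_conv_shift fls_X_times_conv_shift)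

lemma rtt_coeffs_in_ideal:
  "x \<in> coeffs2 N (RTT_defect q N (fls_const fls_X_inv) fls_X_inv t_ser t_ser) \<Longrightarrow> x \<in> uq_ideal q N"
  "x \<in> coeffs2 N (RTT_defect q N (fls_const fls_X) fls_X tbar_ser tbar_ser) \<Longrightarrow> x \<in> uq_ideal q N"
  "x \<in> coeffs2 N (RTT_defect q N (fls_const fls_X) fls_X_inv tbar_ser t_ser) \<Longrightarrow> x \<in> uq_ideal q N"
  by (rule uq_relations_in_ideal, simp only: uq_relations_def Un_iff simp_thms)+

lemma rtt_rel_TT:
  assumes q: "q \<noteq> 0"
  shows "rtt_rel scu (fls_const q) (uu q i) (uu q j) (tL q N i) (tL q N j)"
proof -
  have "rtt_rel scu (fls_const q) (uu q i) (uu q j) (\<lambda>x y. iota q N (subst_ser (qpos q i) (t_ser x y))) (\<lambda>x y. iota q N (subst_ser (qpos q j) (t_ser x y)))"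
  proof (rule rtt_rel_iota[where u = "fls_const fls_X_inv" and v = fls_X_inv and \<xi> = fls_X_inv and \<eta> = fls_X_inv])
    show "fls_const fls_X_inv * Z = Z * fls_const fls_X_inv" for Z :: "free_alg fls fls" by (rule fls_const_fls_X_inv_central)
    show "fls_X_inv * Z = Z * fls_X_inv" for Z :: "free_alg fls fls" by (rule fls_X_inv_times_comm)
    show "fls_X_inv * fls_outer h = fls_outer (fls_X_inv * h)" for h by (rule fls_X_inv_outer)
    show "fls_scal (uu q i) * fls_rescale (qpos q i) h = fls_rescale (qpos q i) (fls_X_inv * h)" for h by (rule uu_rescale(1)[OF q])
    show "fls_scal (uu q j) * fls_rescale (qpos q j) h = fls_rescale (qpos q j) (fls_X_inv * h)" for h by (rule uu_rescale(1)[OF q])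
    show "fls_nth (fls_X_inv * fps_to_fls h) k = 0" if "k < - 1" for h :: "free_alg fps" and k by (rule fls_X_inv_bound[OF that])
    show "fls_nth (fls_X_inv * fps_to_fls h) k = 0" if "k < - 1" for h :: "free_alg fps" and k by (rule fls_X_inv_bound[OF that])
    show "x \<in> uq_ideal q N" if "x \<in> coeffs2 N (RTT_defect q N (fls_const fls_X_inv) fls_X_inv t_ser t_ser)" for x
      by (rule rtt_coeffs_in_ideal(1)[OF that])
    show "iota q N (subst_ser (qpos q i) (t_ser x y)) = 0" if "x \<notin> {1..N} \<or> y \<notin> {1..N}" for x y
      using tL_out[OF that] by (simp only: tL_def)
    show "iota q N (subst_ser (qpos q j) (t_ser x y)) = 0" if "x \<notin> {1..N} \<or> y \<notin> {1..N}" for x y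
      using tL_out[OF that] by (simp only: tL_def)
  qed (rule refl)
  then show ?thesis by (simp only: tL_def[abs_def] tL_def[abs_def])
qed

lemma rtt_rel_BB:
  assumes q: "q \<noteq> 0"
  shows "rtt_rel scu (fls_const q) (inverse (uu q i)) (inverse (uu q j)) (tbL q N i) (tbL q N j)"
proof -
  have "rtt_rel scu (fls_const q) (inverse (uu q i)) (inverse (uu q j)) (\<lambda>x y. iota q N (subst_ser (qpos q i) (tbar_ser x y))) (\<lambda>x y. iota q N (subst_ser (qpos q j) (tbar_ser x y)))"
  proof (rule rtt_rel_iota[where u = "fls_const fls_X" and v = fls_X and \<xi> = fls_X and \<eta> = fls_X])
    show "fls_const fls_X * Z = Z * fls_const fls_X" for Z :: "free_alg fls fls" by (rule fls_const_fls_X_central)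
    show "fls_X * Z = Z * fls_X" for Z :: "free_alg fls fls" by (rule fls_X_times_comm)
    show "fls_X * fls_outer h = fls_outer (fls_X * h)" for h by (rule fls_X_outer)
    show "fls_scal (inverse (uu q i)) * fls_rescale (qpos q i) h = fls_rescale (qpos q i) (fls_X * h)" for h by (rule uu_rescale(2)[OF q])
    show "fls_scal (inverse (uu q j)) * fls_rescale (qpos q j) h = fls_rescale (qpos q j) (fls_X * h)" for h by (rule uu_rescale(2)[OF q])
    show "fls_nth (fls_X * fps_to_fls h) k = 0" if "k < - 1" for h :: "free_alg fps" and k by (rule fls_X_bound[OF that])
    show "fls_nth (fls_X * fps_to_fls h) k = 0" if "k < - 1" for h :: "free_alg fps" and k by (rule fls_X_bound[OF that])
    show "x \<in> uq_ideal q N" if "x \<in> coeffs2 N (RTT_defect q N (fls_const fls_X) fls_X tbar_ser tbar_ser)" for x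
      by (rule rtt_coeffs_in_ideal(2)[OF that])
    show "iota q N (subst_ser (qpos q i) (tbar_ser x y)) = 0" if "x \<notin> {1..N} \<or> y \<notin> {1..N}" for x y
      using tbL_out[OF that] by (simp only: tbL_def)
    show "iota q N (subst_ser (qpos q j) (tbar_ser x y)) = 0" if "x \<notin> {1..N} \<or> y \<notin> {1..N}" for x y
      using tbL_out[OF that] by (simp only: tbL_def)
  qed (rule refl)
  then show ?thesis by (simp only: tbL_def[abs_def] tbL_def[abs_def])
qed

lemma rtt_rel_BT:
  assumes q: "q \<noteq> 0"
  shows "rtt_rel scu (fls_const q) (inverse (uu q i)) (uu q j) (tbL q N i) (tL q N j)"
proof -
  have "rtt_rel scu (fls_const q) (inverse (uu q i)) (uu q j) (\<lambda>x y. iota q N (subst_ser (qpos q i) (tbar_ser x y))) (\<lambda>x y. iota q N (subst_ser (qpos q j) (t_ser x y)))"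
  proof (rule rtt_rel_iota[where u = "fls_const fls_X" and v = fls_X_inv and \<xi> = fls_X and \<eta> = fls_X_inv])
    show "fls_const fls_X * Z = Z * fls_const fls_X" for Z :: "free_alg fls fls" by (rule fls_const_fls_X_central)
    show "fls_X_inv * Z = Z * fls_X_inv" for Z :: "free_alg fls fls" by (rule fls_X_inv_times_comm)
    show "fls_X_inv * fls_outer h = fls_outer (fls_X_inv * h)" for h by (rule fls_X_inv_outer)
    show "fls_scal (inverse (uu q i)) * fls_rescale (qpos q i) h = fls_rescale (qpos q i) (fls_X * h)" for h by (rule uu_rescale(2)[OF q])
    show "fls_scal (uu q j) * fls_rescale (qpos q j) h = fls_rescale (qpos q j) (fls_X_inv * h)" for h by (rule uu_rescale(1)[OF q])
    show "fls_nth (fls_X * fps_to_fls h) k = 0" if "k < - 1" for h :: "free_alg fps" and k by (rule fls_X_bound[OF that])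
    show "fls_nth (fls_X_inv * fps_to_fls h) k = 0" if "k < - 1" for h :: "free_alg fps" and k by (rule fls_X_inv_bound[OF that])
    show "x \<in> uq_ideal q N" if "x \<in> coeffs2 N (RTT_defect q N (fls_const fls_X) fls_X_inv tbar_ser t_ser)" for x
      by (rule rtt_coeffs_in_ideal(3)[OF that])
    show "iota q N (subst_ser (qpos q i) (tbar_ser x y)) = 0" if "x \<notin> {1..N} \<or> y \<notin> {1..N}" for x y
      using tbL_out[OF that] by (simp only: tbL_def)
    show "iota q N (subst_ser (qpos q j) (t_ser x y)) = 0" if "x \<notin> {1..N} \<or> y \<notin> {1..N}" for x y
      using tL_out[OF that] by (simp only: tL_def)
  qed (rule refl)
  then show ?thesis by (simp only: tbL_def[abs_def] tL_def[abs_def])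
qed

lemma uu_Suc:
  assumes q: "q \<noteq> 0"
  shows "uu q (Suc a) = uu q a / (fls_const q * fls_const q)"
proof -
  have "q powi (2 - 2 * int a) = q powi ((2 - 2 * int (Suc a)) + 2)" by simp
  also have "\<dots> = q powi (2 - 2 * int (Suc a)) * q powi 2" using q by (subst power_int_add) auto
  also have "q powi 2 = q * q" by (simp add: power2_eq_square)
  finally have "fls_const (q powi (2 - 2 * int a)) = fls_const q * fls_const q * fls_const (q powi (2 - 2 * int (Suc a)))"
    by (simp only: fls_const_mult_const mult.commute)
  then have "uu q a = (fls_const q * fls_const q) * uu q (Suc a)"
    unfolding uu_def by (simp only: mult.assoc)
  moreover have "fls_const q * fls_const q \<noteq> 0" using q by simp
  ultimately show ?thesis by (simp only: nonzero_mult_div_cancel_left not_False_eq_True)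
qed

text \<open>The inequalities hold because the inverse of u_i is a multiple of the series variable
  and u_j a multiple of its inverse, so their coefficients at exponent 1 differ; q^2 is not 1 as q
  is not a root of unity.\<close>

lemma sklyanin_op_uq:
  assumes q: "q \<noteq> 0" and nr: "\<And>k::nat. k > 0 \<Longrightarrow> q ^ k \<noteq> 1"
  shows "sklyanin_op scu (fls_const q) (uu q) N (tL q N) (tbL q N)"
proof (unfold_locales)
  show "fls_const q \<noteq> 0" using q by simp
  show "uu q i \<noteq> 0" for i using q by (simp add: uu_def)
  show "uu q (Suc a) = uu q a / (fls_const q * fls_const q)" for a by (rule uu_Suc[OF q])
  show "fls_const q * fls_const q \<noteq> 1"
  proof
    assume "fls_const q * fls_const q = 1"
    then have "fls_nth (fls_const (q * q)) 0 = fls_nth 1 0" by (simp only: fls_const_mult_const)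
    then show False using nr[of 2] by (simp add: power2_eq_square)
  qed
  show "inverse (uu q i) \<noteq> uu q j" for i j
  proof
    assume "inverse (uu q i) = uu q j"
    then have "fls_nth (fls_const (qpos q i) * fls_X) 1 = fls_nth (fls_const (q powi (2 - 2 * int j)) * fls_X_inv) 1"
      unfolding inverse_uu[OF q] unfolding uu_def by (simp only:)
    then show False using q by (simp only: fls_mult_const_nth) simp
  qed
  show "inverse (fls_const q) * inverse (uu q i) \<noteq> fls_const q * uu q j" for i j
  proof
    assume "inverse (fls_const q) * inverse (uu q i) = fls_const q * uu q j"
    then have "fls_nth (fls_const (inverse q) * (fls_const (qpos q i) * fls_X)) 1 = fls_nth (fls_const q * (fls_const (q powi (2 - 2 * int j)) * fls_X_inv)) 1"
      unfolding inverse_uu[OF q] fls_inverse_const unfolding uu_def by (simp only:)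
    then show False using q by (simp only: fls_mult_const_nth) simp
  qed
qed (rule rtt_rel_TT[OF q] rtt_rel_BB[OF q] rtt_rel_BT[OF q] tL_out tbL_out, assumption?)+

section \<open>The entries of the q-antisymmetrizer\<close>

abbreviation adj_comp :: "nat list \<Rightarrow> nat \<Rightarrow> nat" where
  "adj_comp is \<equiv> foldr (\<lambda>i \<tau>. transpose i (Suc i) \<circ> \<tau>) is id"

lemma foldr_adj: "foldr (\<lambda>i \<tau>. transpose i (Suc i) \<circ> \<tau>) is \<tau>0 = adj_comp is \<circ> \<tau>0"
  by (induction "is") (simp_all add: comp_assoc)

lemma adj_comp_snoc: "adj_comp (is @ [i]) = adj_comp is \<circ> transpose i (Suc i)"
  using foldr_adj[of "is" "transpose i (Suc i)"] by simp

lemma adj_comp_permutes: "set is \<subseteq> {1..<N} \<Longrightarrow> adj_comp is permutes {1..N}"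
proof (induction "is")
  case (Cons i "is")
  have tr: "transpose i (Suc i) permutes {1..N}" using Cons.prems by (intro permutes_swap_id) auto
  have IH: "adj_comp is permutes {1..N}" using Cons.prems by (intro Cons.IH) simp
  have e: "adj_comp (i # is) = transpose i (Suc i) \<circ> adj_comp is" by (simp only: foldr_Cons comp_apply)
  show ?case unfolding e by (rule permutes_compose[OF IH tr])
next
  case Nil
  show ?case using permutes_id[of "{1..N}"] by (simp add: id_def)
qed

lemma map_transpose:
  assumes "length xs + Suc (Suc (length ys)) = N" "map f [1..<Suc N] = xs @ x # y # ys"
  shows "map (f \<circ> transpose (Suc (length xs)) (Suc (Suc (length xs)))) [1..<Suc N] = xs @ y # x # ys"
proof (rule nth_equalityI)
  let ?i = "Suc (length xs)"
  have f: "f (Suc k) = (xs @ x # y # ys) ! k" if "k < N" for k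
  proof -
    have "(xs @ x # y # ys) ! k = map f [1..<Suc N] ! k" by (simp only: assms(2))
    also have "\<dots> = f (Suc k)" using that by (simp del: upt_Suc)
    finally show ?thesis by simp
  qed
  show "length (map (f \<circ> transpose ?i (Suc ?i)) [1..<Suc N]) = length (xs @ y # x # ys)"
    using assms(1) by (simp del: upt_Suc)
  fix k assume "k < length (map (f \<circ> transpose ?i (Suc ?i)) [1..<Suc N])"
  then have k: "k < N" by (simp del: upt_Suc)
  have lhs: "map (f \<circ> transpose ?i (Suc ?i)) [1..<Suc N] ! k = f (transpose ?i (Suc ?i) (Suc k))"
    using k by (simp del: upt_Suc)
  consider "k = length xs" | "k = ?i" | "k \<noteq> length xs" "k \<noteq> ?i" by blast
  then show "map (f \<circ> transpose ?i (Suc ?i)) [1..<Suc N] ! k = (xs @ y # x # ys) ! k"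
  proof cases
    case 1
    have "f (Suc ?i) = y" using f[of ?i] assms(1) by (simp add: nth_append)
    then show ?thesis unfolding lhs using 1 by (simp add: nth_append)
  next
    case 2
    have "f ?i = x" using f[of "length xs"] assms(1) by (simp add: nth_append)
    then show ?thesis unfolding lhs using 2 by (simp add: nth_append)
  next
    case 3
    then have tr: "transpose ?i (Suc ?i) (Suc k) = Suc k" by (simp add: transpose_def)
    have "(xs @ x # y # ys) ! k = (xs @ y # x # ys) ! k"
    proof (cases "k < length xs")
      case True
      then show ?thesis by (simp add: nth_append)
    next
      case False
      with 3 obtain m where "k = length xs + Suc (Suc m)" by (metis add_Suc_right le_neq_implies_less le_Suc_ex less_imp_Suc_add not_less Suc_leI)
      then show ?thesis by (simp add: nth_append)
    qed
    then show ?thesis unfolding lhs tr f[OF k] .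
  qed
qed

lemma mset_map_permutes:
  assumes "\<sigma> permutes {1..N}"
  shows "mset (map \<sigma> [1..<Suc N]) = mset [1..<Suc N]"
proof -
  have "inj_on \<sigma> (set [1..<Suc N])" using permutes_inj[OF assms] by (rule inj_on_subset) simp
  then have d: "distinct (map \<sigma> [1..<Suc N])" by (simp only: distinct_map distinct_upt simp_thms)
  have "set (map \<sigma> [1..<Suc N]) = set [1..<Suc N]"
    using permutes_image[OF assms] by (simp only: set_map set_upt atLeastLessThanSuc_atLeastAtMost)
  then show ?thesis using set_eq_iff_mset_eq_distinct[OF d distinct_upt] by blast
qed

text \<open>Being reachable from 1, ..., N by adjacent transpositions is a property of words that is
  invariant under adjacent exchanges, hence shared by all rearrangements.\<close>

lemma adj_comp_exists:
  assumes "\<sigma> permutes {1..N}"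
  shows "\<exists>js. set js \<subseteq> {1..<N} \<and> adj_comp js = \<sigma>"
proof -
  define g where "g xs = (\<exists>js. set js \<subseteq> {1..<N} \<and> map (adj_comp js) [1..<Suc N] = xs)" for xs
  have half: "g (xs @ y # x # ys)" if g: "g (xs @ x # y # ys)" for xs x y ys
  proof -
    from g obtain js where js: "set js \<subseteq> {1..<N}" "map (adj_comp js) [1..<Suc N] = xs @ x # y # ys"
      unfolding g_def by blast
    from arg_cong[OF js(2), of length] have l: "length xs + Suc (Suc (length ys)) = N" by (simp del: upt_Suc)
    let ?i = "Suc (length xs)"
    have "map (adj_comp (js @ [?i])) [1..<Suc N] = xs @ y # x # ys"
      unfolding adj_comp_snoc by (rule map_transpose[OF l js(2)])
    moreover have "set (js @ [?i]) \<subseteq> {1..<N}" using js(1) l by auto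
    ultimately show ?thesis unfolding g_def by blast
  qed
  then have "g (xs @ x # y # ys) = g (xs @ y # x # ys)" for xs x y ys by blast
  from adjacent_swap_invariant[of g, OF this mset_map_permutes[OF assms]]
  have "g (map \<sigma> [1..<Suc N]) = g [1..<Suc N]" .
  moreover have "g [1..<Suc N]" unfolding g_def by (rule exI[of _ "[]"]) simp
  ultimately obtain js where js: "set js \<subseteq> {1..<N}" "map (adj_comp js) [1..<Suc N] = map \<sigma> [1..<Suc N]"
    unfolding g_def by blast
  have "adj_comp js = \<sigma>"
  proof
    fix i show "adj_comp js i = \<sigma> i"
    proof (cases "i \<in> {1..N}")
      case True
      then have "i \<in> set [1..<Suc N]" by auto
      then show ?thesis using js(2) by (simp only: map_eq_conv)
    next
      case False
      then show ?thesis using permutes_not_in[OF assms False] permutes_not_in[OF adj_comp_permutes[OF js(1)] False] by simp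
    qed
  qed
  with js(1) show ?thesis by blast
qed

abbreviation inv_fun :: "nat \<Rightarrow> (nat \<Rightarrow> nat) \<Rightarrow> nat" where
  "inv_fun N a \<equiv> inv_list (map a [1..<Suc N])"

lemma multi_idx_comp:
  assumes "a \<in> multi_idx N N" "\<sigma> permutes {1..N}"
  shows "a \<circ> \<sigma> \<in> multi_idx N N"
  using assms permutes_in_image[OF assms(2)] permutes_not_in[OF assms(2)]
  by (auto simp: multi_idx_def PiE_def extensional_def Pi_def)

lemma inv_fun_transpose:
  assumes "1 \<le> i" "i < N" "a i < a (Suc i)"
  shows "inv_fun N (a \<circ> transpose i (Suc i)) = Suc (inv_fun N a)"
proof -
  obtain m where i: "i = Suc m" using assms(1) by (cases i) auto
  let ?L = "map a [1..<Suc N]"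
  define xs where "xs = take m ?L"
  define ys where "ys = drop (Suc (Suc m)) ?L"
  have m: "m < length ?L" "Suc m < length ?L" using assms i by (simp_all del: upt_Suc)
  have nth: "?L ! m = a i" "?L ! Suc m = a (Suc i)" using assms i by (simp_all del: upt_Suc)
  have eq: "?L = xs @ a i # a (Suc i) # ys"
    unfolding xs_def ys_def nth[symmetric] using m by (metis Cons_nth_drop_Suc append_take_drop_id)
  have lx: "length xs = m" using m unfolding xs_def by (simp del: upt_Suc)
  have l: "length xs + Suc (Suc (length ys)) = N" using arg_cong[OF eq, of length] by (simp del: upt_Suc)
  have "map (a \<circ> transpose i (Suc i)) [1..<Suc N] = xs @ a (Suc i) # a i # ys"
    using map_transpose[OF l eq] unfolding lx i .
  then show ?thesis unfolding eq by (simp only: inv_list_swap[OF assms(3)])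
qed

text \<open>P^q_{i,i+1} is the ordinary exchange of two tensor factors conjugated by the diagonal
  matrix with entries q^inv: exchanging distinct neighbours changes the number of inversions by one,
  in the direction that yields q or 1/q.\<close>

lemma Pq_mat_entry:
  fixes q :: complex
  assumes i: "i \<in> {1..<N}" and a: "a \<in> multi_idx N N" and b: "b \<in> multi_idx N N" and q: "q \<noteq> 0"
  shows "in_copies N i (Suc i) (Pq_mat (scal_fls q) (scal_fls (inverse q))) a b =
    (if b = a \<circ> transpose i (Suc i) then scal_fls (q powi (int (inv_fun N a) - int (inv_fun N b))) else 0)"
proof -
  let ?s = "transpose i (Suc i)"
  have s: "?s permutes {1..N}" using i by (intro permutes_swap_id) auto
  have out: "a k = undefined" "b k = undefined" if "k \<notin> {1..N}" for k
    by (rule PiE_arb[OF a[unfolded multi_idx_def] that], rule PiE_arb[OF b[unfolded multi_idx_def] that])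
  have iff: "b = a \<circ> ?s \<longleftrightarrow> (\<forall>r\<in>{1..N} - {i, Suc i}. a r = b r) \<and> b i = a (Suc i) \<and> b (Suc i) = a i"
  proof
    assume h: "b = a \<circ> ?s"
    have "a r = b r" if "r \<in> {1..N} - {i, Suc i}" for r
      unfolding h comp_apply using that by (subst transpose_apply_other) auto
    moreover have "b i = a (Suc i)" "b (Suc i) = a i" unfolding h by simp_all
    ultimately show "(\<forall>r\<in>{1..N} - {i, Suc i}. a r = b r) \<and> b i = a (Suc i) \<and> b (Suc i) = a i" by blast
  next
    assume r: "(\<forall>r\<in>{1..N} - {i, Suc i}. a r = b r) \<and> b i = a (Suc i) \<and> b (Suc i) = a i"
    show "b = a \<circ> ?s"
    proof
      fix k
      consider "k = i" | "k = Suc i" | "k \<noteq> i" "k \<noteq> Suc i" "k \<in> {1..N}" | "k \<notin> {1..N}" by blast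
      then show "b k = (a \<circ> ?s) k"
      proof cases
        case 3
        then have "?s k = k" by (intro transpose_apply_other) auto
        moreover have "a k = b k" using r 3 by blast
        ultimately show ?thesis by (simp only: comp_apply)
      next
        case 4
        then have "k \<noteq> i" "k \<noteq> Suc i" using i by auto
        then have "?s k = k" by (intro transpose_apply_other) auto
        then show ?thesis using out[OF 4] by (simp only: comp_apply)
      qed (use r in simp_all)
    qed
  qed
  show ?thesis
  proof (cases "b = a \<circ> ?s")
    case False
    have "in_copies N i (Suc i) (Pq_mat (scal_fls q) (scal_fls (inverse q))) a b = 0"
    proof (cases "\<forall>r\<in>{1..N} - {i, Suc i}. a r = b r")
      case True
      then have n: "\<not> (b i = a (Suc i) \<and> b (Suc i) = a i)" using iff False by blast
      have "Pq_mat (scal_fls q) (scal_fls (inverse q)) (a i) (b i) (a (Suc i)) (b (Suc i)) = 0"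
        unfolding Pq_mat_def using n by auto
      then show ?thesis unfolding in_copies_def by (simp only: if_cancel)
    next
      case n: False
      then show ?thesis unfolding in_copies_def by (simp only: if_False)
    qed
    then show ?thesis using False by (simp only: if_False)
  next
    case True
    then have r: "\<forall>r\<in>{1..N} - {i, Suc i}. a r = b r" "b i = a (Suc i)" "b (Suc i) = a i" using iff by blast+
    have ic: "in_copies N i (Suc i) (Pq_mat (scal_fls q) (scal_fls (inverse q))) a b =
        Pq_mat (scal_fls q) (scal_fls (inverse q)) (a i) (a (Suc i)) (a (Suc i)) (a i)"
      unfolding in_copies_def if_P[OF r(1)] r(2,3) by (rule refl)
    have b': "a = b \<circ> ?s" unfolding True comp_assoc transpose_comp_involutory by simp
    consider "a i = a (Suc i)" | "a i < a (Suc i)" | "a (Suc i) < a i" by linarith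
    then show ?thesis
    proof cases
      case 1
      have "b = a"
      proof
        fix k show "b k = a k" unfolding True comp_apply transpose_def using 1 by simp
      qed
      then have "scal_fls (q powi (int (inv_fun N a) - int (inv_fun N b))) = 1" by (simp add: scal_fls_def del: upt_Suc)
      moreover have "Pq_mat (scal_fls q) (scal_fls (inverse q)) (a i) (a (Suc i)) (a (Suc i)) (a i) = 1"
        unfolding Pq_mat_def using 1 by simp
      ultimately show ?thesis unfolding ic using True by (simp only: if_True simp_thms)
    next
      case 2
      have "inv_fun N b = Suc (inv_fun N a)" unfolding True by (rule inv_fun_transpose) (use i 2 in auto)
      then have "q powi (int (inv_fun N a) - int (inv_fun N b)) = inverse q" by (simp add: power_int_minus del: upt_Suc)
      moreover have "Pq_mat (scal_fls q) (scal_fls (inverse q)) (a i) (a (Suc i)) (a (Suc i)) (a i) = scal_fls (inverse q)"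
        unfolding Pq_mat_def using 2 by simp
      ultimately show ?thesis unfolding ic using True by (simp only: if_True simp_thms)
    next
      case 3
      have "b i < b (Suc i)" using 3 r by simp
      then have "inv_fun N a = Suc (inv_fun N b)" by (subst b', intro inv_fun_transpose) (use i in auto)
      then have "q powi (int (inv_fun N a) - int (inv_fun N b)) = q" by (simp del: upt_Suc)
      moreover have "Pq_mat (scal_fls q) (scal_fls (inverse q)) (a i) (a (Suc i)) (a (Suc i)) (a i) = scal_fls q"
        unfolding Pq_mat_def using 3 by simp
      ultimately show ?thesis unfolding ic using True by (simp only: if_True simp_thms)
    qed
  qed
qed

lemma scal_fls_mult: "scal_fls (a * b) = scal_fls a * scal_fls b"
  by (simp only: fls_scal_const[symmetric] fls_scal_mult[symmetric] fls_const_mult_const)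

text \<open>The powers of q telescope. The product depends on the permutation only, whichever
  factorization was chosen, and no braid relation has to be checked.\<close>

lemma Pq_prod_entry:
  fixes q :: complex
  assumes q: "q \<noteq> 0" and "set is \<subseteq> {1..<N}" and "a \<in> multi_idx N N" and b: "b \<in> multi_idx N N"
  shows "op_prod N N (map (\<lambda>i. in_copies N i (Suc i) (Pq_mat (scal_fls q) (scal_fls (inverse q)))) is) a b =
    (if b = a \<circ> adj_comp is then scal_fls (q powi (int (inv_fun N a) - int (inv_fun N b))) else 0)"
  using assms(2,3)
proof (induction "is" arbitrary: a)
  case Nil
  then show ?case by (auto simp: op_prod_def op_one_def scal_fls_def)
next
  case (Cons i "is")
  let ?P = "\<lambda>i. in_copies N i (Suc i) (Pq_mat (scal_fls q) (scal_fls (inverse q)))"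
  let ?s = "transpose i (Suc i)"
  have i: "i \<in> {1..<N}" using Cons.prems by simp
  have s: "?s permutes {1..N}" using i by (intro permutes_swap_id) auto
  have as: "a \<circ> ?s \<in> multi_idx N N" by (rule multi_idx_comp[OF Cons.prems(2) s])
  have "op_prod N N (map ?P (i # is)) a b = (\<Sum>c\<in>multi_idx N N. ?P i a c * op_prod N N (map ?P is) c b)"
    by (simp add: op_prod_def op_mult_def)
  also have "\<dots> = (\<Sum>c\<in>multi_idx N N. if c = a \<circ> ?s then
      scal_fls (q powi (int (inv_fun N a) - int (inv_fun N (a \<circ> ?s)))) * op_prod N N (map ?P is) (a \<circ> ?s) b else 0)"
    by (intro sum.cong refl) (simp add: Pq_mat_entry[OF i Cons.prems(2) _ q] del: upt_Suc)
  also have "\<dots> = scal_fls (q powi (int (inv_fun N a) - int (inv_fun N (a \<circ> ?s)))) * op_prod N N (map ?P is) (a \<circ> ?s) b"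
    using as finite_multi_idx by (simp only: sum.delta if_True)
  also have "\<dots> = (if b = a \<circ> adj_comp (i # is) then scal_fls (q powi (int (inv_fun N a) - int (inv_fun N b))) else 0)"
  proof -
    have IH: "op_prod N N (map ?P is) (a \<circ> ?s) b = (if b = (a \<circ> ?s) \<circ> adj_comp is then scal_fls (q powi (int (inv_fun N (a \<circ> ?s)) - int (inv_fun N b))) else 0)"
      by (rule Cons.IH[OF _ as]) (use Cons.prems in simp)
    have e: "(a \<circ> ?s) \<circ> adj_comp is = a \<circ> adj_comp (i # is)" by (simp add: comp_assoc)
    have p: "q powi x * q powi y = q powi (x + y)" for x y using q by (simp add: power_int_add)
    show ?thesis unfolding IH e by (simp add: scal_fls_mult[symmetric] p del: upt_Suc foldr.simps)
  qed
  finally show ?case .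
qed

definition asym :: "complex \<Rightarrow> nat \<Rightarrow> (nat \<Rightarrow> nat) \<Rightarrow> (nat \<Rightarrow> nat) \<Rightarrow> complex" where
  "asym q N a b = (\<Sum>\<sigma> | \<sigma> permutes {1..N}. of_int (sign \<sigma>) * (if b = a \<circ> \<sigma> then q powi (int (inv_fun N a) - int (inv_fun N b)) else 0))"

lemma scal_fls_of_int: "scal_fls (of_int k) = of_int k"
proof -
  have s1: "scal_fls 1 = 1" by (simp add: scal_fls_def)
  have add: "scal_fls (a + b) = scal_fls a + scal_fls b" for a b
    by (simp only: fls_scal_const[symmetric] fls_scal_add[symmetric] fls_plus_const)
  have s0: "scal_fls 0 = 0" by (simp add: scal_fls_def)
  have n: "scal_fls (- a) = - scal_fls a" for a
    using add[of a "- a"] s0 by (simp add: eq_neg_iff_add_eq_0 add.commute)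
  show ?thesis
  proof (induction k rule: int_induct[of _ 0])
    case (step1 i)
    then show ?case by (simp add: add s1)
  next
    case (step2 i)
    have "scal_fls (of_int (i - 1)) = scal_fls (of_int i + - 1)" by simp
    also have "\<dots> = of_int i + - 1" by (simp only: add n s1 step2)
    finally show ?case by simp
  qed (simp add: s0)
qed

lemma q_antisym_entry:
  fixes q :: complex
  assumes q: "q \<noteq> 0" and a: "a \<in> multi_idx N N" and b: "b \<in> multi_idx N N"
  shows "q_antisym N (scal_fls q) (scal_fls (inverse q)) a b = scal_fls (asym q N a b)"
proof -
  let ?v = "q powi (int (inv_fun N a) - int (inv_fun N b))"
  have "Pq_perm N (scal_fls q) (scal_fls (inverse q)) \<sigma> a b = (if b = a \<circ> \<sigma> then scal_fls ?v else 0)"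
    if "\<sigma> permutes {1..N}" for \<sigma>
  proof -
    let ?is = "SOME is. set is \<subseteq> {1..<N} \<and> adj_comp is = \<sigma>"
    have "set ?is \<subseteq> {1..<N} \<and> adj_comp ?is = \<sigma>" by (rule someI_ex[OF adj_comp_exists[OF that]])
    then show ?thesis
      unfolding Pq_perm_def using Pq_prod_entry[OF q _ a b, of ?is] by (simp only:)
  qed
  then have "q_antisym N (scal_fls q) (scal_fls (inverse q)) a b =
     (\<Sum>\<sigma> | \<sigma> permutes {1..N}. of_int (sign \<sigma>) * (if b = a \<circ> \<sigma> then scal_fls ?v else 0))"
    unfolding q_antisym_def by (intro sum.cong refl) simp
  also have "\<dots> = (\<Sum>\<sigma> | \<sigma> permutes {1..N}. scal_fls (of_int (sign \<sigma>) * (if b = a \<circ> \<sigma> then ?v else 0)))"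
  proof (rule sum.cong[OF refl])
    fix \<sigma>
    have "scal_fls 0 = 0" by (simp add: scal_fls_def)
    then show "of_int (sign \<sigma>) * (if b = a \<circ> \<sigma> then scal_fls ?v else 0) = scal_fls (of_int (sign \<sigma>) * (if b = a \<circ> \<sigma> then ?v else 0))"
      by (cases "b = a \<circ> \<sigma>") (simp_all only: scal_fls_mult scal_fls_of_int if_True if_False mult_zero_right simp_thms)
  qed
  also have "\<dots> = scal_fls (asym q N a b)"
    unfolding asym_def scal_fls_def by (intro fls_eqI) (simp add: fls_nth_sum scal_sum del: upt_Suc)
  finally show ?thesis .
qed

text \<open>Composing the summation variable with the transposition reverses the sign: each row of
  A^q_N is q-alternating with \<kappa> = -1/q.\<close>

lemma asym_transpose:
  assumes "1 \<le> i" "i < N"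
  shows "b i < b (Suc i) \<Longrightarrow> q \<noteq> 0 \<Longrightarrow> asym q N a (b \<circ> transpose i (Suc i)) = - inverse q * asym q N a b"
    and "b i = b (Suc i) \<Longrightarrow> asym q N a b = 0"
proof -
  let ?s = "transpose i (Suc i)"
  have s: "?s permutes {1..N}" using assms by (intro permutes_swap_id) auto
  have fin: "finite {1..N}" by simp
  have sgn: "sign (\<sigma> \<circ> ?s) = - sign \<sigma>" if "\<sigma> permutes {1..N}" for \<sigma>
    using sign_compose[of \<sigma> ?s] permutation_permutes that s fin by (metis mult_minus1_right n_not_Suc_n sign_swap_id)
  have inv: "(b \<circ> ?s = a \<circ> (\<sigma> \<circ> ?s)) = (b = a \<circ> \<sigma>)" for \<sigma>
  proof
    assume h: "b \<circ> ?s = a \<circ> (\<sigma> \<circ> ?s)"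
    have "b = (b \<circ> ?s) \<circ> ?s" by (simp add: comp_assoc)
    also have "\<dots> = a \<circ> \<sigma>" unfolding h by (simp add: comp_assoc)
    finally show "b = a \<circ> \<sigma>" .
  qed (simp add: comp_assoc)
  have key: "asym q N a (b \<circ> ?s) = - (\<Sum>\<sigma> | \<sigma> permutes {1..N}. of_int (sign \<sigma>) *
      (if b = a \<circ> \<sigma> then q powi (int (inv_fun N a) - int (inv_fun N (b \<circ> ?s))) else 0))"
    unfolding asym_def sum_negf[symmetric]
    by (subst sum_permutations_compose_right[OF s], rule sum.cong[OF refl]) (simp add: inv sgn del: upt_Suc)
  show "asym q N a (b \<circ> ?s) = - inverse q * asym q N a b" if lt: "b i < b (Suc i)" and q: "q \<noteq> 0"
  proof -
    have "int (inv_fun N a) - int (inv_fun N (b \<circ> ?s)) = (int (inv_fun N a) - int (inv_fun N b)) + - 1"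
      unfolding inv_fun_transpose[OF assms lt] by simp
    moreover have "q powi (z + - 1) = inverse q * q powi z" for z
      using q by (subst power_int_add) (auto simp: power_int_minus mult.commute)
    ultimately have W: "q powi (int (inv_fun N a) - int (inv_fun N (b \<circ> ?s))) = inverse q * q powi (int (inv_fun N a) - int (inv_fun N b))"
      by (simp only:)
    have gen: "- (s * (if P then inverse q * z else 0)) = - inverse q * (s * (if P then z else 0))" for s z :: complex and P
      by simp
    show ?thesis unfolding key W unfolding asym_def sum_distrib_left sum_negf[symmetric] gen by (rule refl)
  qed
  show "asym q N a b = 0" if "b i = b (Suc i)"
  proof -
    have bs: "b \<circ> ?s = b" using that by (auto simp: fun_eq_iff transpose_def)
    have "asym q N a b = - asym q N a b" using key unfolding bs asym_def[symmetric] .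
    then show ?thesis by simp
  qed
qed

definition from_list :: "nat \<Rightarrow> nat list \<Rightarrow> nat \<Rightarrow> nat" where
  "from_list N xs = (\<lambda>k. if k \<in> {1..N} then xs ! (k - 1) else undefined)"

lemma map_from_list: "length xs = N \<Longrightarrow> map (from_list N xs) [1..<Suc N] = xs"
  by (rule nth_equalityI) (simp_all add: from_list_def del: upt_Suc)

lemma from_list_map_in:
  assumes k: "k \<in> {1..N}"
  shows "from_list N (map g [1..<Suc N]) k = g k"
proof -
  from k have k': "1 \<le> k" "k \<le> N" by simp_all
  have h1: "1 + (k - 1) < Suc N" using k' by linarith
  have h2: "k - 1 < length [1..<Suc N]" unfolding length_upt using k' by linarith
  have h3: "1 + (k - 1) = k" using k' by linarith
  have "from_list N (map g [1..<Suc N]) k = map g [1..<Suc N] ! (k - 1)"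
    unfolding from_list_def if_P[OF k] by (rule refl)
  also have "\<dots> = g k" by (simp only: nth_map[OF h2] nth_upt[OF h1] h3)
  finally show ?thesis .
qed

lemma from_list_map:
  assumes "e \<in> multi_idx N N"
  shows "from_list N (map e [1..<Suc N]) = e"
proof
  fix k
  show "from_list N (map e [1..<Suc N]) k = e k"
  proof (cases "k \<in> {1..N}")
    case True
    then show ?thesis by (rule from_list_map_in)
  next
    case False
    have "e k = undefined" by (rule PiE_arb[OF assms[unfolded multi_idx_def] False])
    then show ?thesis using False by (simp only: from_list_def if_False)
  qed
qed

lemma from_list_swap:
  assumes "length xs + Suc (Suc (length ys)) = N"
  shows "from_list N (xs @ y # x # ys) = from_list N (xs @ x # y # ys) \<circ> transpose (Suc (length xs)) (Suc (Suc (length xs)))"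
proof -
  let ?f = "from_list N (xs @ x # y # ys)" and ?i = "Suc (length xs)"
  let ?g = "?f \<circ> transpose ?i (Suc ?i)"
  have m: "map ?f [1..<Suc N] = xs @ x # y # ys" by (rule map_from_list) (use assms in simp)
  have g: "map ?g [1..<Suc N] = xs @ y # x # ys" by (rule map_transpose[OF assms m])
  show ?thesis
  proof
    fix k
    show "from_list N (xs @ y # x # ys) k = ?g k"
    proof (cases "k \<in> {1..N}")
      case True
      then have "from_list N (map ?g [1..<Suc N]) k = ?g k" by (rule from_list_map_in)
      then show ?thesis unfolding g .
    next
      case False
      then have "transpose ?i (Suc ?i) k = k" using assms by (auto simp: transpose_def)
      then show ?thesis using False by (simp only: from_list_def comp_apply if_False)
    qed
  qed
qed

text \<open>The q-alternating functions on words of length N over {1..N} are determined by one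
  value, the one at 1, ..., N.\<close>

lemma (in alternation) alternating_eq_wt:
  assumes f: "alternating f" and xs: "set xs \<subseteq> {1..N}" "length xs = N"
  shows "f xs = sc (wt {1..N} xs) * f [1..<Suc N]"
proof (cases "distinct xs")
  case False
  then show ?thesis using alternating_not_distinct[OF f False] by (simp add: wt_def)
next
  case True
  then have "card (set xs) = N" using xs(2) distinct_card[OF True] by simp
  then have sx: "set xs = {1..N}" by (intro card_subset_eq[OF finite_atLeastAtMost xs(1)]) simp
  have "set xs = set [1..<Suc N]" unfolding sx set_upt atLeastLessThanSuc_atLeastAtMost by (rule refl)
  then have "mset xs = mset [1..<Suc N]" by (rule set_eq_iff_mset_eq_distinct[THEN iffD1, OF True distinct_upt])
  from alternating_perm[OF f this]
  have "sc (\<kappa> ^ inv_list [1..<Suc N]) * f xs = sc (\<kappa> ^ inv_list xs) * f [1..<Suc N]" .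
  moreover have "inv_list [1..<Suc N] = 0"
  proof -
    have "{(i, j). (1::nat) \<le> i \<and> i < j \<and> j < Suc N \<and> id j < id i} = {}" by auto
    then show ?thesis using inv_list_map_upt[of id 1 "Suc N"] by (simp only: list.map_id card.empty)
  qed
  moreover have "wt {1..N} xs = \<kappa> ^ inv_list xs" using True sx by (simp only: wt_def if_True simp_thms)
  ultimately show ?thesis by (simp only: power_0 sc_1 mult_1_left)
qed

lemma asym_from_list:
  assumes l: "length xs + Suc (Suc (length ys)) = N"
  shows "c < d \<Longrightarrow> q \<noteq> 0 \<Longrightarrow> asym q N a (from_list N (xs @ d # c # ys)) = - inverse q * asym q N a (from_list N (xs @ c # d # ys))"
    and "asym q N a (from_list N (xs @ c # c # ys)) = 0"
proof -
  have i: "1 \<le> Suc (length xs)" "Suc (length xs) < N" using l by linarith+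
  have nthL: "from_list N (xs @ x # y # ys) (Suc (length xs)) = x" "from_list N (xs @ x # y # ys) (Suc (Suc (length xs))) = y" for x y
    using l by (simp_all add: from_list_def nth_append)
  show "asym q N a (from_list N (xs @ d # c # ys)) = - inverse q * asym q N a (from_list N (xs @ c # d # ys))"
    if "c < d" "q \<noteq> 0"
    unfolding from_list_swap[OF l, of d c]
    by (rule asym_transpose(1)[OF i _ that(2)]) (simp only: nthL that(1))
  show "asym q N a (from_list N (xs @ c # c # ys)) = 0"
    by (rule asym_transpose(2)[OF i]) (simp only: nthL)
qed

text \<open>Only the identity permutation fixes a multi-index with distinct entries.\<close>

lemma asym_id: "asym q N (from_list N [1..<Suc N]) (from_list N [1..<Suc N]) = 1"
proof -
  let ?i = "from_list N [1..<Suc N]"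
  have "(?i = ?i \<circ> \<sigma>) = (\<sigma> = id)" if p: "\<sigma> permutes {1..N}" for \<sigma>
  proof
    assume h: "?i = ?i \<circ> \<sigma>"
    show "\<sigma> = id"
    proof
      fix k show "\<sigma> k = id k"
      proof (cases "k \<in> {1..N}")
        case True
        then have "\<sigma> k \<in> {1..N}" using permutes_in_image[OF p] by simp
        moreover have "?i k = ?i (\<sigma> k)" using fun_cong[OF h, of k] by (simp only: comp_def)
        ultimately show ?thesis using True by (simp add: from_list_def del: upt_Suc)
      next
        case False
        then show ?thesis using permutes_not_in[OF p] by simp
      qed
    qed
  qed simp
  note eq = this
  have "asym q N ?i ?i = (\<Sum>\<sigma> | \<sigma> permutes {1..N}. if \<sigma> = id then 1 else 0)"
    unfolding asym_def
  proof (rule sum.cong[OF refl])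
    fix \<sigma> assume "\<sigma> \<in> {\<sigma>. \<sigma> permutes {1..N}}"
    then have "(?i = ?i \<circ> \<sigma>) = (\<sigma> = id)" by (intro eq) simp
    moreover have "q powi (int (inv_fun N ?i) - int (inv_fun N ?i)) = 1" by (simp only: diff_self power_int_0_right)
    ultimately show "of_int (sign \<sigma>) * (if ?i = ?i \<circ> \<sigma> then q powi (int (inv_fun N ?i) - int (inv_fun N ?i)) else 0) = (if \<sigma> = id then 1 else (0::complex))"
      by (cases "\<sigma> = id") (simp_all only: if_True if_False simp_thms mult_zero_right sign_id of_int_1 mult_1_left)
  qed
  also have "\<dots> = 1"
    by (subst sum.delta) (simp_all add: finite_permutations permutes_id)
  finally show ?thesis .
qed

section \<open>Transferring the operator product to the ring of series\<close>

lemma fls_rescale_mult: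
  assumes "c \<noteq> 0"
  shows "fls_rescale c (f * g) = fls_rescale c f * fls_rescale c g"
proof (rule fls_eqI)
  fix n
  let ?A = "{fls_subdegree f..n - fls_subdegree g}"
  have comm: "scal a * x * (scal b * y) = scal (a * b) * (x * y)" for a b x y
  proof -
    have "scal a * x * (scal b * y) = scal a * ((x * scal b) * y)" by (simp only: mult.assoc)
    also have "x * scal b = scal b * x" by (rule scal_central[symmetric])
    finally show ?thesis by (simp only: scal_mult mult.assoc)
  qed
  have p: "c powi i * c powi (n - i) = c powi n" for i
    using power_int_add[of c i "n - i"] assms by simp
  have "fls_nth (fls_rescale c f * fls_rescale c g) n = (\<Sum>i\<in>?A. fls_nth (fls_rescale c f) i * fls_nth (fls_rescale c g) (n - i))"
    by (rule fls_times_nth_bounds) simp_all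
  also have "\<dots> = (\<Sum>i\<in>?A. scal (c powi n) * (fls_nth f i * fls_nth g (n - i)))"
    by (simp only: fls_rescale_nth comm p)
  also have "\<dots> = fls_nth (fls_rescale c (f * g)) n"
    by (simp only: fls_rescale_nth fls_times_nth(2)[of f g] sum_distrib_left)
  finally show "fls_nth (fls_rescale c (f * g)) n = fls_nth (fls_rescale c f * fls_rescale c g) n" by (rule sym)
qed

lemma subst_ser_mult: "c \<noteq> 0 \<Longrightarrow> subst_ser c (f * g) = subst_ser c f * subst_ser c g"
  unfolding subst_ser_eq fls_times_fps_to_fls by (rule fls_rescale_mult)

lemma subst_ser_add: "subst_ser c (f + g) = subst_ser c f + subst_ser c g"
  by (rule fls_eqI) (simp add: subst_ser_def distrib_left)

lemma subst_ser_0: "subst_ser c 0 = 0"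
  by (rule fls_eqI) (simp add: subst_ser_def)

lemma subst_ser_sum: "subst_ser c (\<Sum>i\<in>A. f i) = (\<Sum>i\<in>A. subst_ser c (f i))"
  by (induction A rule: infinite_finite_induct) (simp_all add: subst_ser_add subst_ser_0)

definition rowm :: "nat \<Rightarrow> free_alg fls oper \<Rightarrow> ((nat \<Rightarrow> nat) \<Rightarrow> free_alg fls) \<Rightarrow> (nat \<Rightarrow> nat) \<Rightarrow> free_alg fls" where
  "rowm N M H = (\<lambda>e. \<Sum>b\<in>multi_idx N N. H b * M b e)"

lemma run_rowm:
  assumes e: "e \<in> multi_idx N N"
  shows "(\<Sum>b\<in>multi_idx N N. H b * op_prod N N Ms b e) = run (map (rowm N) Ms) H e"
proof (induction Ms arbitrary: H)
  case Nil
  have "(\<Sum>b\<in>multi_idx N N. H b * op_prod N N [] b e) = (\<Sum>b\<in>multi_idx N N. if b = e then H e else 0)"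
    by (rule sum.cong) (auto simp: op_prod_def op_one_def)
  also have "\<dots> = H e" using e finite_multi_idx by (simp only: sum.delta if_True)
  finally show ?case by (simp only: list.map run_Nil)
next
  case (Cons M Ms)
  have "op_prod N N (M # Ms) b e = (\<Sum>c\<in>multi_idx N N. M b c * op_prod N N Ms c e)" for b
    by (simp add: op_prod_def op_mult_def)
  then have "(\<Sum>b\<in>multi_idx N N. H b * op_prod N N (M # Ms) b e) =
      (\<Sum>b\<in>multi_idx N N. \<Sum>c\<in>multi_idx N N. H b * M b c * op_prod N N Ms c e)"
    by (simp only: sum_distrib_left mult.assoc)
  also have "\<dots> = (\<Sum>c\<in>multi_idx N N. rowm N M H c * op_prod N N Ms c e)"
    unfolding rowm_def sum_distrib_right by (rule sum.swap)
  also have "\<dots> = run (map (rowm N) (M # Ms)) H e" by (simp only: Cons list.map run_Cons)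
  finally show ?case .
qed

lemma multi_idx_upd:
  assumes e: "e \<in> multi_idx N N" and i: "i \<in> {1..N}" and x: "x \<in> {1..N}"
  shows "e(i := x) \<in> multi_idx N N"
  unfolding multi_idx_def
proof (rule PiE_I)
  fix k assume "k \<in> {1..N}"
  then have "e k \<in> {1..N}" by (rule PiE_mem[OF e[unfolded multi_idx_def]])
  then show "(e(i := x)) k \<in> {1..N}" using x by (cases "k = i") simp_all
next
  fix k assume k: "k \<notin> {1..N}"
  then have "e k = undefined" by (rule PiE_arb[OF e[unfolded multi_idx_def]])
  moreover have "k \<noteq> i" using k i by blast
  ultimately show "(e(i := x)) k = undefined" by simp
qed

lemma multi_idx_mem: "e \<in> multi_idx N N \<Longrightarrow> i \<in> {1..N} \<Longrightarrow> e i \<in> {1..N}"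
  unfolding multi_idx_def by (rule PiE_mem)

lemma multi_idx_eqI:
  assumes "b \<in> multi_idx N N" "b' \<in> multi_idx N N" "\<And>k. k \<in> {1..N} \<Longrightarrow> b k = b' k"
  shows "b = b'"
  using assms unfolding multi_idx_def by (rule PiE_ext)

lemma rowm_in_copy:
  assumes e: "e \<in> multi_idx N N" and i: "i \<in> {1..N}"
  shows "rowm N (in_copy N i M) H e = (\<Sum>x\<in>{1..N}. H (e(i := x)) * M x (e i))"
proof -
  let ?P = "\<lambda>b. \<forall>r\<in>{1..N} - {i}. b r = e r"
  have "rowm N (in_copy N i M) H e = (\<Sum>b\<in>multi_idx N N. if ?P b then H b * M (b i) (e i) else 0)"
    unfolding rowm_def in_copy_def by (rule sum.cong[OF refl]) simp
  also have "\<dots> = (\<Sum>b\<in>{b \<in> multi_idx N N. ?P b}. H b * M (b i) (e i))"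
    by (rule sum.inter_filter[OF finite_multi_idx, symmetric])
  also have "\<dots> = (\<Sum>x\<in>{1..N}. H (e(i := x)) * M x (e i))"
  proof (rule sum.reindex_bij_witness[of _ "\<lambda>x. e(i := x)" "\<lambda>b. b i"])
    fix b assume b: "b \<in> {b \<in> multi_idx N N. ?P b}"
    show bi: "b i \<in> {1..N}" using b i multi_idx_mem by blast
    show eq: "e(i := b i) = b"
      by (rule multi_idx_eqI[OF multi_idx_upd[OF e i bi]]) (use b in auto)
    show "H (e(i := b i)) * M (b i) (e i) = H b * M (b i) (e i)" by (simp only: eq)
  next
    fix x assume x: "x \<in> {1..N}"
    show "(e(i := x)) i = x" by simp
    show "e(i := x) \<in> {b \<in> multi_idx N N. ?P b}" using multi_idx_upd[OF e i x] by simp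
  qed
  finally show ?thesis .
qed

lemma rowm_in_copies:
  assumes e: "e \<in> multi_idx N N" and i: "i \<in> {1..N}" and j: "j \<in> {1..N}" and ij: "i \<noteq> j"
  shows "rowm N (in_copies N i j M) H e = (\<Sum>x\<in>{1..N}. \<Sum>y\<in>{1..N}. H (e(i := x, j := y)) * M x (e i) y (e j))"
proof -
  let ?P = "\<lambda>b. \<forall>r\<in>{1..N} - {i, j}. b r = e r"
  have "rowm N (in_copies N i j M) H e = (\<Sum>b\<in>multi_idx N N. if ?P b then H b * M (b i) (e i) (b j) (e j) else 0)"
    unfolding rowm_def in_copies_def by (rule sum.cong[OF refl]) simp
  also have "\<dots> = (\<Sum>b\<in>{b \<in> multi_idx N N. ?P b}. H b * M (b i) (e i) (b j) (e j))"
    by (rule sum.inter_filter[OF finite_multi_idx, symmetric])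
  also have "\<dots> = (\<Sum>p\<in>{1..N} \<times> {1..N}. H (e(i := fst p, j := snd p)) * M (fst p) (e i) (snd p) (e j))"
  proof (rule sum.reindex_bij_witness[of _ "\<lambda>p. e(i := fst p, j := snd p)" "\<lambda>b. (b i, b j)"])
    fix b assume b: "b \<in> {b \<in> multi_idx N N. ?P b}"
    have bi: "b i \<in> {1..N}" "b j \<in> {1..N}" using b i j multi_idx_mem by blast+
    then show "(b i, b j) \<in> {1..N} \<times> {1..N}" by simp
    have eq: "e(i := b i, j := b j) = b"
      by (rule multi_idx_eqI[OF multi_idx_upd[OF multi_idx_upd[OF e i bi(1)] j bi(2)]]) (use b in auto)
    then show "e(i := fst (b i, b j), j := snd (b i, b j)) = b" by (simp only: fst_conv snd_conv)
    show "H (e(i := fst (b i, b j), j := snd (b i, b j))) * M (fst (b i, b j)) (e i) (snd (b i, b j)) (e j) = H b * M (b i) (e i) (b j) (e j)"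
      by (simp only: fst_conv snd_conv eq)
  next
    fix p assume "p \<in> {1..N} \<times> {1..N}"
    then have p: "fst p \<in> {1..N}" "snd p \<in> {1..N}" by auto
    show "((e(i := fst p, j := snd p)) i, (e(i := fst p, j := snd p)) j) = p" using ij by simp
    show "e(i := fst p, j := snd p) \<in> {b \<in> multi_idx N N. ?P b}"
      using multi_idx_upd[OF multi_idx_upd[OF e i p(1)] j p(2)] by simp
  qed
  also have "\<dots> = (\<Sum>x\<in>{1..N}. \<Sum>y\<in>{1..N}. H (e(i := x, j := y)) * M x (e i) y (e j))"
    unfolding sum.cartesian_product by (simp only: case_prod_unfold)
  finally show ?thesis .
qed

text \<open>The operators act on row vectors from the right, so a left factor z is passed along
  unchanged. It will hold the idempotent \<open>iota q N 1\<close> and one entry of A^q_N.\<close>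

definition transfers :: "complex \<Rightarrow> nat \<Rightarrow> free_alg fls oper \<Rightarrow> (((nat \<Rightarrow> nat) \<Rightarrow> ul) \<Rightarrow> (nat \<Rightarrow> nat) \<Rightarrow> ul) \<Rightarrow> bool" where
  "transfers q N M f \<longleftrightarrow> (\<forall>H K z. (\<forall>e\<in>multi_idx N N. iota q N (H e) = z * K e) \<longrightarrow>
     (\<forall>e\<in>multi_idx N N. iota q N (rowm N M H e) = z * f K e))"

lemma transfers_run:
  assumes "\<And>M f. (M, f) \<in> set ps \<Longrightarrow> transfers q N M f" "\<And>e. e \<in> multi_idx N N \<Longrightarrow> iota q N (H e) = z * K e"
    "e \<in> multi_idx N N"
  shows "iota q N (run (map (rowm N) (map fst ps)) H e) = z * run (map snd ps) K e"
  using assms(1,2)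
proof (induction ps arbitrary: H K)
  case Nil
  then show ?case using assms(3) by simp
next
  case (Cons p ps)
  obtain M f where p: "p = (M, f)" by (cases p)
  have "transfers q N M f" by (rule Cons.prems(1)) (simp add: p)
  then have "\<And>e. e \<in> multi_idx N N \<Longrightarrow> iota q N (rowm N M H e) = z * f K e"
    unfolding transfers_def using Cons.prems(2) by blast
  then have "iota q N (run (map (rowm N) (map fst ps)) (rowm N M H) e) = z * run (map snd ps) (f K) e"
    by (intro Cons.IH Cons.prems(1)) simp_all
  then show ?case by (simp only: p list.map fst_conv snd_conv run_Cons)
qed

lemma transfers_in_copy:
  assumes i: "i \<in> {1..N}" and M: "\<And>x y. iota q N (M x y) = M' x y"
  shows "transfers q N (in_copy N i M) (cop N i M')"
  unfolding transfers_def
proof (intro allI impI ballI)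
  fix H K z e assume h: "\<forall>e\<in>multi_idx N N. iota q N (H e) = z * K e" and e: "e \<in> multi_idx N N"
  have "iota q N (rowm N (in_copy N i M) H e) = (\<Sum>x\<in>{1..N}. iota q N (H (e(i := x))) * M' x (e i))"
    by (simp only: rowm_in_copy[OF e i] iota_sum iota_mult M)
  also have "\<dots> = (\<Sum>x\<in>{1..N}. z * (K (e(i := x)) * M' x (e i)))"
  proof (rule sum.cong[OF refl])
    fix x assume "x \<in> {1..N}"
    then have "iota q N (H (e(i := x))) = z * K (e(i := x))" using h multi_idx_upd[OF e i] by blast
    then show "iota q N (H (e(i := x))) * M' x (e i) = z * (K (e(i := x)) * M' x (e i))" by (simp only: mult.assoc)
  qed
  finally show "iota q N (rowm N (in_copy N i M) H e) = z * cop N i M' K e"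
    by (simp only: cop_def sum_distrib_left)
qed

lemma transfers_in_copies:
  assumes i: "i \<in> {1..N}" "j \<in> {1..N}" "i \<noteq> j" and M: "\<And>a b c d. M a b c d = fls_scal (\<rho> a b c d)"
  shows "transfers q N (in_copies N i j M) (pop N i j (\<lambda>a b c d. scu (\<rho> a b c d)))"
  unfolding transfers_def
proof (intro allI impI ballI)
  fix H K z e assume h: "\<forall>e\<in>multi_idx N N. iota q N (H e) = z * K e" and e: "e \<in> multi_idx N N"
  have "iota q N (rowm N (in_copies N i j M) H e) = (\<Sum>x\<in>{1..N}. \<Sum>y\<in>{1..N}. iota q N (H (e(i := x, j := y))) * scu (\<rho> x (e i) y (e j)))"
    by (simp only: rowm_in_copies[OF e i] iota_sum M iota_scal_right)
  also have "\<dots> = (\<Sum>x\<in>{1..N}. \<Sum>y\<in>{1..N}. z * (K (e(i := x, j := y)) * scu (\<rho> x (e i) y (e j))))"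
  proof (rule sum.cong[OF refl], rule sum.cong[OF refl])
    fix x y assume x: "x \<in> {1..N}" and y: "y \<in> {1..N}"
    have "e(i := x, j := y) \<in> multi_idx N N" by (rule multi_idx_upd[OF multi_idx_upd[OF e i(1) x] i(2) y])
    then have "iota q N (H (e(i := x, j := y))) = z * K (e(i := x, j := y))" using h by blast
    then show "iota q N (H (e(i := x, j := y))) * scu (\<rho> x (e i) y (e j)) = z * (K (e(i := x, j := y)) * scu (\<rho> x (e i) y (e j)))"
      by (simp only: mult.assoc)
  qed
  finally show "iota q N (rowm N (in_copies N i j M) H e) = z * pop N i j (\<lambda>a b c d. scu (\<rho> a b c d)) K e"
    by (simp only: pop_def sum_distrib_left)
qed

lemma fls_scal_0: "fls_scal 0 = 0"
  by (rule fls_eqI) simp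

lemma Rt_mat_scal:
  assumes "sklyanin_op scu (fls_const q) (uu q) N (tL q N) (tbL q N)"
  shows "Rt_mat (scal_fls q) (scal_fls (inverse q)) (fls_scal x) (fls_scal v) a b c d =
    fls_scal (sklyanin_op.rt (fls_const q) x v a b c d)"
proof -
  interpret sk: sklyanin_op scu "fls_const q" "uu q" N "tL q N" "tbL q N" by (rule assms)
  have d1: "fls_scal (x - v) = fls_scal x - fls_scal v"
    and d2: "fls_scal (inverse (fls_const q) * x - fls_const q * v) = scal_fls (inverse q) * fls_scal x - scal_fls q * fls_scal v"
    and d3: "fls_scal ((inverse (fls_const q) - fls_const q) * w) = (scal_fls (inverse q) - scal_fls q) * fls_scal w" for w
    by (simp_all only: fls_scal_diff fls_scal_mult fls_scal_const fls_inverse_const)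
  show ?thesis
  proof (cases "a = b")
    case True
    then show ?thesis
      unfolding Rt_mat_def R_mat_def sk.rt_def rdiag_def roff_def by (auto simp: d1 d2 fls_scal_0)
  next
    case False
    consider "a < b" | "b < a" using False by linarith
    then show ?thesis
      unfolding Rt_mat_def R_mat_def sk.rt_def rdiag_def roff_def by cases (auto simp: d3 fls_scal_0)
  qed
qed

section \<open>Series with coefficients in the twisted q-Yangian\<close>

text \<open>The preimage of the twisted q-Yangian in the free algebra, so that closure properties
  can be checked on representatives.\<close>

definition Yset :: "complex \<Rightarrow> nat \<Rightarrow> free_alg set" where
  "Yset q N = {f. uq_class q N f \<in> Ytw q N}"

lemma uq_class_hom: "(\<lambda>x. uq_class q N x) \<in> ring_hom free_ring (Uq q N)"
  unfolding uq_class_def Uq_def by (rule ideal.rcos_ring_hom[OF ideal_uq_ideal])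

lemma uq_class_add: "uq_class q N (x + y) = uq_class q N x \<oplus>\<^bsub>Uq q N\<^esub> uq_class q N y"
  using ring_hom_add[OF uq_class_hom, of x y q N] by (simp add: free_ring_def)

lemma uq_class_mult: "uq_class q N (x * y) = uq_class q N x \<otimes>\<^bsub>Uq q N\<^esub> uq_class q N y"
  using ring_hom_mult[OF uq_class_hom, of x y q N] by (simp add: free_ring_def)

lemma Yset_add: "x \<in> Yset q N \<Longrightarrow> y \<in> Yset q N \<Longrightarrow> x + y \<in> Yset q N"
  unfolding Yset_def mem_Collect_eq uq_class_add Ytw_def by (rule generate_ring.eng_add)

lemma Yset_mult: "x \<in> Yset q N \<Longrightarrow> y \<in> Yset q N \<Longrightarrow> x * y \<in> Yset q N"
  unfolding Yset_def mem_Collect_eq uq_class_mult Ytw_def by (rule generate_ring.eng_mult)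

lemma Yset_scal: "scal c \<in> Yset q N"
  unfolding Yset_def mem_Collect_eq Ytw_def by (rule generate_ring.incl) blast

lemma Yset_0: "0 \<in> Yset q N"
  using Yset_scal[of 0 q N] by simp

lemma Yset_s: "i \<in> {1..N} \<Longrightarrow> j \<in> {1..N} \<Longrightarrow> fps_nth (s_ser N i j) r \<in> Yset q N"
  unfolding Yset_def mem_Collect_eq Ytw_def by (rule generate_ring.incl) blast

lemma Yset_sum: "(\<And>i. i \<in> A \<Longrightarrow> f i \<in> Yset q N) \<Longrightarrow> (\<Sum>i\<in>A. f i) \<in> Yset q N"
  by (induction A rule: infinite_finite_induct) (simp_all add: Yset_0 Yset_add)

definition Zset :: "complex \<Rightarrow> nat \<Rightarrow> free_alg fls set" where
  "Zset q N = {f. \<forall>k. fls_nth f k \<in> Yset q N}"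

lemma Zset_mult: "f \<in> Zset q N \<Longrightarrow> g \<in> Zset q N \<Longrightarrow> f * g \<in> Zset q N"
  unfolding Zset_def mem_Collect_eq fls_times_nth(2) by (intro allI Yset_sum Yset_mult) simp_all

lemma Zset_sum: "(\<And>i. i \<in> A \<Longrightarrow> f i \<in> Zset q N) \<Longrightarrow> (\<Sum>i\<in>A. f i) \<in> Zset q N"
  unfolding Zset_def mem_Collect_eq fls_nth_sum by (intro allI Yset_sum) simp

lemma Zset_scal: "fls_scal c \<in> Zset q N"
  unfolding Zset_def mem_Collect_eq fls_scal_nth by (intro allI Yset_scal)

lemma Zset_0: "0 \<in> Zset q N" and Zset_1: "1 \<in> Zset q N"
  using Zset_scal[of 0 q N] Zset_scal[of 1 q N] by (simp_all only: fls_scal_0 fls_scal_1)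

lemma Zset_s:
  assumes "i \<in> {1..N}" "j \<in> {1..N}"
  shows "subst_ser c (s_ser N i j) \<in> Zset q N"
  unfolding Zset_def mem_Collect_eq
proof
  fix k
  show "fls_nth (subst_ser c (s_ser N i j)) k \<in> Yset q N"
    using Yset_mult[OF Yset_scal Yset_s[OF assms]] Yset_0 by (simp add: subst_ser_def)
qed

definition Zentries :: "complex \<Rightarrow> nat \<Rightarrow> free_alg fls oper \<Rightarrow> bool" where
  "Zentries q N M \<longleftrightarrow> (\<forall>a\<in>multi_idx N N. \<forall>b\<in>multi_idx N N. M a b \<in> Zset q N)"

lemma Zset_op_prod:
  assumes "\<And>M. M \<in> set Ms \<Longrightarrow> Zentries q N M" "a \<in> multi_idx N N" "b \<in> multi_idx N N"
  shows "op_prod N N Ms a b \<in> Zset q N"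
  using assms(1,2)
proof (induction Ms arbitrary: a)
  case Nil
  show ?case by (simp add: op_prod_def op_one_def Zset_0 Zset_1)
next
  case (Cons M Ms)
  have "op_prod N N (M # Ms) a b = (\<Sum>c\<in>multi_idx N N. M a c * op_prod N N Ms c b)"
    by (simp add: op_prod_def op_mult_def)
  moreover have "M a c * op_prod N N Ms c b \<in> Zset q N" if c: "c \<in> multi_idx N N" for c
  proof (rule Zset_mult)
    have "Zentries q N M" by (rule Cons.prems(1)) simp
    then show "M a c \<in> Zset q N" unfolding Zentries_def using Cons.prems(2) c by blast
    show "op_prod N N Ms c b \<in> Zset q N" by (rule Cons.IH[OF _ c], rule Cons.prems(1)) simp
  qed
  ultimately show ?case by (simp only: Zset_sum)
qed

lemma Zset_in_copies:
  assumes "\<And>a b c d. M a b c d \<in> Zset q N"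
  shows "in_copies N i j M a b \<in> Zset q N"
  unfolding in_copies_def using assms Zset_0 by simp

lemma Zset_uq_series: "f \<in> Zset q N \<Longrightarrow> uq_series q N f k \<in> Ytw q N"
  unfolding Zset_def Yset_def uq_series_def by blast

lemma set_concat_map_Cons:
  "x \<in> set (concat (map (\<lambda>i. f i # map (g i) (h i)) xs)) \<longleftrightarrow> (\<exists>i\<in>set xs. x = f i \<or> x \<in> g i ` set (h i))"
  by auto

lemma iota_one_left_commute: "x * (iota q N 1 * y) = iota q N 1 * (x * y)"
proof -
  have "x * iota q N 1 = iota q N 1 * x" by (rule iota_one_central iota_one_central[symmetric])
  then show ?thesis by (simp only: mult.assoc[symmetric])
qed

section \<open>The Sklyanin determinant and the series c(u)\<close>

context
  fixes q :: complex and N :: nat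
  assumes q: "q \<noteq> 0" and nr: "\<And>k::nat. k > 0 \<Longrightarrow> q ^ k \<noteq> 1" and N: "N \<ge> 2"
begin

interpretation sk: sklyanin_op scu "fls_const q" "uu q" N "tL q N" "tbL q N"
  by (rule sklyanin_op_uq[OF q nr])

lemma qpos_nz: "qpos q i \<noteq> 0"
  using q by simp

lemma S_eq: "sk.S i l c = iota q N (subst_ser (qpos q i) (s_ser N l c))"
  unfolding sk.S_def s_ser_def tL_def tbL_def
  by (simp only: subst_ser_sum iota_sum subst_ser_mult[OF qpos_nz] iota_mult)

lemma Sb_eq: "sk.Sb i k j = iota q N (subst_ser (qpos q i) (sbar_t_ser N k j))"
  unfolding sk.Sb_def sbar_t_ser_def sbar_ser_def tL_def tbL_def
  by (simp only: subst_ser_sum iota_sum subst_ser_mult[OF qpos_nz] iota_mult)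

abbreviation idx_id where "idx_id \<equiv> from_list N [1..<Suc N]"

lemma idx_id_in: "idx_id \<in> multi_idx N N"
  unfolding multi_idx_def
proof (rule PiE_I)
  fix k assume k: "k \<in> {1..N}"
  then have "idx_id k = k" using from_list_map_in[OF k, of id] by (simp only: list.map_id id_apply)
  then show "idx_id k \<in> {1..N}" using k by (simp only:)
next
  fix k assume "k \<notin> {1..N}"
  then show "idx_id k = undefined" by (simp only: from_list_def if_False)
qed

lemma map_idx_id: "map idx_id [1..<Suc N] = [1..<Suc N]"
  by (rule map_from_list) (simp only: length_upt diff_Suc_1)

lemma multi_idx_list:
  assumes "e \<in> multi_idx N N"
  shows "set (map e [1..<Suc N]) \<subseteq> {1..N}" "length (map e [1..<Suc N]) = N"
proof -
  have eq: "set (map e [1..<Suc N]) = e ` {1..N}" by (simp only: set_map set_upt atLeastLessThanSuc_atLeastAtMost)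
  show "set (map e [1..<Suc N]) \<subseteq> {1..N}" unfolding eq by (rule image_subsetI) (rule multi_idx_mem[OF assms])
  show "length (map e [1..<Suc N]) = N" by (simp only: length_map length_upt diff_Suc_1)
qed

text \<open>Each row of A^q_N is q-alternating in the column multi-index, hence a multiple of the
  q-sign, namely by its entry at 1, ..., N.\<close>

lemma asym_wt:
  assumes e: "e \<in> multi_idx N N"
  shows "scu (fls_const (asym q N a e)) = scu (sk.wt {1..N} (map e [1..<Suc N])) * scu (fls_const (asym q N a idx_id))"
proof -
  \<comment> \<open>Extended by 0 to words of other lengths, because \<open>alternating\<close>
    speaks of all words.\<close>
  define g where "g = (\<lambda>xs. scu (fls_const (if length xs = N then asym q N a (from_list N xs) else 0)))"
  have k: "fls_const (- inverse q * z) = - inverse (fls_const q) * fls_const z" for z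
    by (simp only: fls_const_mult_const[symmetric] fls_const_minus fls_inverse_const)
  have "sk.alternating g"
  proof (rule sk.alternatingI)
    fix xs c d ys assume cd: "c < (d::nat)"
    show "g (xs @ d # c # ys) = scu (- inverse (fls_const q)) * g (xs @ c # d # ys)"
    proof (cases "length xs + Suc (Suc (length ys)) = N")
      case True
      then have l: "length (xs @ d # c # ys) = N" "length (xs @ c # d # ys) = N" by simp_all
      show ?thesis
        unfolding g_def if_P[OF l(1)] if_P[OF l(2)] asym_from_list(1)[OF True cd q] k by (rule scu.sc_mult)
    next
      case False
      then have l: "length (xs @ d # c # ys) \<noteq> N" "length (xs @ c # d # ys) \<noteq> N" by simp_all
      show ?thesis
        unfolding g_def if_not_P[OF l(1)] if_not_P[OF l(2)] by simp
    qed
  next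
    fix xs c ys
    show "g (xs @ c # c # ys) = 0"
    proof (cases "length xs + Suc (Suc (length ys)) = N")
      case True
      then have l: "length (xs @ c # c # ys) = N" by simp
      show ?thesis unfolding g_def if_P[OF l] asym_from_list(2)[OF True] by simp
    next
      case False
      then have l: "length (xs @ c # c # ys) \<noteq> N" by simp
      show ?thesis unfolding g_def if_not_P[OF l] by simp
    qed
  qed
  from sk.alternating_eq_wt[OF this multi_idx_list[OF e]]
  have "g (map e [1..<Suc N]) = scu (sk.wt {1..N} (map e [1..<Suc N])) * g [1..<Suc N]" .
  moreover have "g (map e [1..<Suc N]) = scu (fls_const (asym q N a e))"
    unfolding g_def if_P[OF multi_idx_list(2)[OF e]] from_list_map[OF e] by (rule refl)
  moreover have l: "length [1..<Suc N] = N" by (simp only: length_upt diff_Suc_1)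
  moreover have "g [1..<Suc N] = scu (fls_const (asym q N a idx_id))"
    unfolding g_def if_P[OF l] by (rule refl)
  ultimately show ?thesis by (simp only:)
qed

lemma gamma_eq: "gamma_N q N = (\<Prod>(i, j)\<in>{(i, j). 1 \<le> i \<and> i < j \<and> j \<le> N}. inverse (uu q i) - uu q j)"
  unfolding gamma_N_def inverse_uu[OF q] unfolding uu_def by (rule refl)

abbreviation "Rmat i j \<equiv> Rt_mat (scal_fls q) (scal_fls (inverse q)) (scal_fls (q powi (2 * int i - 2)) * fls_X) (scal_fls (q powi (2 - 2 * int j)) * fls_X_inv)"

lemma Rmat_scal: "Rmat i j a b c d = fls_scal (sk.rt (inverse (uu q i)) (uu q j) a b c d)"
proof -
  have "scal_fls (q powi (2 * int i - 2)) * fls_X = fls_scal (inverse (uu q i))"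
    unfolding inverse_uu[OF q] by (simp only: fls_scal_mult fls_scal_const fls_scal_X)
  moreover have "scal_fls (q powi (2 - 2 * int j)) * fls_X_inv = fls_scal (uu q j)"
    unfolding uu_def by (simp only: fls_scal_mult fls_scal_const fls_scal_X_inv)
  ultimately show ?thesis by (simp only: Rt_mat_scal[OF sk.sklyanin_op_axioms])
qed

abbreviation "Smat i \<equiv> in_copy N i (\<lambda>j k. subst_ser (qpos q i) (s_ser N j k))"
abbreviation "Anti \<equiv> q_antisym N (scal_fls q) (scal_fls (inverse q))"

definition sdet_list :: "free_alg fls oper list" where
  "sdet_list = concat (map (\<lambda>i. Smat i # map (\<lambda>j. in_copies N i j (Rmat i j)) [Suc i..<Suc N]) [1..<Suc N])"

lemma sdet_product_eq: "sdet_product q N = op_prod N N (Anti # sdet_list)"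
  unfolding sdet_product_def Let_def sdet_list_def by (rule refl)

text \<open>A row of A^q_N is, up to a scalar, the starting vector of \<open>run_sdet\<close>; the
  remaining factors are translated one by one.\<close>

lemma sdet_product_iota:
  assumes a: "a \<in> multi_idx N N" and e: "e \<in> multi_idx N N"
  shows "iota q N (sdet_product q N a e) = iota q N 1 * scu (fls_const (asym q N a idx_id)) *
    (scu (gamma_N q N) * sk.sig 1 {1..N} (map e [1..<Suc N]))"
proof -
  define ps where "ps = concat (map (\<lambda>i. (Smat i, sk.Sop i) # map (\<lambda>j. (in_copies N i j (Rmat i j), sk.Rop i j)) [Suc i..<Suc N]) [1..<Suc N])"
  have fst: "map fst ps = sdet_list"
    unfolding ps_def sdet_list_def by (simp only: map_concat map_map comp_def list.map fst_conv)
  have snd: "map snd ps = concat (map (\<lambda>i. sk.Sop i # map (sk.Rop i) [Suc i..<Suc N]) [1..<Suc N])"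
    unfolding ps_def by (simp only: map_concat map_map comp_def list.map snd_conv)
  have tr: "transfers q N M f" if mem: "(M, f) \<in> set ps" for M f
  proof -
    from mem obtain i where i: "i \<in> set [1..<Suc N]"
      "(M, f) \<in> set ((Smat i, sk.Sop i) # map (\<lambda>j. (in_copies N i j (Rmat i j), sk.Rop i j)) [Suc i..<Suc N])"
      unfolding ps_def set_concat set_map[of _ "[1..<Suc N]"] by blast
    have iN: "i \<in> {1..N}" using i(1) by (simp only: set_upt atLeastLessThanSuc_atLeastAtMost)
    from i(2) consider "M = Smat i" "f = sk.Sop i"
      | j where "j \<in> set [Suc i..<Suc N]" "M = in_copies N i j (Rmat i j)" "f = sk.Rop i j"
      unfolding list.set set_map by blast
    then show ?thesis
    proof cases
      case 1
      show ?thesis unfolding 1 by (rule transfers_in_copy[OF iN]) (rule S_eq[symmetric])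
    next
      case (2 j)
      have jN: "j \<in> {1..N}" "i \<noteq> j" using 2(1) iN by (auto simp del: upt_Suc)
      show ?thesis unfolding 2(2,3) by (rule transfers_in_copies[OF iN jN]) (rule Rmat_scal)
    qed
  qed
  let ?z = "iota q N 1 * scu (fls_const (asym q N a idx_id))"
  let ?K = "\<lambda>e. scu (sk.wt {1..N} (map e [1..<Suc N]))"
  have init: "iota q N (Anti a b) = ?z * ?K b" if b: "b \<in> multi_idx N N" for b
  proof -
    have "iota q N (Anti a b) = iota q N (1 * fls_scal (fls_const (asym q N a b)))"
      by (simp only: q_antisym_entry[OF q a b] fls_scal_const mult_1_left)
    also have "\<dots> = iota q N 1 * (?K b * scu (fls_const (asym q N a idx_id)))"
      by (simp only: iota_scal_right asym_wt[OF b])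
    also have "?K b * scu (fls_const (asym q N a idx_id)) = scu (fls_const (asym q N a idx_id)) * ?K b"
      by (rule scu.sc_central)
    finally show ?thesis by (simp only: mult.assoc)
  qed
  have "sdet_product q N a e = (\<Sum>b\<in>multi_idx N N. Anti a b * op_prod N N sdet_list b e)"
    unfolding sdet_product_eq by (simp add: op_prod_def op_mult_def)
  also have "\<dots> = run (map (rowm N) (map fst ps)) (Anti a) e" unfolding fst by (rule run_rowm[OF e])
  finally have "iota q N (sdet_product q N a e) = ?z * run (map snd ps) ?K e"
    by (simp only: transfers_run[OF tr init e])
  also have "run (map snd ps) ?K e = scu (gamma_N q N) * sk.sig 1 {1..N} (map e [1..<Suc N])"
    unfolding snd gamma_eq
  proof (rule sk.run_sdet)
    show "1 \<le> N" using N by simp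
    show "sk.good e" unfolding sk.good_def using multi_idx_mem[OF e] by blast
  qed
  finally show ?thesis .
qed

abbreviation "sig0 \<equiv> sk.sig 1 {1..N} [1..<Suc N]"

lemma sdet_id_iota: "iota q N (sdet_product q N idx_id idx_id) = iota q N 1 * (scu (gamma_N q N) * sig0)"
  unfolding sdet_product_iota[OF idx_id_in idx_id_in] asym_id map_idx_id by simp

text \<open>On both sides the column multi-index enters only through its q-sign, on the left because
  \<open>sig\<close> is q-alternating in its columns.\<close>

lemma sdet_product_antisym:
  assumes a: "a \<in> multi_idx N N" and b: "b \<in> multi_idx N N"
  shows "iota q N (sdet_product q N a b) = iota q N (Anti a b * sdet_product q N idx_id idx_id)"
proof -
  let ?xs = "map b [1..<Suc N]"
  let ?w = "scu (sk.wt {1..N} ?xs)" and ?a = "scu (fls_const (asym q N a idx_id))" and ?g = "scu (gamma_N q N)"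
  have sig: "sk.sig 1 {1..N} ?xs = ?w * sig0"
    by (rule sk.alternating_eq_wt[OF sk.alternating_sig multi_idx_list[OF b]])
  have "iota q N (Anti a b * sdet_product q N idx_id idx_id) = (?w * ?a) * (iota q N 1 * (?g * sig0))"
    unfolding q_antisym_entry[OF q a b] unfolding fls_scal_const[symmetric] iota_scal_left sdet_id_iota asym_wt[OF b] by (rule refl)
  also have "\<dots> = iota q N 1 * ((?w * ?a) * (?g * sig0))" by (rule iota_one_left_commute)
  also have "(?w * ?a) * (?g * sig0) = ?a * (?g * (?w * sig0))"
    by (simp only: scu.sc_sc scu.sc_mult[symmetric] mult_ac)
  finally show ?thesis
    unfolding sdet_product_iota[OF a b] sig by (simp only: mult.assoc)
qed

lemma sdet_list_Zset:
  assumes M: "M \<in> set (Anti # sdet_list)" and a: "a \<in> multi_idx N N" and b: "b \<in> multi_idx N N"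
  shows "M a b \<in> Zset q N"
proof -
  have z1: "Anti a b \<in> Zset q N"
    unfolding q_antisym_entry[OF q a b] unfolding fls_scal_const[symmetric] by (rule Zset_scal)
  have z2: "Smat i a b \<in> Zset q N" if "i \<in> {1..N}" for i
    unfolding in_copy_def using Zset_s[OF multi_idx_mem[OF a that] multi_idx_mem[OF b that]] Zset_0
    by (simp only: split: if_split) blast
  have z3: "in_copies N i j (Rmat i j) a b \<in> Zset q N" for i j
    by (rule Zset_in_copies) (simp only: Rmat_scal Zset_scal)
  from M have "M = Anti \<or> M \<in> set sdet_list" by (simp only: list.set insert_iff)
  then have "M = Anti \<or> (\<exists>i\<in>set [1..<Suc N]. M = Smat i \<or> M \<in> (\<lambda>j. in_copies N i j (Rmat i j)) ` set [Suc i..<Suc N])"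
    unfolding sdet_list_def set_concat_map_Cons .
  then show ?thesis
  proof (elim disjE bexE imageE)
    assume "M = Anti"
    then show ?thesis by (simp only: z1)
  next
    fix i assume i: "i \<in> set [1..<Suc N]" "M = Smat i"
    have "i \<in> {1..N}" using i(1) by (simp only: set_upt atLeastLessThanSuc_atLeastAtMost)
    then show ?thesis unfolding i(2) by (rule z2)
  next
    fix i j assume "M = in_copies N i j (Rmat i j)"
    then show ?thesis by (simp only: z3)
  qed
qed

lemma sdet_product_id_Zset: "sdet_product q N idx_id idx_id \<in> Zset q N"
  unfolding sdet_product_eq
proof (rule Zset_op_prod[OF _ idx_id_in idx_id_in])
  fix M assume M: "M \<in> set (Anti # sdet_list)"
  show "Zentries q N M" unfolding Zentries_def by (intro ballI sdet_list_Zset[OF M])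
qed

text \<open>Existence: A^q_N has the entry 1 at the identity multi-indices, so the entry of the
  product at this place is a Sklyanin determinant, which justifies the choice in
  \<open>sdet\<close>.\<close>

lemma is_sdet_id: "is_sdet q N (sdet_product q N idx_id idx_id)"
  unfolding is_sdet_def
proof (intro conjI allI ballI)
  show "uq_series q N (sdet_product q N idx_id idx_id) k \<in> Ytw q N" for k
    by (rule Zset_uq_series[OF sdet_product_id_Zset])
  show "uq_series q N (sdet_product q N a b) = uq_series q N (Anti a b * sdet_product q N idx_id idx_id)"
    if "a \<in> multi_idx N N" "b \<in> multi_idx N N" for a b
    by (rule uq_series_eq_iff[THEN iffD2, OF sdet_product_antisym[OF that]])
qed

text \<open>Uniqueness: any representative is recovered, modulo the relations, from that same
  entry.\<close>

lemma sdet_iota: "iota q N (sdet q N) = iota q N 1 * (scu (gamma_N q N) * sig0)"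
proof -
  have "is_sdet q N (sdet q N)" unfolding sdet_def by (rule someI[of "is_sdet q N", OF is_sdet_id])
  then have "iota q N (sdet_product q N idx_id idx_id) = iota q N (Anti idx_id idx_id * sdet q N)"
    unfolding is_sdet_def uq_series_eq_iff using idx_id_in by blast
  also have "Anti idx_id idx_id = 1"
    unfolding q_antisym_entry[OF q idx_id_in idx_id_in] asym_id unfolding scal_fls_def by simp
  finally show ?thesis unfolding sdet_id_iota by simp
qed

lemma gamma_nz: "gamma_N q N \<noteq> 0"
proof -
  have "inverse (uu q i) - uu q j \<noteq> 0" for i j using sk.nz1[of i j] by simp
  moreover have "finite {(i, j). 1 \<le> i \<and> i < j \<and> j \<le> N}"
    by (rule finite_subset[of _ "{..N} \<times> {..N}"]) auto
  ultimately show ?thesis unfolding gamma_eq by (simp add: prod_zero_iff case_prod_beta)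
qed

text \<open>The scalars of the R-matrices multiply to gamma_N(u), exactly the factor divided out in
  c(u).\<close>

lemma c_ser_iota: "iota q N (c_ser q N) = iota q N 1 * sig0"
proof -
  have "iota q N (c_ser q N) = scu (inverse (gamma_N q N)) * (iota q N 1 * (scu (gamma_N q N) * sig0))"
    unfolding c_ser_def iota_scal_left sdet_iota by (rule refl)
  also have "\<dots> = iota q N 1 * (scu (inverse (gamma_N q N)) * (scu (gamma_N q N) * sig0))"
    by (rule iota_one_left_commute)
  also have "scu (inverse (gamma_N q N)) * (scu (gamma_N q N) * sig0) = sig0"
    unfolding scu.sc_sc using gamma_nz by simp
  finally show ?thesis .
qed

text \<open>Identifies (-q)^{-l(p)+l(p')} with the powers of \<kappa> = -1/q and of its inverse that
  the expansion attaches to p and p'.\<close>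

lemma coefficient_eq:
  "fls_const ((- q) powi (- int a + int b)) = (- inverse (fls_const q)) ^ a * inverse (- inverse (fls_const q)) ^ b"
proof -
  have "(- q) powi (- int a + int b) = (- q) powi (- int a) * (- q) powi (int b)"
    using q by (intro power_int_add) simp
  also have "\<dots> = (- inverse q) ^ a * (- q) ^ b"
    by (simp add: power_int_minus power_inverse[symmetric] inverse_minus_eq)
  finally have e: "(- q) powi (- int a + int b) = (- inverse q) ^ a * (- q) ^ b" .
  have i: "- inverse (fls_const q) = fls_const (- inverse q)"
    by (simp only: fls_const_minus fls_inverse_const)
  have j: "inverse (- inverse (fls_const q)) = fls_const (- q)"
    unfolding i unfolding fls_inverse_const by simp
  have "fls_const ((- inverse q) ^ a * (- q) ^ b) = fls_const (- inverse q) ^ a * fls_const (- q) ^ b"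
    by (metis fls_const_mult_const fls_const_power)
  then show ?thesis unfolding e j unfolding i .
qed

lemma c_ser_formula:
  assumes n: "N = 2 * n \<or> N = 2 * n + 1"
  shows "uq_series q N (c_ser q N) =
    uq_series q N (\<Sum>p | p permutes {1..N}.
      scal_fls ((- q) powi (- int (inversions N p) + int (inversions N (perm_prime N p))))
      * prod_list (map (\<lambda>i. subst_ser (q powi (2 * int i - 2)) (sbar_t_ser N (p i) (perm_prime N p i)))
          [1..<Suc n])
      * prod_list (map (\<lambda>i. subst_ser (q powi (2 * int i - 2)) (s_ser N (p i) (perm_prime N p i)))
          [Suc n..<Suc N]))"
  unfolding uq_series_eq_iff c_ser_iota sk.sig_perm_expansion[OF N n] iota_sum sum_distrib_left
proof (rule sum.cong[OF refl])
  fix p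
  let ?x = "- int (inversions N p) + int (inversions N (perm_prime N p))"
  let ?B = "map (\<lambda>i. subst_ser (q powi (2 * int i - 2)) (sbar_t_ser N (p i) (perm_prime N p i))) [1..<Suc n]"
  let ?C = "map (\<lambda>i. subst_ser (q powi (2 * int i - 2)) (s_ser N (p i) (perm_prime N p i))) [Suc n..<Suc N]"
  let ?B' = "map (\<lambda>i. sk.Sb i (p i) (perm_prime N p i)) [1..<Suc n]"
  let ?C' = "map (\<lambda>i. sk.S i (p i) (perm_prime N p i)) [Suc n..<Suc N]"
  have B: "map (iota q N) ?B = ?B'" and C: "map (iota q N) ?C = ?C'"
    by (simp_all only: map_map comp_def Sb_eq S_eq)
  have "iota q N (scal_fls ((- q) powi ?x) * prod_list ?B * prod_list ?C) =
     scu (fls_const ((- q) powi ?x)) * ((iota q N 1 * prod_list ?B') * (iota q N 1 * prod_list ?C'))"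
    unfolding fls_scal_const[symmetric] mult.assoc iota_scal_left iota_mult[of q N "prod_list ?B"] iota_prod_list B C by (rule refl)
  also have "\<dots> = iota q N 1 * iota q N 1 * (scu (fls_const ((- q) powi ?x)) * (prod_list ?B' * prod_list ?C'))"
    by (simp only: mult.assoc iota_one_left_commute[of "prod_list ?B'"] iota_one_left_commute[of "scu (fls_const ((- q) powi ?x))"])
  \<comment> \<open>One idempotent stems from each of the two products of factors.\<close>
  also have "iota q N 1 * iota q N 1 = iota q N 1" by (rule iota_one_left)
  finally show "iota q N 1 * (scu ((- inverse (fls_const q)) ^ inversions N p * inverse (- inverse (fls_const q)) ^ inversions N (perm_prime N p)) *
      (prod_list ?B' * prod_list ?C')) = iota q N (scal_fls ((- q) powi ?x) * prod_list ?B * prod_list ?C)"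
    unfolding coefficient_eq by (rule sym)
qed

end

theorem theorem4p7:
  fixes q :: complex and N n :: nat
  assumes "q \<noteq> 0" and "\<And>k::nat. k > 0 \<Longrightarrow> q ^ k \<noteq> 1"
    and "N \<ge> 2" and "N = 2 * n \<or> N = 2 * n + 1"
  shows "uq_series q N (c_ser q N) =
    uq_series q N (\<Sum>p | p permutes {1..N}.
      scal_fls ((- q) powi (- int (inversions N p) + int (inversions N (perm_prime N p))))
      * prod_list (map (\<lambda>i. subst_ser (q powi (2 * int i - 2)) (sbar_t_ser N (p i) (perm_prime N p i)))
          [1..<Suc n])
      * prod_list (map (\<lambda>i. subst_ser (q powi (2 * int i - 2)) (s_ser N (p i) (perm_prime N p i)))
          [Suc n..<Suc N]))"
  by (rule c_ser_formula[OF assms])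

end
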